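(* Let $p>0$, let $g:\mathbb{R}^n\to[0,\infty)$ be a continuous function that is $p$-concave and $\frac1p$-homogeneous, and let $\mu$ be the measure on $\mathbb{R}^n$ with density $g$ with respect to Lebesgue measure. Let $(u_i)_{i=1}^m$ be unit vectors in $\mathbb{R}^n$ and $(c_i)_{i=1}^m$ positive constants such that $$\sum_{i=1}^m c_i\,u_i\otimes u_i=I_n,$$ and suppose moreover that $[-u,u]\cap\operatorname{supp}(g)\neq\varnothing$ for each $u\in\mathcal{P}=\mathcal{P}((u_i)_{i=1}^m)$. Then for any convex body $K\subset\mathbb{R}^n$, $$\mu(K)^{n+\frac1p-1}\le 2^{n+\frac1p}\left(\inf_{u\in\mathcal{P}}\tilde g(u)\right)^{-1}\prod_{k=1}^n\left(1+\frac{1}{kp}\right)\prod_{i=1}^m P_{\mu,K}(u_i)^{c_i\left(1+\frac{1}{pn}\right)}.$$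
   Context: A convex body is a compact convex subset of $\mathbb{R}^n$ with nonempty interior. For a function $g$ on $\mathbb{R}^n$ with nonnegative values, $\operatorname{supp}(g)=\{x: g(x)>0\}$ (not its closure). The function $g$ is $p$-concave ($p>0$) if for all $\lambda\in[0,1]$ and all $x,y\in\operatorname{supp}(g)$, $g(\lambda x+(1-\lambda)y)\ge(\lambda g^p(x)+(1-\lambda)g^p(y))^{1/p}$, where $g^p(x)=g(x)^p$. It is $r$-homogeneous if $g(ax)=a^r g(x)$ for all $a>0$, $x\in\mathbb{R}^n$. Write $\tilde g(x)=g(x)+g(-x)$. For $\theta\in\mathbb{R}^n$, $[-\theta,\theta]=\{t\theta: t\in[-1,1]\}$. For a unit vector $u$, $u\otimes u$ is the rank-one map $x\mapsto\langle x,u\rangle u$, and $I_n$ is the identity on $\mathbb{R}^n$. For measurable sets $A,B\subset\mathbb{R}^n$ the mixed $\mu$-measure is $$\mu_1(A,B)=\liminf_{\varepsilon\to0^+}\frac{\mu(A+\varepsilon B)-\mu(A)}{\varepsilon},$$ where $A+\varepsilon B$ is the Minkowski sum. For a unit vector $\theta\in S^{n-1}$ and a convex body $K$, $$P_{\mu,K}(\theta)=\frac n2\int_0^1\mu_1(tK,[-\theta,\theta])\,dt.$$ The finite set $\mathcal{P}$: for a finite set $\mathcal{S}$ of unit vectors in $\mathbb{R}^n$, let $\mathcal{S}^{(1)}$ be the set of all vectors $\frac{v-\langle v,w\rangle w}{|v-\langle v,w\rangle w|}$ with $v,w\in\mathcal{S}$ and $v-\langle v,w\rangle w\neq0$ (normalized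 projections of $v$ onto the hyperplane $w^\perp$). Put $\mathcal{S}^{(k)}=(\mathcal{S}^{(k-1)})^{(1)}$ for $k\ge2$. With $\mathcal{S}=\{u_1,\dots,u_m\}$, $$\mathcal{P}((u_i)_{i=1}^m)=\mathcal{S}\cup\mathcal{S}^{(1)}\cup\dots\cup\mathcal{S}^{(n-1)}$$ (for $n=1$ this is just $\mathcal{S}$). *)

theory Defs
  imports "HOL-Analysis.Analysis"
begin

definition convex_body :: "'a::euclidean_space set \<Rightarrow> bool" where
  "convex_body K \<longleftrightarrow> compact K \<and> convex K \<and> interior K \<noteq> {}"

text \<open>The support is not closed.\<close>

definition supp :: "('a \<Rightarrow> real) \<Rightarrow> 'a set" where
  "supp g = {x. g x > 0}"

definition p_concave :: "real \<Rightarrow> ('a::real_vector \<Rightarrow> real) \<Rightarrow> bool" where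
  "p_concave p g \<longleftrightarrow>
     (\<forall>l\<in>{0..1}. \<forall>x\<in>supp g. \<forall>y\<in>supp g.
        g (l *\<^sub>R x + (1 - l) *\<^sub>R y)
          \<ge> (l * g x powr p + (1 - l) * g y powr p) powr (1 / p))"

definition homogeneous :: "real \<Rightarrow> ('a::real_vector \<Rightarrow> real) \<Rightarrow> bool" where
  "homogeneous r g \<longleftrightarrow> (\<forall>a>0. \<forall>x. g (a *\<^sub>R x) = a powr r * g x)"

definition sym_sum :: "('a::real_vector \<Rightarrow> real) \<Rightarrow> 'a \<Rightarrow> real" where
  "sym_sum g x = g x + g (- x)"

definition sym_segment :: "'a::real_vector \<Rightarrow> 'a set" where
  "sym_segment \<theta> = {t *\<^sub>R \<theta> | t. t \<in> {-1..1}}"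

text \<open>The map \<open>u \<otimes> u\<close>.\<close>

definition rank_one :: "'a::real_inner \<Rightarrow> 'a \<Rightarrow> 'a" where
  "rank_one u x = (x \<bullet> u) *\<^sub>R u"

definition density_measure :: "('a::euclidean_space \<Rightarrow> real) \<Rightarrow> 'a measure" where
  "density_measure g = density lborel (\<lambda>x. ennreal (g x))"

text \<open>The lower limit is taken in the extended reals, so that it always exists and the
  difference may be negative. The sum of sets is the Minkowski sum.\<close>

definition mixed_measure :: "'a::euclidean_space measure \<Rightarrow> 'a set \<Rightarrow> 'a set \<Rightarrow> ereal" where
  "mixed_measure M A B =
     Liminf (at_right 0)
       (\<lambda>\<epsilon>::real. (enn2ereal (emeasure M (A + (*\<^sub>R) \<epsilon> ` B)) - enn2ereal (emeasure M A)) / ereal \<epsilon>)"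

text \<open>For a convex body \<open>K\<close> and a measure with continuous density the integrand is finite, so
  \<^const>\<open>real_of_ereal\<close> loses nothing: if \<open>K\<close> contains a ball of radius \<open>r\<close> and
  \<open>t > 0\<close>, then \<open>tK + \<epsilon>[-\<theta>,\<theta>]\<close> contains \<open>tK\<close> and lies in a translate of
  \<open>(1 + \<epsilon>/(tr))tK\<close>, so its measure exceeds that of \<open>tK\<close> by \<open>O(\<epsilon>)\<close>. For a homogeneous density
  the integrand is moreover a constant times a power of \<open>t\<close> on \<open>(0,1]\<close>.\<close>

definition P_functional ::
    "(real^'n) measure \<Rightarrow> (real^'n) set \<Rightarrow> real^'n \<Rightarrow> real" where
  "P_functional M K \<theta> =
     real CARD('n) / 2 *
       (LBINT t:{0..1}. real_of_ereal (mixed_measure M ((*\<^sub>R) t ` K) (sym_segment \<theta>)))"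

definition proj_set :: "'a::real_inner set \<Rightarrow> 'a set" where
  "proj_set S =
     {(1 / norm (v - (v \<bullet> w) *\<^sub>R w)) *\<^sub>R (v - (v \<bullet> w) *\<^sub>R w) | v w.
        v \<in> S \<and> w \<in> S \<and> v - (v \<bullet> w) *\<^sub>R w \<noteq> 0}"

definition proj_closure :: "(real^'n) set \<Rightarrow> (real^'n) set" where
  "proj_closure S = (\<Union>k\<in>{0..CARD('n) - 1}. (proj_set ^^ k) S)"

end

theory Submission imports Defs "HOL-Probability.Probability" begin

text \<open>Write \<open>r = 1/p\<close> and \<open>q = n + r\<close>. The Prekopa-Leindler inequality and homogeneity make
  \<open>\<mu>\<^bsup>1/q\<^esup>\<close> superadditive under Minkowski addition, and differentiating \<open>\<mu>(K + \<epsilon>Z)\<close> at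
  \<open>\<epsilon> = 0\<close> for a zonotope \<open>Z = \<Sum>\<^sub>i a\<^sub>i [-u\<^sub>i, u\<^sub>i]\<close> gives
  \<open>q \<mu>(K)\<^bsup>1-1/q\<^esup> \<mu>(Z)\<^bsup>1/q\<^esup> \<le> \<Sum>\<^sub>i a\<^sub>i \<mu>\<^sub>1(K, [-u\<^sub>i, u\<^sub>i])\<close>. By homogeneity \<open>\<mu>\<^sub>1(K, [-u\<^sub>i, u\<^sub>i])\<close> is
  \<open>2q/n\<close> times the value of the functional at \<open>u\<^sub>i\<close>, so for \<open>a\<^sub>i = c\<^sub>i / P(u\<^sub>i)\<close> the right-hand side is
  \<open>2q\<close>.

  For a lower bound on \<open>\<mu>(Z)\<close>, choose signs such that \<open>w\<^sub>i = \<plusminus>u\<^sub>i\<close> lies in the support of \<open>g\<close>.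
  Then \<open>Z\<close> contains \<open>\<Sum>\<^sub>i a\<^sub>i [0, w\<^sub>i]\<close>, where superadditivity of \<open>g\<^sup>p\<close> gives
  \<open>g(\<Sum>\<^sub>i b\<^sub>i w\<^sub>i) \<ge> \<gamma> (\<Sum>\<^sub>i b\<^sub>i)\<^bsup>r\<^esup>\<close> with \<open>\<gamma>\<close> the infimum in the statement. The integral
  of the right-hand side over this zonotope is estimated by Barthe's proof of the reverse
  Brascamp-Lieb inequality, that is, by a monotone transport of the Gaussian measure together with
  \<open>det(\<Sum>\<^sub>i c\<^sub>i l\<^sub>i u\<^sub>i \<otimes> u\<^sub>i) \<ge> \<Prod>\<^sub>i l\<^sub>i powr c\<^sub>i\<close>.\<close>

section \<open>The Prekopa-Leindler inequality\<close>

text \<open>No regularity of the boundary of \<open>K\<close> is at hand, so \<mu>(K + \<epsilon>Z)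
  is differentiated at 0 line by line: adding a one-sided segment [0, v] lengthens each chord of
  direction v at one end, and in the limit only the density at that end counts. The symmetric
  segment is the sum of two such segments, and a zonotope is built from them one at a time, so that
  the derivative becomes linear in the a_i.

  The a_i equalise the contributions of the generators: taking traces in the decomposition of the
  identity gives \<Sum> c_i = n, and raising the resulting bound to the power q produces the factor
  2^q. Since P(u_i) is only known to be nonnegative, it is replaced by P(u_i) + \<eta>, and \<eta>
  tends to 0 at the end.

  Homogeneity forces g(0) = 0, so concavity excludes that g is positive at both u and -u. The
  symmetrised density at u_i is therefore the value of g at w_i.

  The transport produces (1 + 1/(pn))^n; each of these n equal factors is at most 1 + 1/(kp) for k
  \<le> n, whence the product in the statement.\<close>

lemma brunn_minkowski_1:
  fixes A B C :: "real set"
  assumes A: "A \<in> sets lborel" "bounded A" "A \<noteq> {}" and B: "B \<in> sets lborel" "bounded B" "B \<noteq> {}"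
    and C: "C \<in> sets lborel" "\<And>x y. x \<in> A \<Longrightarrow> y \<in> B \<Longrightarrow> x + y \<in> C"
  shows "emeasure lborel A + emeasure lborel B \<le> emeasure lborel C"
proof -
  \<comment> \<open>Compact subsets of almost full measure are used because they have extreme
    points. Adjoining a point \<open>s\<close> of \<open>S\<close> keeps the approximation
    nonempty.\<close>
  have cpt: "\<exists>T. compact T \<and> T \<noteq> {} \<and> T \<subseteq> S \<and> emeasure lborel S \<le> emeasure lborel T + ennreal e"
    if S: "S \<in> sets lborel" "bounded S" "S \<noteq> {}" and e: "e > 0" for S :: "real set" and e :: real
  proof -
    obtain T where T: "closed T" "T \<subseteq> S" "S - T \<in> lmeasurable" "emeasure lebesgue (S - T) < ennreal e"
      using sets_lebesgue_inner_closed[of S e] S e by auto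
    obtain s where s: "s \<in> S" using S by auto
    have cT: "compact (insert s T)"
      using T S bounded_subset compact_eq_bounded_closed by (metis compact_insert)
    have TB: "insert s T \<in> sets borel" using cT by (simp add: borel_compact)
    have "emeasure lborel S \<le> emeasure lborel (insert s T \<union> (S - insert s T))"
      using S TB by (intro emeasure_mono sets.Un sets.Diff) auto
    also have "\<dots> \<le> emeasure lborel (insert s T) + emeasure lborel (S - insert s T)"
      using S TB by (intro emeasure_subadditive sets.Diff) auto
    also have "emeasure lborel (S - insert s T) = emeasure lebesgue (S - insert s T)"
      using S TB by (simp add: sets.Diff)
    also have "\<dots> \<le> emeasure lebesgue (S - T)"
      using T by (intro emeasure_mono) auto
    also have "\<dots> \<le> ennreal e" using T by simp
    finally have "emeasure lborel S \<le> emeasure lborel (insert s T) + ennreal e" 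
      by (simp add: add_left_mono)
    then show ?thesis using cT T s by (intro exI[of _ "insert s T"]) auto
  qed
  show ?thesis
  proof (rule ennreal_le_epsilon)
    fix e :: real assume e: "0 < e"
    obtain S where S: "compact S" "S \<noteq> {}" "S \<subseteq> A" "emeasure lborel A \<le> emeasure lborel S + ennreal (e/2)"
      using cpt[OF A, of "e/2"] e by auto
    obtain T where T: "compact T" "T \<noteq> {}" "T \<subseteq> B" "emeasure lborel B \<le> emeasure lborel T + ennreal (e/2)"
      using cpt[OF B, of "e/2"] e by auto
    \<comment> \<open>With s = max S and t = min T, the translates t + S and s + T lie in S + T and
      meet only at s + t: the first ends where the second begins.\<close>
    obtain s where s: "s \<in> S" "\<And>x. x \<in> S \<Longrightarrow> x \<le> s" using compact_attains_sup[OF S(1,2)] by auto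
    obtain t where t: "t \<in> T" "\<And>x. x \<in> T \<Longrightarrow> t \<le> x" using compact_attains_inf[OF T(1,2)] by auto
    have eq: "emeasure lborel ((+) c ` X) = emeasure lborel X" if "compact X" for c and X :: "real set"
    proof -
      have "emeasure lborel X = emeasure (distr lborel borel ((+) (-c))) X"
        using lborel_distr_plus[of "-c"] by simp
      also have "\<dots> = emeasure lborel ((+) (-c) -` X)"
        using that by (subst emeasure_distr) (auto simp: borel_compact)
      also have "(+) (-c) -` X = (+) c ` X" by (auto simp: image_iff intro!: bexI[of _ "_ - c"])
      finally show ?thesis by simp
    qed
    have S': "(+) t ` S \<in> sets borel" and T': "(+) s ` T \<in> sets borel"
      using S T by (auto intro!: borel_compact compact_translation)
    have "emeasure lborel S + emeasure lborel T = emeasure lborel ((+) t ` S) + emeasure lborel ((+) s ` T)"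
      using S T by (simp add: eq)
    also have "\<dots> = emeasure lborel ((+) t ` S) + emeasure lborel ((+) s ` T - {s+t})"
      using T' by (subst emeasure_Diff_null_set[of "{s+t}"]) (auto simp: null_sets_def)
    also have "\<dots> = emeasure lborel ((+) t ` S \<union> ((+) s ` T - {s+t}))"
      using S' T' s t by (intro plus_emeasure) (auto, force)
    also have "\<dots> \<le> emeasure lborel C"
    proof (intro emeasure_mono)
      have "t + x \<in> C" if "x \<in> S" for x
        using C(2)[of x t] that t S(3) T(3) by (auto simp: add.commute)
      moreover have "s + x \<in> C" if "x \<in> T" for x
        using C(2)[of s x] that s S(3) T(3) by auto
      ultimately show "(+) t ` S \<union> ((+) s ` T - {s + t}) \<subseteq> C" by auto
    qed (use C(1) in blast)
    finally have 1: "emeasure lborel S + emeasure lborel T \<le> emeasure lborel C" .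
    have "emeasure lborel A + emeasure lborel B \<le> (emeasure lborel S + ennreal (e/2)) + (emeasure lborel T + ennreal (e/2))"
      using S T by (intro add_mono)
    also have "\<dots> = (emeasure lborel S + emeasure lborel T) + ennreal e"
      using e by (simp add: ac_simps flip: ennreal_plus)
    also have "\<dots> \<le> emeasure lborel C + ennreal e" using 1 by (rule add_right_mono)
    finally show "emeasure lborel A + emeasure lborel B \<le> emeasure lborel C + ennreal e" .
  qed
qed

text \<open>The relation \<open>C \<ge> A\<^bsup>1-t\<^esup> B\<^bsup>t\<^esup>\<close> for extended reals without powers of \<open>\<infinity>\<close>; hypothesis and
  conclusion of the Prekopa-Leindler inequality then have the same shape, so that it can be iterated
  over the coordinates without integrability conditions.\<close>

definition geo_le :: "real \<Rightarrow> ennreal \<Rightarrow> ennreal \<Rightarrow> ennreal \<Rightarrow> bool" where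
  "geo_le t A B C \<longleftrightarrow>
     (\<forall>a>0. \<forall>b>0. ennreal a < A \<longrightarrow> ennreal b < B \<longrightarrow> ennreal (a powr (1 - t) * b powr t) \<le> C)"

lemma geo_leD:
  "geo_le t A B C \<Longrightarrow> 0 < a \<Longrightarrow> 0 < b \<Longrightarrow> ennreal a < A \<Longrightarrow> ennreal b < B
    \<Longrightarrow> ennreal (a powr (1 - t) * b powr t) \<le> C"
  by (simp add: geo_le_def)

section \<open>Scaling and layer-cake estimates on the line\<close>

lemma emeasure_lborel_scale:
  fixes A :: "real set"
  assumes A: "A \<in> sets borel" and c: "c > 0"
  shows "(*) c ` A \<in> sets borel" "emeasure lborel ((*) c ` A) = ennreal c * emeasure lborel A"
proof -
  have eq: "(*) c ` A = (*) (inverse c) -` A"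
    using c by (auto simp: image_iff field_simps intro!: bexI[of _ "_ / c"])
  have m: "(*) (inverse c) \<in> borel_measurable borel" by simp
  show "(*) c ` A \<in> sets borel" unfolding eq using measurable_sets[OF m A] by simp
  have "emeasure lborel ((*) c ` A) = emeasure (distr lborel borel ((*) (inverse c))) A"
    using A by (simp add: eq emeasure_distr)
  also have "\<dots> = emeasure (density lborel (\<lambda>_. inverse \<bar>inverse c\<bar>)) A"
    using c by (subst lborel_distr_mult) auto
  also have "\<dots> = ennreal c * emeasure lborel A"
    using c A by (simp add: emeasure_density nn_integral_cmult)
  finally show "emeasure lborel ((*) c ` A) = ennreal c * emeasure lborel A" .
qed

lemma brunn_minkowski_1_convex:
  fixes A B C :: "real set"
  assumes A: "A \<in> sets lborel" "bounded A" "A \<noteq> {}" and B: "B \<in> sets lborel" "bounded B" "B \<noteq> {}"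
    and C: "C \<in> sets lborel" "\<And>x y. x \<in> A \<Longrightarrow> y \<in> B \<Longrightarrow> (1 - t) * x + t * y \<in> C" and t: "0 < t" "t < 1"
  shows "ennreal (1 - t) * emeasure lborel A + ennreal t * emeasure lborel B \<le> emeasure lborel C"
proof -
  have "emeasure lborel ((*) (1 - t) ` A) + emeasure lborel ((*) t ` B) \<le> emeasure lborel C"
  proof (rule brunn_minkowski_1)
    show "(*) (1 - t) ` A \<in> sets lborel" "(*) t ` B \<in> sets lborel"
      using A B t by (simp_all add: emeasure_lborel_scale)
    show "bounded ((*) (1 - t) ` A)" "bounded ((*) t ` B)"
      using bounded_scaling[OF A(2), of "1 - t"] bounded_scaling[OF B(2), of t] by simp_all
  qed (use A B C in auto)
  then show ?thesis using A B t by (simp add: emeasure_lborel_scale)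
qed

text \<open>The layer-cake formula cut off at height \<open>M\<close>: the levels below
  \<open>M\<close> recover the integral of the minimum of \<open>h\<close> and \<open>M\<close>. The
  parameter s in (0,1) allows functions with different suprema to be compared at equal relative
  height.\<close>

lemma nn_integral_level_le:
  fixes h :: "real \<Rightarrow> ennreal"
  assumes [measurable]: "h \<in> borel_measurable borel" and M: "M > 0"
  shows "ennreal M * (\<integral>\<^sup>+s. emeasure lborel {x. ennreal (s * M) \<le> h x} * indicator {0<..<1} s \<partial>lborel)
    \<le> (\<integral>\<^sup>+x. h x \<partial>lborel)"
proof -
  have "(\<integral>\<^sup>+s. emeasure lborel {x. ennreal (s * M) \<le> h x} * indicator {0<..<1} s \<partial>lborel)
     = (\<integral>\<^sup>+s. (\<integral>\<^sup>+x. (if ennreal (s * M) \<le> h x \<and> 0 < s \<and> s < 1 then 1 else 0) \<partial>lborel) \<partial>lborel)"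
  proof (intro nn_integral_cong)
    fix s :: real
    have "(\<integral>\<^sup>+x. (if ennreal (s * M) \<le> h x \<and> 0 < s \<and> s < 1 then 1 else 0) \<partial>lborel)
      = (\<integral>\<^sup>+x. indicator {x. ennreal (s * M) \<le> h x} x * indicator {0<..<1} s \<partial>lborel)"
      by (intro nn_integral_cong) (auto simp: indicator_def)
    then show "emeasure lborel {x. ennreal (s * M) \<le> h x} * indicator {0<..<1} s
      = (\<integral>\<^sup>+x. (if ennreal (s * M) \<le> h x \<and> 0 < s \<and> s < 1 then 1 else 0) \<partial>lborel)"
      by (simp add: nn_integral_multc)
  qed
  also have "\<dots> = (\<integral>\<^sup>+x. (\<integral>\<^sup>+s. (if ennreal (s * M) \<le> h x \<and> 0 < s \<and> s < 1 then 1 else 0) \<partial>lborel) \<partial>lborel)"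
    by (rule lborel_pair.Fubini') simp
  finally have eq: "(\<integral>\<^sup>+s. emeasure lborel {x. ennreal (s * M) \<le> h x} * indicator {0<..<1} s \<partial>lborel)
     = (\<integral>\<^sup>+x. (\<integral>\<^sup>+s. (if ennreal (s * M) \<le> h x \<and> 0 < s \<and> s < 1 then 1 else 0) \<partial>lborel) \<partial>lborel)" .
  have "ennreal M * (\<integral>\<^sup>+s. (if ennreal (s * M) \<le> h x \<and> 0 < s \<and> s < 1 then 1 else 0) \<partial>lborel) \<le> h x" for x
  proof (cases "h x = \<infinity>")
    case False
    then obtain k where k: "h x = ennreal k" "k \<ge> 0" by (cases "h x") auto
    have "(\<integral>\<^sup>+s. (if ennreal (s * M) \<le> h x \<and> 0 < s \<and> s < 1 then 1 else 0) \<partial>lborel)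
      \<le> (\<integral>\<^sup>+s. indicator {0..k/M} s \<partial>lborel)"
      using k M by (intro nn_integral_mono) (auto simp: indicator_def field_simps)
    also have "\<dots> = ennreal (k/M)" using k M by simp
    finally have "ennreal M * (\<integral>\<^sup>+s. (if ennreal (s * M) \<le> h x \<and> 0 < s \<and> s < 1 then 1 else 0) \<partial>lborel)
       \<le> ennreal M * ennreal (k/M)" by (rule mult_left_mono) simp
    also have "\<dots> = ennreal k" using M k by (simp flip: ennreal_mult')
    finally show ?thesis using k by simp
  qed auto
  then have "(\<integral>\<^sup>+x. ennreal M * (\<integral>\<^sup>+s. (if ennreal (s * M) \<le> h x \<and> 0 < s \<and> s < 1 then 1 else 0) \<partial>lborel) \<partial>lborel)
     \<le> (\<integral>\<^sup>+x. h x \<partial>lborel)" by (intro nn_integral_mono)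
  then show ?thesis unfolding eq by (subst (asm) nn_integral_cmult) simp_all
qed

text \<open>As \<open>f\<close> never exceeds \<open>M\<close>, the levels below \<open>M\<close>
  exhaust it. Strict superlevel sets are nonempty at every level below the supremum, which is how
  they will be used.\<close>

lemma nn_integral_le_level:
  fixes f :: "real \<Rightarrow> real"
  assumes [measurable]: "f \<in> borel_measurable borel" and M: "M > 0" and f: "\<And>x. 0 \<le> f x" "\<And>x. f x \<le> M"
  shows "(\<integral>\<^sup>+x. f x \<partial>lborel)
    \<le> ennreal M * (\<integral>\<^sup>+s. emeasure lborel {x. s * M < f x} * indicator {0<..<1} s \<partial>lborel)"
proof -
  have "(\<integral>\<^sup>+s. emeasure lborel {x. s * M < f x} * indicator {0<..<1} s \<partial>lborel)
     = (\<integral>\<^sup>+s. (\<integral>\<^sup>+x. (if s * M < f x \<and> 0 < s \<and> s < 1 then 1 else 0) \<partial>lborel) \<partial>lborel)"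
  proof (intro nn_integral_cong)
    fix s :: real
    have "(\<integral>\<^sup>+x. (if s * M < f x \<and> 0 < s \<and> s < 1 then 1 else 0) \<partial>lborel)
      = (\<integral>\<^sup>+x. indicator {x. s * M < f x} x * indicator {0<..<1} s \<partial>lborel)"
      by (intro nn_integral_cong) (auto simp: indicator_def)
    then show "emeasure lborel {x. s * M < f x} * indicator {0<..<1} s
      = (\<integral>\<^sup>+x. (if s * M < f x \<and> 0 < s \<and> s < 1 then 1 else 0) \<partial>lborel)"
      by (simp add: nn_integral_multc)
  qed
  also have "\<dots> = (\<integral>\<^sup>+x. (\<integral>\<^sup>+s. (if s * M < f x \<and> 0 < s \<and> s < 1 then 1 else 0) \<partial>lborel) \<partial>lborel)"
    by (rule lborel_pair.Fubini') simp
  finally have eq: "(\<integral>\<^sup>+s. emeasure lborel {x. s * M < f x} * indicator {0<..<1} s \<partial>lborel)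
     = (\<integral>\<^sup>+x. (\<integral>\<^sup>+s. (if s * M < f x \<and> 0 < s \<and> s < 1 then 1 else 0) \<partial>lborel) \<partial>lborel)" .
  have "ennreal (f x) \<le> ennreal M * (\<integral>\<^sup>+s. (if s * M < f x \<and> 0 < s \<and> s < 1 then 1 else 0) \<partial>lborel)" for x
  proof -
    have "ennreal (f x / M) = (\<integral>\<^sup>+s. indicator {0<..<f x/M} s \<partial>lborel)"
      using f[of x] M by simp
    also have "\<dots> \<le> (\<integral>\<^sup>+s. (if s * M < f x \<and> 0 < s \<and> s < 1 then 1 else 0) \<partial>lborel)"
    proof (intro nn_integral_mono)
      fix s :: real
      have "s < 1" if "s < f x / M"
        using that f(2)[of x] M by (intro order_less_le_trans[OF that]) simp
      then show "indicator {0<..<f x / M} s \<le> (if s * M < f x \<and> 0 < s \<and> s < 1 then 1 else 0 :: ennreal)"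
        using M by (auto simp: indicator_def field_simps)
    qed
    finally have "ennreal M * ennreal (f x / M) \<le> ennreal M * (\<integral>\<^sup>+s. (if s * M < f x \<and> 0 < s \<and> s < 1 then 1 else 0) \<partial>lborel)"
      by (rule mult_left_mono) simp
    then show ?thesis using M f(1)[of x] by (simp flip: ennreal_mult')
  qed
  then have "(\<integral>\<^sup>+x. f x \<partial>lborel) \<le> (\<integral>\<^sup>+x. ennreal M * (\<integral>\<^sup>+s. (if s * M < f x \<and> 0 < s \<and> s < 1 then 1 else 0) \<partial>lborel) \<partial>lborel)"
     by (intro nn_integral_mono)
  then show ?thesis unfolding eq by (subst (asm) nn_integral_cmult) simp_all
qed

text \<open>Reduces the one-dimensional inequality to bounded functions with bounded
  support.\<close>

lemma nn_integral_truncate: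
  fixes f :: "real \<Rightarrow> ennreal"
  assumes [measurable]: "f \<in> borel_measurable borel" and a: "ennreal a < (\<integral>\<^sup>+x. f x \<partial>lborel)"
  obtains N :: nat where "ennreal a < (\<integral>\<^sup>+x. min (f x) (of_nat N) * indicator {-real N..real N} x \<partial>lborel)"
proof -
  let ?F = "\<lambda>(N::nat) x. min (f x) (of_nat N) * indicator {-real N..real N} x"
  have "incseq ?F"
    by (auto simp: incseq_def le_fun_def indicator_def min_def intro: order_trans)
  moreover have "(SUP N. ?F N x) = f x" for x
  proof (rule antisym)
    show "(SUP N. ?F N x) \<le> f x" by (intro SUP_least) (auto simp: indicator_def)
    show "f x \<le> (SUP N. ?F N x)"
    proof (subst le_SUP_iff, intro allI impI)
      fix y assume y: "y < f x"
      then have "y < top" by (metis order_less_le_trans top_greatest)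
      then obtain n where n: "y < of_nat n" using ennreal_Ex_less_of_nat by (auto simp: less_top)
      obtain k :: nat where k: "\<bar>x\<bar> \<le> real k" using real_arch_simple by blast
      have "y < of_nat (max n k)" using n by (rule order_less_le_trans) simp
      then show "\<exists>i\<in>UNIV. y < ?F i x"
        using y k by (intro bexI[of _ "max n k"]) (auto simp: indicator_def)
    qed
  qed
  ultimately have "(\<integral>\<^sup>+x. f x \<partial>lborel) = (SUP N. \<integral>\<^sup>+x. ?F N x \<partial>lborel)"
    by (subst nn_integral_monotone_convergence_SUP[symmetric]) auto
  then show ?thesis using a that by (auto simp: less_SUP_iff)
qed

text \<open>After both functions are normalised to supremum 1, their superlevel sets at equal height
  satisfy Brunn-Minkowski on the line. Integration over the heights bounds the integral of
  \<open>h\<close> by an arithmetic mean, which is stronger than the geometric one.\<close>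

lemma prekopa_leindler_1:
  fixes f g h :: "real \<Rightarrow> ennreal"
  assumes t: "0 < t" "t < 1"
    and [measurable]: "f \<in> borel_measurable borel" "g \<in> borel_measurable borel" "h \<in> borel_measurable borel"
    and le: "\<And>x y. geo_le t (f x) (g y) (h ((1 - t) * x + t * y))"
  shows "geo_le t (\<integral>\<^sup>+x. f x \<partial>lborel) (\<integral>\<^sup>+x. g x \<partial>lborel) (\<integral>\<^sup>+x. h x \<partial>lborel)"
  unfolding geo_le_def
proof (intro allI impI)
  fix a b :: real
  assume a: "0 < a" "ennreal a < (\<integral>\<^sup>+x. f x \<partial>lborel)" and b: "0 < b" "ennreal b < (\<integral>\<^sup>+x. g x \<partial>lborel)"
  \<comment> \<open>The last clause makes \<open>M\<close> the supremum of \<open>F\<close>, so that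
    the level sets below \<open>M\<close> are nonempty, as Brunn-Minkowski requires.\<close>
  have trunc: "\<exists>F M. F \<in> borel_measurable borel \<and> (\<forall>x. 0 \<le> F x) \<and> (\<forall>x. F x \<le> M) \<and> 0 < M \<and>
      (\<forall>x. ennreal (F x) \<le> f x) \<and> ennreal a < (\<integral>\<^sup>+x. ennreal (F x) \<partial>lborel) \<and> bounded {x. 0 < F x} \<and>
      (\<forall>c<M. \<exists>x. c < F x)"
    if [measurable]: "f \<in> borel_measurable borel" and a: "0 < a" "ennreal a < (\<integral>\<^sup>+x. f x \<partial>lborel)"
    for f :: "real \<Rightarrow> ennreal" and a
  proof -
    obtain N where N: "ennreal a < (\<integral>\<^sup>+x. min (f x) (of_nat N) * indicator {-real N..real N} x \<partial>lborel)"
      using nn_integral_truncate[OF _ a(2)] by auto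
    define F where "F x = enn2real (min (f x) (of_nat N) * indicator {-real N..real N} x)" for x
    have fin: "min (f x) (of_nat N) * indicator {-real N..real N} x < top" for x
      by (auto simp: indicator_def min_less_iff_disj of_nat_less_top)
    have F: "ennreal (F x) = min (f x) (of_nat N) * indicator {-real N..real N} x" for x
      using fin[of x] by (simp add: F_def)
    have meas: "F \<in> borel_measurable borel" unfolding F_def by measurable
    have F0: "0 \<le> F x" for x by (simp add: F_def)
    have FN: "F x \<le> real N" for x
    proof -
      have "ennreal (F x) \<le> of_nat N" unfolding F by (auto simp: indicator_def)
      then show ?thesis by (simp add: ennreal_of_nat_eq_real_of_nat)
    qed
    have bdd: "bdd_above (range F)" using FN by (intro bdd_aboveI[of _ "real N"]) auto
    have M: "F x \<le> Sup (range F)" for x using bdd by (intro cSup_upper) auto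
    have pos: "0 < Sup (range F)"
    proof (rule ccontr)
      assume "\<not> 0 < Sup (range F)"
      then have "F x = 0" for x using M[of x] F0[of x] by linarith
      then have "(\<integral>\<^sup>+x. ennreal (F x) \<partial>lborel) = 0" by simp
      then show False using N by (simp add: F)
    qed
    have "bounded {x. 0 < F x}"
      by (rule bounded_subset[of "{-real N..real N}"]) (auto simp: F_def indicator_def split: if_splits)
    moreover have "\<exists>x. c < F x" if "c < Sup (range F)" for c
      using that less_cSup_iff[OF _ bdd] by auto
    moreover have "ennreal (F x) \<le> f x" for x unfolding F by (auto simp: indicator_def)
    ultimately show ?thesis using meas F0 M pos N
      by (intro exI[of _ F] exI[of _ "Sup (range F)"]) (auto simp: F)
  qed
  obtain F Mf where F: "F \<in> borel_measurable borel" "\<And>x. 0 \<le> F x" "\<And>x. F x \<le> Mf" "0 < Mf"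
      "\<And>x. ennreal (F x) \<le> f x" "ennreal a < (\<integral>\<^sup>+x. ennreal (F x) \<partial>lborel)" "bounded {x. 0 < F x}"
      "\<And>c. c < Mf \<Longrightarrow> \<exists>x. c < F x"
    using trunc[of f a] a by auto
  obtain G Mg where G: "G \<in> borel_measurable borel" "\<And>x. 0 \<le> G x" "\<And>x. G x \<le> Mg" "0 < Mg"
      "\<And>x. ennreal (G x) \<le> g x" "ennreal b < (\<integral>\<^sup>+x. ennreal (G x) \<partial>lborel)" "bounded {x. 0 < G x}"
      "\<And>c. c < Mg \<Longrightarrow> \<exists>x. c < G x"
    using trunc[of g b] b by auto
  note [measurable] = F(1) G(1)
  \<comment> \<open>The height for \<open>h\<close> that matches relative level s: (s Mf)^(1-t) (s
    Mg)^t = s M.\<close>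
  define M where "M = Mf powr (1 - t) * Mg powr t"
  have M: "M > 0" using F(4) G(4) by (simp add: M_def)
  define IF where "IF = (\<integral>\<^sup>+s. emeasure lborel {x. s * Mf < F x} * indicator {0<..<1} s \<partial>lborel)"
  define IG where "IG = (\<integral>\<^sup>+s. emeasure lborel {x. s * Mg < G x} * indicator {0<..<1} s \<partial>lborel)"
  define IH where "IH = (\<integral>\<^sup>+s. emeasure lborel {x. ennreal (s * M) \<le> h x} * indicator {0<..<1} s \<partial>lborel)"
  have measI: "(\<lambda>s. emeasure lborel {x. s * c < K x}) \<in> borel_measurable borel"
    if [measurable]: "K \<in> borel_measurable borel" for K :: "real \<Rightarrow> real" and c
  proof -
    have "(\<lambda>s. \<integral>\<^sup>+x. (if s * c < K x then 1 else 0) \<partial>lborel) \<in> borel_measurable borel"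
      by measurable
    moreover have "(\<integral>\<^sup>+x. (if s * c < K x then 1 else 0) \<partial>lborel) = emeasure lborel {x. s * c < K x}" for s
    proof -
      have "(\<integral>\<^sup>+x. (if s * c < K x then 1 else 0) \<partial>lborel) = (\<integral>\<^sup>+x. indicator {x. s * c < K x} x \<partial>lborel)"
        by (intro nn_integral_cong) (auto simp: indicator_def)
      then show ?thesis by simp
    qed
    ultimately show ?thesis by simp
  qed
  have "ennreal (1 - t) * IF + ennreal t * IG
    = (\<integral>\<^sup>+s. (ennreal (1 - t) * emeasure lborel {x. s * Mf < F x}
        + ennreal t * emeasure lborel {x. s * Mg < G x}) * indicator {0<..<1} s \<partial>lborel)"
    unfolding IF_def IG_def using measI[OF F(1), of Mf] measI[OF G(1), of Mg]
    by (subst (1 2) nn_integral_cmult[symmetric]) (auto simp: nn_integral_add[symmetric] distrib_right mult.assoc)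
  also have "\<dots> \<le> IH" unfolding IH_def
  proof (intro nn_integral_mono)
    fix s :: real
    show "(ennreal (1 - t) * emeasure lborel {x. s * Mf < F x}
        + ennreal t * emeasure lborel {x. s * Mg < G x}) * indicator {0<..<1} s
       \<le> emeasure lborel {x. ennreal (s * M) \<le> h x} * indicator {0<..<1} s"
    proof (cases "0 < s \<and> s < 1")
      case True
      have "ennreal (1 - t) * emeasure lborel {x. s * Mf < F x} + ennreal t * emeasure lborel {x. s * Mg < G x}
         \<le> emeasure lborel {x. ennreal (s * M) \<le> h x}"
      proof (rule brunn_minkowski_1_convex)
        show "bounded {x. s * Mf < F x}" using True F(4)
          by (intro bounded_subset[OF F(7)]) (auto intro: order_less_trans[rotated])
        show "bounded {x. s * Mg < G x}" using True G(4)
          by (intro bounded_subset[OF G(7)]) (auto intro: order_less_trans[rotated])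
        show "{x. s * Mf < F x} \<noteq> {}" using F(8)[of "s * Mf"] F(4) True by auto
        show "{x. s * Mg < G x} \<noteq> {}" using G(8)[of "s * Mg"] G(4) True by auto
        fix x y assume x: "x \<in> {x. s * Mf < F x}" and y: "y \<in> {x. s * Mg < G x}"
        have "ennreal ((s * Mf) powr (1 - t) * (s * Mg) powr t) \<le> h ((1 - t) * x + t * y)"
        proof (rule geo_leD[OF le])
          show "ennreal (s * Mf) < f x" using x F(2)[of x] True F(4)
            by (intro order_less_le_trans[OF _ F(5)]) (auto simp: ennreal_less_iff)
          show "ennreal (s * Mg) < g y" using y G(2)[of y] True G(4)
            by (intro order_less_le_trans[OF _ G(5)]) (auto simp: ennreal_less_iff)
        qed (use True F(4) G(4) in auto)
        also have "(s * Mf) powr (1 - t) * (s * Mg) powr t = s powr (1 - t) * s powr t * M"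
          using True F(4) G(4) by (simp add: M_def powr_mult)
        also have "s powr (1 - t) * s powr t = s" using True by (simp flip: powr_add)
        finally show "(1 - t) * x + t * y \<in> {x. ennreal (s * M) \<le> h x}" by simp
      qed (use t in auto)
      then show ?thesis using True by simp
    qed auto
  qed
  finally have "ennreal M * (ennreal (1 - t) * IF + ennreal t * IG) \<le> ennreal M * IH"
    by (rule mult_left_mono) simp
  also have "\<dots> \<le> (\<integral>\<^sup>+x. h x \<partial>lborel)"
    unfolding IH_def using M by (intro nn_integral_level_le) auto
  finally have 1: "ennreal M * (ennreal (1 - t) * IF + ennreal t * IG) \<le> (\<integral>\<^sup>+x. h x \<partial>lborel)" .
  have div: "ennreal (c / N) \<le> I" if "ennreal c < ennreal N * I" "0 < N" "0 < c" for c N I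
  proof (cases I)
    case (real r)
    then show ?thesis using that by (simp add: ennreal_less_iff field_simps flip: ennreal_mult')
  qed auto
  have IF: "ennreal (a / Mf) \<le> IF"
    using order_less_le_trans[OF F(6) nn_integral_le_level[OF F(1,4,2,3)]] F(4) a by (intro div) (auto simp: IF_def)
  have IG: "ennreal (b / Mg) \<le> IG"
    using order_less_le_trans[OF G(6) nn_integral_le_level[OF G(1,4,2,3)]] G(4) b by (intro div) (auto simp: IG_def)
  \<comment> \<open>The weighted arithmetic-geometric mean inequality for the normalised bounds
    restores the multiplicative form.\<close>
  have "a powr (1 - t) * b powr t = M * ((a / Mf) powr (1 - t) * (b / Mg) powr t)"
    using F(4) G(4) a b by (simp add: M_def powr_divide)
  also have "\<dots> \<le> M * ((1 - t) * (a / Mf) + t * (b / Mg))"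
    using F(4) G(4) a b t M by (intro mult_left_mono Youngs_inequality_0) auto
  finally have "ennreal (a powr (1 - t) * b powr t) \<le> ennreal (M * ((1 - t) * (a / Mf) + t * (b / Mg)))"
    by (rule ennreal_leI)
  also have "\<dots> = ennreal M * (ennreal (1 - t) * ennreal (a / Mf) + ennreal t * ennreal (b / Mg))"
    using M t a b F(4) G(4) by (subst ennreal_mult', simp, subst ennreal_plus) (auto simp: ennreal_mult' simp del: times_divide_eq_right)
  also have "\<dots> \<le> ennreal M * (ennreal (1 - t) * IF + ennreal t * IG)"
    by (intro mult_left_mono add_mono IF IG) auto
  also note 1
  finally show "ennreal (a powr (1 - t) * b powr t) \<le> (\<integral>\<^sup>+x. h x \<partial>lborel)" .
qed

text \<open>By the inequality in the other coordinates, the integrals over them satisfy the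
  one-dimensional hypothesis in the remaining coordinate. The restricted abstraction keeps the
  convex combination extensional, hence inside the product space.\<close>

lemma prekopa_leindler_PiM:
  fixes f g h :: "('i \<Rightarrow> real) \<Rightarrow> ennreal"
  assumes "finite I" and t: "0 < t" "t < 1"
    and "f \<in> borel_measurable (\<Pi>\<^sub>M i\<in>I. lborel)" "g \<in> borel_measurable (\<Pi>\<^sub>M i\<in>I. lborel)"
      "h \<in> borel_measurable (\<Pi>\<^sub>M i\<in>I. lborel)"
    and "\<And>x y. x \<in> space (\<Pi>\<^sub>M i\<in>I. lborel) \<Longrightarrow> y \<in> space (\<Pi>\<^sub>M i\<in>I. lborel) \<Longrightarrow>
           geo_le t (f x) (g y) (h (\<lambda>i\<in>I. (1 - t) * x i + t * y i))"
  shows "geo_le t (integral\<^sup>N (\<Pi>\<^sub>M i\<in>I. lborel) f) (integral\<^sup>N (\<Pi>\<^sub>M i\<in>I. lborel) g) (integral\<^sup>N (\<Pi>\<^sub>M i\<in>I. lborel) h)"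
  using assms(1,4-)
proof (induction I arbitrary: f g h rule: finite_induct)
  \<comment> \<open>The empty product is a one-point space, so hypothesis and conclusion
    coincide.\<close>
  case empty
  interpret product_sigma_finite "\<lambda>_::'i. lborel :: real measure" ..
  have eq: "(\<lambda>i\<in>{}. (1 - t) * undefined i + t * undefined i) = (\<lambda>_::'i. undefined :: real)"
    by (simp add: restrict_def)
  have "geo_le t (f (\<lambda>_. undefined)) (g (\<lambda>_. undefined)) (h (\<lambda>_. undefined))"
    using empty(4)[of "\<lambda>_. undefined" "\<lambda>_. undefined"] by (simp add: space_PiM restrict_def)
  then show ?case by (simp add: PiM_empty nn_integral_count_space_finite)
next
  case (insert i I)
  interpret product_sigma_finite "\<lambda>_::'i. lborel :: real measure" ..
  interpret I: finite_product_sigma_finite "\<lambda>_::'i. lborel :: real measure" I by standard fact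
  have meas: "(\<lambda>y. \<integral>\<^sup>+x. f (x(i := y)) \<partial>(\<Pi>\<^sub>M i\<in>I. lborel)) \<in> borel_measurable borel"
    "\<And>y. (\<lambda>x. f (x(i := y))) \<in> borel_measurable (\<Pi>\<^sub>M i\<in>I. lborel)"
    if [measurable]: "f \<in> borel_measurable (\<Pi>\<^sub>M i\<in>insert i I. lborel)" for f :: "('i \<Rightarrow> real) \<Rightarrow> ennreal"
    by measurable
  show ?case
    unfolding product_nn_integral_insert_rev[OF insert(1,2,4)] product_nn_integral_insert_rev[OF insert(1,2,5)]
      product_nn_integral_insert_rev[OF insert(1,2,6)]
  proof (rule prekopa_leindler_1[OF t])
    fix u v
    have "geo_le t (\<integral>\<^sup>+x. f (x(i := u)) \<partial>(\<Pi>\<^sub>M i\<in>I. lborel)) (\<integral>\<^sup>+x. g (x(i := v)) \<partial>(\<Pi>\<^sub>M i\<in>I. lborel))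
      (\<integral>\<^sup>+x. h (x(i := (1 - t) * u + t * v)) \<partial>(\<Pi>\<^sub>M i\<in>I. lborel))"
    proof (rule insert.IH)
      fix x y :: "'i \<Rightarrow> real" assume x: "x \<in> space (\<Pi>\<^sub>M i\<in>I. lborel)" and y: "y \<in> space (\<Pi>\<^sub>M i\<in>I. lborel)"
      have "geo_le t (f (x(i := u))) (g (y(i := v))) (h (\<lambda>j\<in>insert i I. (1 - t) * (x(i := u)) j + t * (y(i := v)) j))"
        using x y by (intro insert.prems) (auto simp: space_PiM PiE_def extensional_def)
      moreover have "(\<lambda>j\<in>insert i I. (1 - t) * (x(i := u)) j + t * (y(i := v)) j)
        = (\<lambda>j\<in>I. (1 - t) * x j + t * y j)(i := (1 - t) * u + t * v)"
        using insert(2) by (auto simp: fun_eq_iff restrict_def)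
      ultimately show "geo_le t (f (x(i := u))) (g (y(i := v))) (h ((\<lambda>j\<in>I. (1 - t) * x j + t * y j)(i := (1 - t) * u + t * v)))"
        by simp
    qed (intro meas insert.prems)+
    then show "geo_le t (\<integral>\<^sup>+x. f (x(i := u)) \<partial>(\<Pi>\<^sub>M i\<in>I. lborel)) (\<integral>\<^sup>+x. g (x(i := v)) \<partial>(\<Pi>\<^sub>M i\<in>I. lborel))
      (\<integral>\<^sup>+x. h (x(i := (1 - t) * u + t * v)) \<partial>(\<Pi>\<^sub>M i\<in>I. lborel))" .
  qed (intro meas insert.prems)+
qed

theorem prekopa_leindler:
  fixes f g h :: "'a::euclidean_space \<Rightarrow> ennreal"
  assumes t: "0 < t" "t < 1"
    and [measurable]: "f \<in> borel_measurable borel" "g \<in> borel_measurable borel" "h \<in> borel_measurable borel"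
    and le: "\<And>x y. geo_le t (f x) (g y) (h ((1 - t) *\<^sub>R x + t *\<^sub>R y))"
  shows "geo_le t (\<integral>\<^sup>+x. f x \<partial>lborel) (\<integral>\<^sup>+x. g x \<partial>lborel) (\<integral>\<^sup>+x. h x \<partial>lborel)"
proof -
  let ?P = "\<lambda>v. \<Sum>b\<in>Basis. v b *\<^sub>R (b::'a)"
  have eq: "(\<integral>\<^sup>+x. F x \<partial>lborel) = (\<integral>\<^sup>+v. F (?P v) \<partial>(\<Pi>\<^sub>M b\<in>Basis. lborel))"
    if [measurable]: "F \<in> borel_measurable borel" for F :: "'a \<Rightarrow> ennreal"
    by (subst lborel_eq, subst nn_integral_distr) auto
  have *: "?P (\<lambda>i\<in>Basis. (1 - t) * x i + t * y i) = (1 - t) *\<^sub>R ?P x + t *\<^sub>R ?P y" for x y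
    by (simp add: scaleR_sum_right scaleR_add_left sum.distrib)
  show ?thesis unfolding eq[OF assms(3)] eq[OF assms(4)] eq[OF assms(5)]
    proof (rule prekopa_leindler_PiM)
    fix x y :: "'a \<Rightarrow> real"
    show "geo_le t (f (?P x)) (g (?P y)) (h (?P (\<lambda>i\<in>Basis. (1 - t) * x i + t * y i)))"
      by (subst *) (rule le)
  qed (use t in auto)
qed

section \<open>The Brunn-Minkowski inequality for concave homogeneous densities\<close>

text \<open>The first variation rests on continuity and nonnegativity alone; concavity and
  homogeneity are added by a second locale.\<close>

locale continuous_density =
  fixes g :: "'a::euclidean_space \<Rightarrow> real"
  assumes g_nonneg: "0 \<le> g x" and g_cont: "continuous_on UNIV g"
begin

abbreviation \<mu> :: "'a measure" where "\<mu> \<equiv> density_measure g"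

lemma g_meas [measurable]: "g \<in> borel_measurable borel"
  using g_cont by (rule borel_measurable_continuous_onI)

lemma sets_\<mu> [simp, measurable_cong]: "sets \<mu> = sets borel"
  by (simp add: density_measure_def)

lemma emeasure_\<mu>: "A \<in> sets borel \<Longrightarrow> emeasure \<mu> A = (\<integral>\<^sup>+x. ennreal (g x) * indicator A x \<partial>lborel)"
  unfolding density_measure_def by (subst emeasure_density) auto

lemma g_bounded_on_compact:
  assumes "compact A"
  obtains M where "0 < M" "\<And>x. x \<in> A \<Longrightarrow> g x \<le> M"
proof -
  have "bounded (g ` A)"
    by (intro compact_imp_bounded compact_continuous_image continuous_on_subset[OF g_cont] assms) auto
  then obtain M where "0 < M" "\<And>x. x \<in> A \<Longrightarrow> \<bar>g x\<bar> \<le> M" unfolding bounded_pos by auto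
  then show ?thesis using that by (meson abs_le_D1)
qed

lemma emeasure_\<mu>_compact: 
  assumes A: "compact A"
  shows "emeasure \<mu> A < \<infinity>"
proof -
  obtain M where M: "0 < M" "\<And>x. x \<in> A \<Longrightarrow> g x \<le> M" using g_bounded_on_compact[OF A] by blast
  have "emeasure \<mu> A \<le> (\<integral>\<^sup>+x. ennreal M * indicator A x \<partial>lborel)"
    using A M by (subst emeasure_\<mu>) (auto simp: borel_compact indicator_def intro!: nn_integral_mono ennreal_leI)
  also have "\<dots> = ennreal M * emeasure lborel A"
    using A by (subst nn_integral_cmult_indicator) (auto simp: borel_compact)
  also have "\<dots> < \<infinity>"
    using emeasure_bounded_finite[OF compact_imp_bounded[OF A]] by (simp add: ennreal_mult_less_top)
  finally show ?thesis .
qed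

lemma emeasure_\<mu>_eq_measure: "compact A \<Longrightarrow> emeasure \<mu> A = ennreal (measure \<mu> A)"
  using emeasure_\<mu>_compact[of A] by (simp add: emeasure_eq_ennreal_measure less_top)

end

section \<open>Minkowski sums, dilations and translations\<close>

lemma compact_plus_set:
  fixes A B :: "'a::real_normed_vector set"
  assumes "compact A" "compact B"
  shows "compact (A + B)"
proof -
  have "A + B = {x + y | x y. x \<in> A \<and> y \<in> B}" by (auto simp: set_plus_def)
  then show ?thesis using compact_sums[OF assms] by simp
qed

lemma nn_integral_lborel_scale:
  fixes f :: "'a::euclidean_space \<Rightarrow> ennreal"
  assumes [measurable]: "f \<in> borel_measurable borel" and c: "c > 0"
  shows "(\<integral>\<^sup>+x. f x \<partial>lborel) = ennreal (c ^ DIM('a)) * (\<integral>\<^sup>+x. f (c *\<^sub>R x) \<partial>lborel)"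
proof -
  have "(\<integral>\<^sup>+x. f x \<partial>lborel)
    = (\<integral>\<^sup>+x. f x \<partial>(density (distr lborel borel (\<lambda>x. 0 + c *\<^sub>R x)) (\<lambda>_. ennreal (\<bar>c\<bar> ^ DIM('a)))))"
    using lborel_affine[of c "0::'a"] c by simp
  also have "\<dots> = ennreal (c ^ DIM('a)) * (\<integral>\<^sup>+x. f (c *\<^sub>R x) \<partial>lborel)"
    using c by (simp add: nn_integral_density nn_integral_distr nn_integral_cmult)
  finally show ?thesis .
qed

lemma nn_integral_lborel_translate:
  fixes f :: "'a::euclidean_space \<Rightarrow> ennreal"
  assumes [measurable]: "f \<in> borel_measurable borel"
  shows "(\<integral>\<^sup>+x. f (x + c) \<partial>lborel) = (\<integral>\<^sup>+x. f x \<partial>lborel)"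
proof -
  have "(\<integral>\<^sup>+x. f x \<partial>lborel) = (\<integral>\<^sup>+x. f x \<partial>(distr lborel borel ((+) c)))"
    by (simp add: lborel_distr_plus)
  also have "\<dots> = (\<integral>\<^sup>+x. f (x + c) \<partial>lborel)"
    by (simp add: nn_integral_distr add.commute)
  finally show ?thesis by simp
qed

locale concave_homogeneous_density = continuous_density g for g :: "'a::euclidean_space \<Rightarrow> real" +
  fixes p :: real
  assumes p_pos: "p > 0" and concave: "p_concave p g" and homog: "homogeneous (1 / p) g"
begin

text \<open>Degree of homogeneity of \<mu>: volume contributes the dimension, the density
  contributes 1/p.\<close>

definition q :: real where "q = real DIM('a) + 1 / p"

lemma q_gt_1: "q > 1"
proof -
  have "real DIM('a) \<ge> 1" using DIM_positive[where 'a='a] by linarith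
  moreover have "1 / p > 0" using p_pos by simp
  ultimately show ?thesis unfolding q_def by linarith
qed

lemma g_scale: "a > 0 \<Longrightarrow> g (a *\<^sub>R x) = a powr (1 / p) * g x"
  using homog by (simp add: homogeneous_def)

lemma g_zero: "g 0 = 0"
proof -
  have "(2::real) powr 0 < 2 powr (1 / p)" using p_pos by (intro powr_less_mono) auto
  then show ?thesis using g_scale[of 2 0] by auto
qed

lemma g_concave:
  "0 \<le> l \<Longrightarrow> l \<le> 1 \<Longrightarrow> 0 < g x \<Longrightarrow> 0 < g y \<Longrightarrow>
    (l * g x powr p + (1 - l) * g y powr p) powr (1 / p) \<le> g (l *\<^sub>R x + (1 - l) *\<^sub>R y)"
  using concave by (auto simp: p_concave_def supp_def)

text \<open>The origin is the midpoint of x and -x, and concavity would make \<open>g 0\<close>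
  positive. Hence at most one summand of \<open>sym_sum g x\<close> is nonzero.\<close>

lemma g_uminus_eq_0: "0 < g x \<Longrightarrow> g (- x) = 0"
proof (rule ccontr)
  assume x: "0 < g x" "g (- x) \<noteq> 0"
  then have "0 < g (- x)" using g_nonneg[of "-x"] by simp
  then have "(1/2 * g x powr p + (1 - 1/2) * g (-x) powr p) powr (1 / p) \<le> g ((1/2) *\<^sub>R x + (1 - 1/2) *\<^sub>R (-x))"
    using x by (intro g_concave) auto
  also have "\<dots> = 0" by (simp add: g_zero)
  finally have "1/2 * g x powr p + (1 - 1/2) * g (-x) powr p = 0" by (auto simp: powr_def split: if_splits)
  moreover have "g x powr p > 0" "g (-x) powr p > 0" using x \<open>0 < g (-x)\<close> by auto
  ultimately show False by simp
qed

text \<open>Concavity at the midpoint, followed by a dilation by 2, under which the p-th power of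
  \<open>g\<close> doubles.\<close>

lemma g_superadditive:
  assumes "0 < g x" "0 < g y"
  shows "g x powr p + g y powr p \<le> g (x + y) powr p"
proof -
  let ?m = "(1/2) *\<^sub>R x + (1 - 1/2) *\<^sub>R y"
  have pos: "0 < 1/2 * g x powr p + (1 - 1/2) * g y powr p" using assms by (intro add_pos_pos) auto
  have "(1/2 * g x powr p + (1 - 1/2) * g y powr p) powr (1 / p) \<le> g ?m"
    using assms by (intro g_concave) auto
  then have "((1/2 * g x powr p + (1 - 1/2) * g y powr p) powr (1 / p)) powr p \<le> g ?m powr p"
    using p_pos by (intro powr_mono2) auto
  then have 1: "1/2 * g x powr p + (1 - 1/2) * g y powr p \<le> g ?m powr p"
    using p_pos pos by (simp add: powr_powr)
  have "x + y = 2 *\<^sub>R ?m" by (simp add: scaleR_add_right)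
  then have "g (x + y) powr p = (2 powr (1 / p) * g ?m) powr p" using g_scale[of 2 ?m] by simp
  also have "\<dots> = 2 * g ?m powr p" using p_pos by (simp add: powr_mult powr_powr g_nonneg)
  finally show ?thesis using 1 by simp
qed

lemma g_scale_powr: "a > 0 \<Longrightarrow> g (a *\<^sub>R x) powr p = a * g x powr p"
  using p_pos by (simp add: g_scale powr_mult powr_powr g_nonneg)

lemma g_sum_ge:
  assumes "finite I" "I \<noteq> {}" "\<And>i. i \<in> I \<Longrightarrow> 0 < b i" "\<And>i. i \<in> I \<Longrightarrow> 0 < g (v i)"
  shows "(\<Sum>i\<in>I. b i * g (v i) powr p) \<le> g (\<Sum>i\<in>I. b i *\<^sub>R v i) powr p"
  using assms
proof (induction I rule: finite_ne_induct)
  case (singleton i)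
  then show ?case by (simp add: g_scale_powr)
next
  case (insert i I)
  have IH: "(\<Sum>i\<in>I. b i * g (v i) powr p) \<le> g (\<Sum>i\<in>I. b i *\<^sub>R v i) powr p"
    by (rule insert.IH) (use insert.prems in auto)
  \<comment> \<open>Superadditivity applies to points of the support only, so the partial sum must
    first be shown to lie there.\<close>
  have "0 < (\<Sum>i\<in>I. b i * g (v i) powr p)"
    using insert by (intro sum_pos) (auto simp: less_imp_neq[symmetric])
  with IH have "0 < g (\<Sum>i\<in>I. b i *\<^sub>R v i)"
    using g_nonneg[of "\<Sum>i\<in>I. b i *\<^sub>R v i"] by (cases "g (\<Sum>i\<in>I. b i *\<^sub>R v i) = 0") auto
  moreover have "0 < g (b i *\<^sub>R v i)"
    using insert.prems(1)[of i] insert.prems(2)[of i] by (simp add: g_scale)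
  ultimately have "g (b i *\<^sub>R v i) powr p + g (\<Sum>i\<in>I. b i *\<^sub>R v i) powr p
     \<le> g (b i *\<^sub>R v i + (\<Sum>i\<in>I. b i *\<^sub>R v i)) powr p"
    by (intro g_superadditive)
  then show ?case using insert IH by (simp add: g_scale_powr)
qed

lemma emeasure_\<mu>_scale:
  assumes A: "compact A" and c: "c > 0"
  shows "emeasure \<mu> ((*\<^sub>R) c ` A) = ennreal (c powr q) * emeasure \<mu> A"
proof -
  have cA: "compact ((*\<^sub>R) c ` A)" using A by (rule compact_scaling)
  have [measurable]: "A \<in> sets borel" "(*\<^sub>R) c ` A \<in> sets borel" using A cA by (auto simp: borel_compact)
  have mem: "c *\<^sub>R x \<in> (*\<^sub>R) c ` A \<longleftrightarrow> x \<in> A" for x using c by auto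
  have "emeasure \<mu> ((*\<^sub>R) c ` A)
    = ennreal (c ^ DIM('a)) * (\<integral>\<^sup>+x. ennreal (g (c *\<^sub>R x)) * indicator ((*\<^sub>R) c ` A) (c *\<^sub>R x) \<partial>lborel)"
    using c by (simp add: emeasure_\<mu>) (subst nn_integral_lborel_scale[of _ c], auto)
  also have "(\<integral>\<^sup>+x. ennreal (g (c *\<^sub>R x)) * indicator ((*\<^sub>R) c ` A) (c *\<^sub>R x) \<partial>lborel)
     = (\<integral>\<^sup>+x. ennreal (c powr (1/p)) * (ennreal (g x) * indicator A x) \<partial>lborel)"
    using c by (intro nn_integral_cong) (auto simp: g_scale ennreal_mult' indicator_def mem mult.assoc)
  also have "\<dots> = ennreal (c powr (1/p)) * emeasure \<mu> A"
    by (subst nn_integral_cmult) (auto simp: emeasure_\<mu>)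
  finally show ?thesis
    using c by (simp add: q_def powr_add powr_realpow ennreal_mult' flip: mult.assoc)
qed

lemma measure_\<mu>_scale: "compact A \<Longrightarrow> c > 0 \<Longrightarrow> measure \<mu> ((*\<^sub>R) c ` A) = c powr q * measure \<mu> A"
  by (simp add: measure_def emeasure_\<mu>_scale enn2real_mult)

text \<open>The p-mean dominates the geometric mean, so \<open>g\<close> is log-concave on its
  support and its products with indicators satisfy the Prekopa-Leindler hypothesis.\<close>

lemma geo_le_\<mu>:
  assumes A: "compact A" and B: "compact B" and t: "0 < t" "t < 1"
  shows "geo_le t (emeasure \<mu> A) (emeasure \<mu> B) (emeasure \<mu> ((*\<^sub>R) (1 - t) ` A + (*\<^sub>R) t ` B))"
proof -
  let ?C = "(*\<^sub>R) (1 - t) ` A + (*\<^sub>R) t ` B"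
  have "compact ?C" using A B by (intro compact_plus_set compact_scaling)
  then have [measurable]: "A \<in> sets borel" "B \<in> sets borel" "?C \<in> sets borel" 
    using A B by (auto simp: borel_compact)
  have "geo_le t (ennreal (g x) * indicator A x) (ennreal (g y) * indicator B y)
     (ennreal (g ((1 - t) *\<^sub>R x + t *\<^sub>R y)) * indicator ?C ((1 - t) *\<^sub>R x + t *\<^sub>R y))" for x y
    unfolding geo_le_def
  proof (intro allI impI)
    fix a b :: real
    assume a: "0 < a" "ennreal a < ennreal (g x) * indicator A x"
      and b: "0 < b" "ennreal b < ennreal (g y) * indicator B y"
    have xy: "x \<in> A" "y \<in> B" using a b by (cases "x \<in> A"; cases "y \<in> B"; simp)+
    have ga: "a < g x" and gb: "b < g y" using a b xy by (auto simp: ennreal_less_iff)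
    have "a powr (1 - t) * b powr t \<le> g x powr (1 - t) * g y powr t"
      using ga gb a b t by (intro mult_mono powr_mono2) auto
    also have "\<dots> = ((g x powr p) powr (1 - t) * (g y powr p) powr t) powr (1 / p)"
      using p_pos ga gb a b by (simp add: powr_mult powr_powr)
    also have "\<dots> \<le> ((1 - t) * g x powr p + t * g y powr p) powr (1 / p)"
      using p_pos ga gb a b t by (intro powr_mono2 Youngs_inequality_0) auto
    also have "\<dots> \<le> g ((1 - t) *\<^sub>R x + t *\<^sub>R y)"
      using g_concave[of "1 - t" x y] ga gb a b t by simp
    finally have "a powr (1 - t) * b powr t \<le> g ((1 - t) *\<^sub>R x + t *\<^sub>R y)" .
    moreover have "(1 - t) *\<^sub>R x + t *\<^sub>R y \<in> ?C" using xy by (intro set_plus_intro imageI)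
    ultimately show "ennreal (a powr (1 - t) * b powr t)
      \<le> ennreal (g ((1 - t) *\<^sub>R x + t *\<^sub>R y)) * indicator ?C ((1 - t) *\<^sub>R x + t *\<^sub>R y)"
      by (simp add: ennreal_leI)
  qed
  then show ?thesis using t by (subst (1 2 3) emeasure_\<mu>) (auto intro!: prekopa_leindler)
qed

text \<open>Rescaling both sets to measure 1 turns the multiplicative inequality into the additive
  one. The choice of \<open>t\<close> gives both sets the same factor 1/(a + b), so that their
  combination is a dilate of A + B.\<close>

lemma brunn_minkowski:
  assumes A: "compact A" "0 < measure \<mu> A" and B: "compact B" "0 < measure \<mu> B"
  shows "measure \<mu> A powr (1 / q) + measure \<mu> B powr (1 / q) \<le> measure \<mu> (A + B) powr (1 / q)"
proof -
  define a where "a = measure \<mu> A powr (1 / q)"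
  define b where "b = measure \<mu> B powr (1 / q)"
  define t where "t = b / (a + b)"
  have ab: "a > 0" "b > 0" using A B by (auto simp: a_def b_def)
  have t: "0 < t" "t < 1" using ab by (auto simp: t_def field_simps)
  let ?A = "(*\<^sub>R) (1 / a) ` A" and ?B = "(*\<^sub>R) (1 / b) ` B"
  have aq: "a powr q = measure \<mu> A" "b powr q = measure \<mu> B" using q_gt_1 A B by (auto simp: a_def b_def powr_powr)
  have c: "compact ?A" "compact ?B" using A B by (auto intro: compact_scaling)
  have mA: "emeasure \<mu> ?A = 1" "emeasure \<mu> ?B = 1"
    using A B ab aq by (auto simp: emeasure_\<mu>_scale emeasure_\<mu>_eq_measure powr_divide simp flip: ennreal_mult')
  have "1 - t = a / (a + b)"
    using ab unfolding t_def
    by (metis add_diff_cancel_right' add_pos_pos diff_divide_distrib divide_self less_numeral_extra(3))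
  then have "(1 - t) / a = 1 / (a + b)" "t / b = 1 / (a + b)"
    using ab by (simp_all add: t_def)
  then have "(*\<^sub>R) (1 - t) ` ?A = (*\<^sub>R) (1 / (a + b)) ` A" "(*\<^sub>R) t ` ?B = (*\<^sub>R) (1 / (a + b)) ` B"
    by (simp_all add: image_image)
  moreover have "(*\<^sub>R) (1 / (a + b)) ` A + (*\<^sub>R) (1 / (a + b)) ` B = (*\<^sub>R) (1 / (a + b)) ` (A + B)"
    by (auto simp: set_plus_def scaleR_add_right image_iff) (metis scaleR_add_right)+
  ultimately have set: "(*\<^sub>R) (1 - t) ` ?A + (*\<^sub>R) t ` ?B = (*\<^sub>R) (1 / (a + b)) ` (A + B)" by simp
  \<comment> \<open>\<open>geo_le\<close> speaks of numbers strictly below the two measures, so 1 is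
    approached from below.\<close>
  have "1 \<le> emeasure \<mu> ((*\<^sub>R) (1 / (a + b)) ` (A + B))"
  proof (rule dense_le)
    fix x :: ennreal assume "x < 1"
    then obtain c where c1: "x = ennreal c" "0 \<le> c" "c < 1"
      by (cases x) (auto simp: ennreal_less_one_iff)
    show "x \<le> emeasure \<mu> ((*\<^sub>R) (1 / (a + b)) ` (A + B))"
    proof (cases "c = 0")
      case False
      have "ennreal (c powr (1 - t) * c powr t) \<le> emeasure \<mu> ((*\<^sub>R) (1 / (a + b)) ` (A + B))"
        using geo_leD[OF geo_le_\<mu>[OF c t], of c c] c1 False mA by (simp add: set ennreal_less_one_iff)
      moreover have "c powr (1 - t) * c powr t = c" using c1 False by (simp flip: powr_add)
      ultimately show ?thesis using c1 by simp
    qed (simp add: c1)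
  qed
  also have "\<dots> = ennreal ((1 / (a + b)) powr q * measure \<mu> (A + B))"
    using ab A B compact_plus_set by (subst emeasure_\<mu>_scale) (auto simp: emeasure_\<mu>_eq_measure ennreal_mult')
  finally have "(a + b) powr q \<le> measure \<mu> (A + B)"
    using ab by (simp add: powr_divide field_simps)
  then have "((a + b) powr q) powr (1 / q) \<le> measure \<mu> (A + B) powr (1 / q)"
    using q_gt_1 by (intro powr_mono2) auto
  then show ?thesis using q_gt_1 ab by (simp add: powr_powr a_def b_def)
qed

text \<open>Brunn-Minkowski bounds the measure of the sum below by (a + \<epsilon>z)^q, which
  Bernoulli's inequality linearises. The bound holds for every \<epsilon>, so convergence of the
  quotient is a separate matter.\<close>

lemma measure_plus_scaled_ge:
  assumes K: "compact K" "0 < measure \<mu> K" and Z: "compact Z" "0 < measure \<mu> Z" and e: "\<epsilon> > 0"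
  shows "q * measure \<mu> K powr (1 - 1 / q) * measure \<mu> Z powr (1 / q)
    \<le> (measure \<mu> (K + (*\<^sub>R) \<epsilon> ` Z) - measure \<mu> K) / \<epsilon>"
proof -
  define a where "a = measure \<mu> K powr (1 / q)"
  define z where "z = measure \<mu> Z powr (1 / q)"
  have az: "a > 0" "z > 0" "q > 0" using K Z q_gt_1 by (auto simp: a_def z_def)
  have aq: "a powr q = measure \<mu> K" "z powr q = measure \<mu> Z" using q_gt_1 K Z by (auto simp: a_def z_def powr_powr)
  have eZ: "compact ((*\<^sub>R) \<epsilon> ` Z)" using Z by (auto intro: compact_scaling)
  have mZ: "measure \<mu> ((*\<^sub>R) \<epsilon> ` Z) = (\<epsilon> * z) powr q"
    using Z e az by (simp add: measure_\<mu>_scale powr_mult aq)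
  have "a + \<epsilon> * z = measure \<mu> K powr (1 / q) + measure \<mu> ((*\<^sub>R) \<epsilon> ` Z) powr (1 / q)"
    using mZ az e by (simp add: a_def powr_powr)
  also have "\<dots> \<le> measure \<mu> (K + (*\<^sub>R) \<epsilon> ` Z) powr (1 / q)"
    using K eZ mZ az e by (intro brunn_minkowski) auto
  finally have "(a + \<epsilon> * z) powr q \<le> (measure \<mu> (K + (*\<^sub>R) \<epsilon> ` Z) powr (1 / q)) powr q"
    using az e by (intro powr_mono2) auto
  then have 1: "(a + \<epsilon> * z) powr q \<le> measure \<mu> (K + (*\<^sub>R) \<epsilon> ` Z)" using az by (simp add: powr_powr)
  define x where "x = \<epsilon> * z / a"
  have x: "x > 0" using az e by (simp add: x_def)
  \<comment> \<open>Bernoulli's inequality 1 + q x \<le> (1 + x)^q for real q > 1, from the weighted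
    means of (1 + x)^q and 1 with weights 1/q and 1 - 1/q.\<close>
  have "((1 + x) powr q) powr (1/q) * 1 powr (1 - 1/q) \<le> 1/q * (1 + x) powr q + (1 - 1/q) * 1"
    using q_gt_1 x by (intro Youngs_inequality_0) auto
  then have "q * (1 + q * x) \<le> q * (1 + x) powr q" using q_gt_1 x by (simp add: powr_powr field_simps)
  then have "1 + q * x \<le> (1 + x) powr q" using q_gt_1 by simp
  then have "a powr q * (1 + q * x) \<le> a powr q * (1 + x) powr q" by (rule mult_left_mono) simp
  also have "\<dots> = (a + \<epsilon> * z) powr q"
  proof -
    have "a * (1 + x) = a + \<epsilon> * z" using az by (simp add: x_def distrib_left)
    then show ?thesis using az x by (simp flip: powr_mult)
  qed
  also note 1
  finally have "a powr q * (1 + q * x) \<le> measure \<mu> (K + (*\<^sub>R) \<epsilon> ` Z)" .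
  then have "q * (a powr q / a) * z \<le> (measure \<mu> (K + (*\<^sub>R) \<epsilon> ` Z) - a powr q) / \<epsilon>"
    using az e by (simp add: x_def field_simps)
  moreover have "a powr q / a = measure \<mu> K powr (1 - 1 / q)"
  proof -
    have "a powr q / a = a powr (q - 1)" using az by (simp add: powr_diff)
    also have "\<dots> = measure \<mu> K powr (1 - 1 / q)" using az by (simp add: a_def powr_powr field_simps)
    finally show ?thesis .
  qed
  ultimately show ?thesis by (simp only: z_def[symmetric] aq(1))
qed

end

section \<open>First variation along a segment\<close>

text \<open>One-sided, so that adding it moves only one end of each chord of direction
  \<open>v\<close>.\<close>

definition seg :: "'a::real_vector \<Rightarrow> 'a set" where
  "seg v = (\<lambda>s. s *\<^sub>R v) ` {0..1}"

definition slab :: "'a::real_inner \<Rightarrow> 'a set" where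
  "slab v = {x. 0 \<le> x \<bullet> v \<and> x \<bullet> v < v \<bullet> v}"

lemma slab_borel [measurable]: "slab (v::'a::euclidean_space) \<in> sets borel"
proof -
  have "slab v = {x \<in> space borel. 0 \<le> x \<bullet> v \<and> x \<bullet> v < v \<bullet> v}" by (simp add: slab_def)
  also have "\<dots> \<in> sets borel" by measurable
  finally show ?thesis .
qed

lemma compact_seg: "compact (seg (v::'a::real_normed_vector))"
  unfolding seg_def by (intro compact_continuous_image continuous_intros) auto

lemma convex_seg: "convex (seg v)"
proof -
  have "linear (\<lambda>s::real. s *\<^sub>R v)" by (simp add: linear_iff scaleR_add_left)
  then show ?thesis unfolding seg_def by (intro convex_linear_image) auto
qed

text \<open>Every line in direction \<open>v\<close> meets the slab in a segment of parameter length 1.\<close>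

lemma nn_integral_slab:
  fixes v :: "'a::euclidean_space"
  assumes v: "v \<noteq> 0" and [measurable]: "h \<in> borel_measurable borel"
  shows "(\<integral>\<^sup>+x. h x \<partial>lborel) = (\<integral>\<^sup>+x. indicator (slab v) x * (\<integral>\<^sup>+s. h (x + s *\<^sub>R v) \<partial>lborel) \<partial>lborel)"
proof -
  have vv: "v \<bullet> v > 0" using v by simp
  have 1: "(\<integral>\<^sup>+s. indicator (slab v) (x - s *\<^sub>R v) \<partial>lborel) = 1" for x
  proof -
    have "(\<integral>\<^sup>+s. indicator (slab v) (x - s *\<^sub>R v) \<partial>lborel)
      = (\<integral>\<^sup>+s. indicator {(x \<bullet> v) / (v \<bullet> v) - 1 <.. (x \<bullet> v) / (v \<bullet> v)} s \<partial>lborel)"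
      using vv by (intro nn_integral_cong) (auto simp: indicator_def slab_def inner_diff_left field_simps)
    then show ?thesis by simp
  qed
  \<comment> \<open>Insert the integral 1, exchange the integrals, and translate by s v for fixed
    s.\<close>
  have "(\<integral>\<^sup>+x. h x \<partial>lborel) = (\<integral>\<^sup>+x. (\<integral>\<^sup>+s. h x * indicator (slab v) (x - s *\<^sub>R v) \<partial>lborel) \<partial>lborel)"
    by (subst nn_integral_cmult) (auto simp: 1)
  also have "\<dots> = (\<integral>\<^sup>+s. (\<integral>\<^sup>+x. h x * indicator (slab v) (x - s *\<^sub>R v) \<partial>lborel) \<partial>lborel)"
    by (rule lborel_pair.Fubini') simp
  also have "\<dots> = (\<integral>\<^sup>+s. (\<integral>\<^sup>+x. h (x + s *\<^sub>R v) * indicator (slab v) x \<partial>lborel) \<partial>lborel)"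
  proof (rule nn_integral_cong)
    fix s :: real
    show "(\<integral>\<^sup>+x. h x * indicator (slab v) (x - s *\<^sub>R v) \<partial>lborel)
      = (\<integral>\<^sup>+x. h (x + s *\<^sub>R v) * indicator (slab v) x \<partial>lborel)"
      using nn_integral_lborel_translate[of "\<lambda>x. h x * indicator (slab v) (x - s *\<^sub>R v)" "s *\<^sub>R v"] by simp
  qed
  also have "\<dots> = (\<integral>\<^sup>+x. (\<integral>\<^sup>+s. h (x + s *\<^sub>R v) * indicator (slab v) x \<partial>lborel) \<partial>lborel)"
    by (rule lborel_pair.Fubini') simp
  also have "\<dots> = (\<integral>\<^sup>+x. indicator (slab v) x * (\<integral>\<^sup>+s. h (x + s *\<^sub>R v) \<partial>lborel) \<partial>lborel)"
    by (rule nn_integral_cong) (subst nn_integral_multc, simp_all add: mult.commute)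
  finally show ?thesis .
qed

section \<open>Chords of a convex body in a fixed direction\<close>

definition line_set :: "'a::real_vector \<Rightarrow> 'a set \<Rightarrow> 'a \<Rightarrow> real set" where
  "line_set v K x = {s. x + s *\<^sub>R v \<in> K}"

lemma compact_line_set:
  fixes K :: "'a::euclidean_space set"
  assumes v: "v \<noteq> 0" and K: "compact K"
  shows "compact (line_set v K x)"
proof -
  have "closed (line_set v K x)"
    using continuous_closed_preimage[of UNIV "\<lambda>s. x + s *\<^sub>R v" K] compact_imp_closed[OF K]
    by (simp add: line_set_def vimage_def continuous_intros)
  moreover obtain B where B: "\<And>y. y \<in> K \<Longrightarrow> norm y \<le> B" 
    using compact_imp_bounded[OF K] unfolding bounded_iff by blast
  have "\<bar>s\<bar> \<le> (B + norm x) / norm v" if "s \<in> line_set v K x" for s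
  proof -
    have "norm (s *\<^sub>R v) = norm ((x + s *\<^sub>R v) - x)" by simp
    also have "\<dots> \<le> norm (x + s *\<^sub>R v) + norm x" by (rule norm_triangle_ineq4)
    also have "\<dots> \<le> B + norm x" using B[of "x + s *\<^sub>R v"] that by (simp add: line_set_def)
    finally show ?thesis using v by (simp add: field_simps)
  qed
  then have "bounded (line_set v K x)" unfolding bounded_iff by auto
  ultimately show ?thesis by (simp add: compact_eq_bounded_closed)
qed

lemma convex_line_set:
  assumes "convex K"
  shows "convex (line_set v K x)"
  unfolding convex_alt
proof (intro ballI allI impI)
  fix a b u :: real assume ab: "a \<in> line_set v K x" "b \<in> line_set v K x" "0 \<le> u \<and> u \<le> 1"
  have "(1 - u) *\<^sub>R (x + a *\<^sub>R v) + u *\<^sub>R (x + b *\<^sub>R v) \<in> K"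
    using ab assms by (auto simp: convex_alt line_set_def)
  also have "(1 - u) *\<^sub>R (x + a *\<^sub>R v) + u *\<^sub>R (x + b *\<^sub>R v) = x + ((1 - u) *\<^sub>R a + u *\<^sub>R b) *\<^sub>R v"
    by (simp add: algebra_simps)
  finally show "(1 - u) *\<^sub>R a + u *\<^sub>R b \<in> line_set v K x" by (simp add: line_set_def)
qed

lemma line_set_plus_seg:
  assumes "convex L" and e: "\<epsilon> > 0"
  shows "line_set v (L + (*\<^sub>R) \<epsilon> ` seg v) x = {s + r | s r. s \<in> line_set v L x \<and> 0 \<le> r \<and> r \<le> \<epsilon>}"
proof (intro set_eqI iffI)
  fix s assume "s \<in> line_set v (L + (*\<^sub>R) \<epsilon> ` seg v) x"
  then obtain y r where yr: "y \<in> L" "0 \<le> r" "r \<le> 1" "x + s *\<^sub>R v = y + \<epsilon> *\<^sub>R r *\<^sub>R v"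
    by (auto simp: line_set_def set_plus_def seg_def)
  then have "x + (s - \<epsilon> * r) *\<^sub>R v \<in> L" by (simp add: algebra_simps)
  then show "s \<in> {s + r | s r. s \<in> line_set v L x \<and> 0 \<le> r \<and> r \<le> \<epsilon>}"
    using yr e by (intro CollectI exI[of _ "s - \<epsilon> * r"] exI[of _ "\<epsilon> * r"]) (auto simp: line_set_def mult_left_le)
next
  fix s assume "s \<in> {s + r | s r. s \<in> line_set v L x \<and> 0 \<le> r \<and> r \<le> \<epsilon>}"
  then obtain s' r where s: "s = s' + r" "x + s' *\<^sub>R v \<in> L" "0 \<le> r" "r \<le> \<epsilon>" by (auto simp: line_set_def)
  have "(x + s' *\<^sub>R v) + \<epsilon> *\<^sub>R (r / \<epsilon>) *\<^sub>R v \<in> L + (*\<^sub>R) \<epsilon> ` seg v"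
    using s e by (intro set_plus_intro imageI) (auto simp: seg_def)
  then show "s \<in> line_set v (L + (*\<^sub>R) \<epsilon> ` seg v) x"
    using e by (simp add: s(1) line_set_def algebra_simps)
qed

text \<open>The chord of \<open>L\<close> is a compact interval [a, b], which the segment prolongs
  to [a, b + \<epsilon>].\<close>

lemma line_set_band:
  fixes L :: "'a::euclidean_space set"
  assumes v: "v \<noteq> 0" and L: "compact L" "convex L" and e: "\<epsilon> > 0" and ne: "line_set v L x \<noteq> {}"
  shows "line_set v (L + (*\<^sub>R) \<epsilon> ` seg v - L) x = {Sup (line_set v L x) <.. Sup (line_set v L x) + \<epsilon>}"
proof -
  let ?S = "line_set v L x"
  obtain a b where ab: "?S = {a..b}"
    using convex_connected[OF convex_line_set[OF L(2), of v x]] compact_line_set[OF v L(1), of x]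
    by (meson connected_compact_interval_1)
  then have le: "a \<le> b" using ne by auto
  have "line_set v (L + (*\<^sub>R) \<epsilon> ` seg v - L) x = line_set v (L + (*\<^sub>R) \<epsilon> ` seg v) x - ?S"
    by (auto simp: line_set_def)
  also have "line_set v (L + (*\<^sub>R) \<epsilon> ` seg v) x = {a..b + \<epsilon>}"
    unfolding line_set_plus_seg[OF L(2) e] ab
  proof (intro set_eqI iffI)
    fix s assume s: "s \<in> {a..b + \<epsilon>}"
    have "s = min s b + (s - min s b) \<and> min s b \<in> {a..b} \<and> 0 \<le> s - min s b \<and> s - min s b \<le> \<epsilon>"
      using s e le by (simp add: min_def)
    then show "s \<in> {s + r |s r. s \<in> {a..b} \<and> 0 \<le> r \<and> r \<le> \<epsilon>}" by blast
  qed auto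
  finally have "line_set v (L + (*\<^sub>R) \<epsilon> ` seg v - L) x = {a..b + \<epsilon>} - {a..b}" by (simp only: ab)
  moreover have "{a..b + \<epsilon>} - {a..b} = {b <.. b + \<epsilon>}" using le by auto
  moreover have "Sup {a..b} = b" using le by simp
  ultimately show ?thesis by (simp only: ab)
qed

section \<open>Difference quotients along lines and their limit\<close>

context continuous_density
begin

text \<open>The density at the point where the line through \<open>x\<close> leaves \<open>K\<close> in direction \<open>v\<close>.\<close>

definition top_value :: "'a \<Rightarrow> 'a set \<Rightarrow> 'a \<Rightarrow> real" where
  "top_value v K x = (if line_set v K x = {} then 0 else g (x + Sup (line_set v K x) *\<^sub>R v))"

text \<open>The weighted area of the part of the boundary of \<open>K\<close> seen from direction \<open>v\<close>, multiplied
  by \<open>\<bar>v\<bar>\<close>; integrating over the slab replaces integration over the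
  projection onto the orthogonal complement of \<open>v\<close>.\<close>

definition face_mass :: "'a \<Rightarrow> 'a set \<Rightarrow> real" where
  "face_mass v K = enn2real (\<integral>\<^sup>+x. indicator (slab v) x * ennreal (top_value v K x) \<partial>lborel)"

text \<open>\<open>G\<close> will be the density along a line and \<open>b n\<close> the parameter
  at which the line leaves the n-th body. Since this end point moves with n, differentiating an
  integral at a fixed point would not suffice.\<close>

lemma average_tendsto:
  fixes G :: "real \<Rightarrow> real"
  assumes G: "continuous_on UNIV G" "\<And>s. 0 \<le> G s" and b: "b \<longlonglongrightarrow> b0" and e: "e \<longlonglongrightarrow> 0" "\<And>n. e n > 0"
  shows "(\<lambda>n. ennreal (1 / e n) * (\<integral>\<^sup>+s. ennreal (G s) * indicator {b n <.. b n + e n} s \<partial>lborel)) \<longlonglongrightarrow> ennreal (G b0)"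
proof -
  have [measurable]: "G \<in> borel_measurable borel" using G(1) by (rule borel_measurable_continuous_onI)
  define I where "I n = ennreal (1 / e n) * (\<integral>\<^sup>+s. ennreal (G s) * indicator {b n <.. b n + e n} s \<partial>lborel)" for n
  have const: "ennreal (1 / e n) * (\<integral>\<^sup>+s. ennreal c * indicator {b n <.. b n + e n} s \<partial>lborel) = ennreal c" if "0 \<le> c" for n c
    using e(2)[of n] that by (subst nn_integral_cmult_indicator) (simp_all add: ennreal_mult[symmetric])
  have bounds: "\<forall>\<^sub>F n in sequentially. ennreal (G b0 - \<delta>) \<le> I n \<and> I n \<le> ennreal (G b0 + \<delta>)" if d: "\<delta> > 0" for \<delta>
  proof -
    have "isCont G b0" using G(1) by (simp add: continuous_on_eq_continuous_at)
    then obtain r where r: "r > 0" "\<And>s. \<bar>s - b0\<bar> < r \<Longrightarrow> \<bar>G s - G b0\<bar> < \<delta>"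
      using d unfolding continuous_at_eps_delta by (auto simp: dist_real_def)
    have "\<forall>\<^sub>F n in sequentially. \<bar>b n - b0\<bar> < r / 2" 
      using tendstoD[OF b, of "r / 2"] r(1) by (simp add: dist_real_def)
    moreover have "\<forall>\<^sub>F n in sequentially. \<bar>e n\<bar> < r / 2"
      using tendstoD[OF e(1), of "r / 2"] r(1) by (simp add: dist_real_def)
    ultimately show ?thesis
    proof eventually_elim
      case (elim n)
      have near: "\<bar>G s - G b0\<bar> < \<delta>" if "s \<in> {b n <.. b n + e n}" for s
      proof (rule r(2))
        have "s - b0 < r" "b0 - s < r"
          using that elim e(2)[of n] abs_ge_self[of "b n - b0"] abs_ge_minus_self[of "b n - b0"] by auto
        then show "\<bar>s - b0\<bar> < r" by (simp add: abs_less_iff)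
      qed
      have "I n \<le> ennreal (1 / e n) * (\<integral>\<^sup>+s. ennreal (G b0 + \<delta>) * indicator {b n <.. b n + e n} s \<partial>lborel)"
        unfolding I_def
      proof (intro mult_left_mono nn_integral_mono)
        fix s show "ennreal (G s) * indicator {b n <.. b n + e n} s \<le> ennreal (G b0 + \<delta>) * indicator {b n <.. b n + e n} s"
          using near[of s] by (cases "s \<in> {b n <.. b n + e n}") (auto intro!: ennreal_leI)
      qed simp
      also have "\<dots> = ennreal (G b0 + \<delta>)" using d G(2)[of b0] by (intro const) simp
      finally have 1: "I n \<le> ennreal (G b0 + \<delta>)" .
      have "ennreal (G b0 - \<delta>) \<le> I n"
      proof (cases "G b0 - \<delta> \<ge> 0")
        case True
        have "ennreal (1 / e n) * (\<integral>\<^sup>+s. ennreal (G b0 - \<delta>) * indicator {b n <.. b n + e n} s \<partial>lborel) \<le> I n"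
          unfolding I_def
        proof (intro mult_left_mono nn_integral_mono)
          fix s show "ennreal (G b0 - \<delta>) * indicator {b n <.. b n + e n} s \<le> ennreal (G s) * indicator {b n <.. b n + e n} s"
            using near[of s] by (cases "s \<in> {b n <.. b n + e n}") (auto intro!: ennreal_leI)
        qed simp
        then show ?thesis using const[OF True] by simp
      qed (simp add: ennreal_neg)
      with 1 show ?case by simp
    qed
  qed
  have fin: "\<forall>\<^sub>F n in sequentially. ennreal (enn2real (I n)) = I n"
    using bounds[OF zero_less_one]
  proof eventually_elim
    case (elim n)
    then have "I n < top" by (metis ennreal_less_top le_less_trans)
    then show ?case by simp
  qed
  have "(\<lambda>n. enn2real (I n)) \<longlonglongrightarrow> G b0"
  proof (rule tendstoI)
    fix d :: real assume d: "d > 0"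
    show "\<forall>\<^sub>F n in sequentially. dist (enn2real (I n)) (G b0) < d"
      using bounds[OF half_gt_zero[OF d]] fin
    proof eventually_elim
      case (elim n)
      have "ennreal (enn2real (I n)) \<le> ennreal (G b0 + d/2)" using elim by simp
      then have 1: "enn2real (I n) \<le> G b0 + d/2" using d G(2)[of b0] by (subst (asm) ennreal_le_iff) auto
      have "ennreal (G b0 - d/2) \<le> ennreal (enn2real (I n))" using elim by simp
      then have 2: "G b0 - d/2 \<le> enn2real (I n)" 
        by (cases "G b0 - d/2 \<ge> 0") (auto intro: order_trans[OF _ enn2real_nonneg])
      from 1 2 d show ?case by (auto simp: dist_real_def abs_less_iff)
    qed
  qed
  then have "(\<lambda>n. ennreal (enn2real (I n))) \<longlonglongrightarrow> ennreal (G b0)" by (rule tendsto_ennrealI)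
  then have "I \<longlonglongrightarrow> ennreal (G b0)" using fin by (rule Lim_transform_eventually)
  then show ?thesis unfolding I_def .
qed

text \<open>The points of the line with parameter in \<open>T\<close> form a closed set disjoint
  from the compact \<open>K\<close>, hence at positive distance from it, while \<open>L n\<close>
  approaches \<open>K\<close>. Applied to \<open>T = UNIV\<close> when the line misses
  \<open>K\<close>, and to a ray beyond the exit point otherwise.\<close>

lemma line_avoids_eventually:
  fixes K :: "'a set"
  assumes v: "v \<noteq> 0" and K: "compact K" and T: "closed T" "T \<inter> line_set v K x = {}"
    and L: "\<And>n y. y \<in> L n \<Longrightarrow> \<exists>k\<in>K. dist y k \<le> C * e n" and e: "e \<longlonglongrightarrow> (0::real)"
  shows "\<forall>\<^sub>F n in sequentially. T \<inter> line_set v (L n) x = {}"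
proof -
  have "closed ((\<lambda>s. s *\<^sub>R v) ` T)"
    using v T(1) by (intro closed_injective_linear_image) (auto simp: linear_iff scaleR_add_left inj_def)
  then have "closed ((+) x ` (\<lambda>s. s *\<^sub>R v) ` T)" by (rule closed_translation)
  moreover have "K \<inter> (+) x ` (\<lambda>s. s *\<^sub>R v) ` T = {}" using T(2) by (auto simp: line_set_def)
  ultimately obtain d where d: "d > 0" "\<And>k y. k \<in> K \<Longrightarrow> y \<in> (+) x ` (\<lambda>s. s *\<^sub>R v) ` T \<Longrightarrow> d \<le> dist k y"
    using separate_compact_closed[OF K] by metis
  have "(\<lambda>n. C * e n) \<longlonglongrightarrow> 0" using tendsto_mult_right_zero[OF e] by simp
  then have "\<forall>\<^sub>F n in sequentially. C * e n < d" using d(1) by (rule order_tendstoD)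
  then show ?thesis
  proof eventually_elim
    case (elim n)
    show ?case
    proof (rule ccontr)
      assume "T \<inter> line_set v (L n) x \<noteq> {}"
      then obtain s where s: "s \<in> T" "x + s *\<^sub>R v \<in> L n" by (auto simp: line_set_def)
      then obtain k where k: "k \<in> K" "dist (x + s *\<^sub>R v) k \<le> C * e n" using L by blast
      have "d \<le> dist k (x + s *\<^sub>R v)" using s k by (intro d(2)) auto
      then show False using k elim by (simp add: dist_commute)
    qed
  qed
qed

text \<open>The bodies \<open>L n\<close> are allowed to vary around \<open>K\<close>, which makes the first variation additive
  along Minkowski sums.\<close>

lemma band_derivative_sequence:
  fixes K :: "'a set"
  assumes v: "v \<noteq> 0" and K: "compact K"
    and L: "\<And>n. compact (L n)" "\<And>n. convex (L n)" "\<And>n. K \<subseteq> L n"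
      "\<And>n y. y \<in> L n \<Longrightarrow> \<exists>k\<in>K. dist y k \<le> C * e n"
    and e: "e \<longlonglongrightarrow> 0" "\<And>n. e n > 0"
  shows "(\<lambda>n. (measure \<mu> (L n + (*\<^sub>R) (e n) ` seg v) - measure \<mu> (L n)) / e n) \<longlonglongrightarrow> face_mass v K"
proof -
  define D where "D n = (L n + (*\<^sub>R) (e n) ` seg v) - L n" for n
  have cplus: "compact (L n + (*\<^sub>R) (e n) ` seg v)" for n
    by (intro compact_plus_set L compact_scaling compact_seg)
  have [measurable]: "D n \<in> sets borel" for n
    unfolding D_def using cplus[of n] L(1)[of n] by (auto simp: borel_compact)
  have sub: "L n \<subseteq> L n + (*\<^sub>R) (e n) ` seg v" for n
  proof
    fix y assume y: "y \<in> L n"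
    have "0 \<in> (*\<^sub>R) (e n) ` seg v" by (force simp: seg_def)
    then have "y + 0 \<in> L n + (*\<^sub>R) (e n) ` seg v" by (intro set_plus_intro y)
    then show "y \<in> L n + (*\<^sub>R) (e n) ` seg v" by simp
  qed
  \<comment> \<open>The difference quotient on the line through x; its integral over the slab is the
    quotient of the measures.\<close>
  define u where "u n x = indicator (slab v) x *
    (ennreal (1 / e n) * (\<integral>\<^sup>+s. ennreal (g (x + s *\<^sub>R v)) * indicator (line_set v (D n) x) s \<partial>lborel))" for n x
  have ind: "indicator (line_set v (D n) x) s = (indicator (D n) (x + s *\<^sub>R v) :: ennreal)" for n x s
    by (simp add: line_set_def indicator_def)
  have [measurable]: "u n \<in> borel_measurable borel" for n
    unfolding u_def ind by measurable
  have int_u: "(\<integral>\<^sup>+x. u n x \<partial>lborel) = ennreal ((measure \<mu> (L n + (*\<^sub>R) (e n) ` seg v) - measure \<mu> (L n)) / e n)" for n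
  proof -
    have "(\<integral>\<^sup>+x. u n x \<partial>lborel) = (\<integral>\<^sup>+x. ennreal (1 / e n) * (indicator (slab v) x *
        (\<integral>\<^sup>+s. ennreal (g (x + s *\<^sub>R v)) * indicator (D n) (x + s *\<^sub>R v) \<partial>lborel)) \<partial>lborel)"
      unfolding u_def ind by (simp add: mult_ac)
    also have "\<dots> = ennreal (1 / e n) * (\<integral>\<^sup>+x. indicator (slab v) x *
        (\<integral>\<^sup>+s. ennreal (g (x + s *\<^sub>R v)) * indicator (D n) (x + s *\<^sub>R v) \<partial>lborel) \<partial>lborel)"
      by (rule nn_integral_cmult) measurable
    also have "(\<integral>\<^sup>+x. indicator (slab v) x *
        (\<integral>\<^sup>+s. ennreal (g (x + s *\<^sub>R v)) * indicator (D n) (x + s *\<^sub>R v) \<partial>lborel) \<partial>lborel)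
      = (\<integral>\<^sup>+x. ennreal (g x) * indicator (D n) x \<partial>lborel)"
      by (rule nn_integral_slab[OF v, symmetric]) measurable
    also have "\<dots> = emeasure \<mu> (D n)" by (simp add: emeasure_\<mu>)
    also have "\<dots> = emeasure \<mu> (L n + (*\<^sub>R) (e n) ` seg v) - emeasure \<mu> (L n)"
      unfolding D_def using emeasure_\<mu>_compact[OF L(1)[of n]] cplus[of n] L(1)[of n] sub[of n]
      by (intro emeasure_Diff) (auto simp: borel_compact)
    also have "\<dots> = ennreal (measure \<mu> (L n + (*\<^sub>R) (e n) ` seg v) - measure \<mu> (L n))"
      using cplus[of n] L(1)[of n] by (simp add: emeasure_\<mu>_eq_measure ennreal_minus)
    finally show ?thesis using e(2)[of n] by (simp add: divide_inverse mult.commute flip: ennreal_mult')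
  qed
  have u_empty: "u n x = 0" if "line_set v (L n) x = {}" for n x
  proof -
    have "line_set v (D n) x = {}"
      using line_set_plus_seg[OF L(2)[of n] e(2)[of n], of v x] that by (auto simp: D_def line_set_def)
    then show ?thesis by (simp add: u_def)
  qed
  have u_eq: "u n x = indicator (slab v) x * (ennreal (1 / e n) *
      (\<integral>\<^sup>+s. ennreal (g (x + s *\<^sub>R v)) * indicator {Sup (line_set v (L n) x) <.. Sup (line_set v (L n) x) + e n} s \<partial>lborel))"
    if "line_set v (L n) x \<noteq> {}" for n x
    unfolding u_def D_def line_set_band[OF v L(1,2) e(2) that] ..
  have lim: "(\<lambda>n. u n x) \<longlonglongrightarrow> indicator (slab v) x * ennreal (top_value v K x)" for x
  proof (cases "line_set v K x = {}")
    case True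
    have "\<forall>\<^sub>F n in sequentially. UNIV \<inter> line_set v (L n) x = {}"
      by (rule line_avoids_eventually[OF v K _ _ L(4) e(1)]) (use True in auto)
    then have "\<forall>\<^sub>F n in sequentially. u n x = 0" by eventually_elim (simp add: u_empty)
    then show ?thesis using True by (simp add: top_value_def tendsto_eventually)
  next
    case False
    define b0 where "b0 = Sup (line_set v K x)"
    define b where "b n = Sup (line_set v (L n) x)" for n
    have KL: "line_set v K x \<subseteq> line_set v (L n) x" for n using L(3)[of n] by (auto simp: line_set_def)
    have ne: "line_set v (L n) x \<noteq> {}" for n using KL[of n] False by auto
    have bdd: "bdd_above (line_set v A x)" if "compact A" for A
      using compact_line_set[OF v that] by (simp add: bounded_imp_bdd_above compact_imp_bounded)
    have bge: "b0 \<le> b n" for n unfolding b_def b0_def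
      by (rule cSup_subset_mono[OF False bdd[OF L(1)] KL])
    have "b \<longlonglongrightarrow> b0"
    proof (rule tendstoI)
      fix d :: real assume d: "d > 0"
      \<comment> \<open>A ray beyond \<open>b0\<close> eventually misses the chords of
        \<open>L n\<close>, which bounds \<open>b n\<close> from above; from below it is bounded by
        inclusion of \<open>K\<close>.\<close>
      have "\<forall>\<^sub>F n in sequentially. {b0 + d/2..} \<inter> line_set v (L n) x = {}"
      proof (rule line_avoids_eventually[OF v K _ _ L(4) e(1)])
        show "{b0 + d/2..} \<inter> line_set v K x = {}"
          using cSup_upper[OF _ bdd[OF K]] d by (force simp: b0_def)
      qed auto
      then show "\<forall>\<^sub>F n in sequentially. dist (b n) b0 < d"
      proof eventually_elim
        case (elim n)
        have "y \<le> b0 + d/2" if "y \<in> line_set v (L n) x" for y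
        proof (rule ccontr)
          assume "\<not> y \<le> b0 + d/2"
          then have "y \<in> {b0 + d/2..}" by simp
          then show False using elim that by blast
        qed
        then have "b n \<le> b0 + d/2" unfolding b_def by (intro cSup_least[OF ne])
        then show ?case using bge[of n] d by (simp add: dist_real_def)
      qed
    qed
    then have "(\<lambda>n. ennreal (1 / e n) * (\<integral>\<^sup>+s. ennreal (g (x + s *\<^sub>R v)) * indicator {b n <.. b n + e n} s \<partial>lborel))
       \<longlonglongrightarrow> ennreal (g (x + b0 *\<^sub>R v))"
      using g_nonneg e
      by (intro average_tendsto continuous_intros continuous_on_compose2[OF g_cont]) auto
    then show ?thesis
      using False unfolding u_eq[OF ne] top_value_def b_def b0_def
      by (cases "x \<in> slab v") auto
  qed
  obtain B where B: "B > 0" "\<And>n. e n \<le> B"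
  proof -
    have "Bseq e" using e(1) by (intro convergent_imp_Bseq convergentI)
    then obtain B where "B > 0" "\<forall>n. norm (e n) \<le> B" by (rule BseqE)
    then show ?thesis by (intro that[of B]) (auto dest: abs_le_D1)
  qed
  obtain RK where RK: "\<And>k. k \<in> K \<Longrightarrow> norm k \<le> RK" using compact_imp_bounded[OF K] unfolding bounded_iff by blast
  define R where "R = \<bar>RK\<bar> + \<bar>C\<bar> * B"
  have R0: "R \<ge> 0" using B by (simp add: R_def)
  have R: "norm y \<le> R" if y: "y \<in> L n" for n y
  proof -
    obtain k where k: "k \<in> K" "dist y k \<le> C * e n" using L(4)[OF y] by blast
    have "norm y \<le> norm k + dist y k" by (simp add: dist_norm norm_triangle_sub)
    also have "dist y k \<le> \<bar>C\<bar> * B"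
    proof -
      have "C * e n \<le> \<bar>C\<bar> * e n" using e(2)[of n] by (intro mult_right_mono) auto
      also have "\<dots> \<le> \<bar>C\<bar> * B" using B(2) by (intro mult_left_mono) auto
      finally show ?thesis using k(2) by simp
    qed
    finally show ?thesis using RK[OF k(1)] by (simp add: R_def)
  qed
  obtain M where M: "M > 0" "\<And>y. y \<in> cball 0 (R + B * norm v) \<Longrightarrow> g y \<le> M"
    using g_bounded_on_compact[OF compact_cball] by blast
  \<comment> \<open>The radius: the exit point x + b v has norm at most \<open>R\<close>, and in the
    slab the inner product of x and v is at most |v|^2. Hence |b| |v| \<le> R + |v|, and x has norm
    at most 2R + |v|.\<close>
  define w where "w x = ennreal M * indicator (cball 0 (2 * R + norm v)) x" for x :: 'a
  have [measurable]: "cball (0::'a) (2 * R + norm v) \<in> sets borel" by simp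
  have [measurable]: "w \<in> borel_measurable borel" unfolding w_def by measurable
  have int_w: "(\<integral>\<^sup>+x. w x \<partial>lborel) < \<infinity>"
    unfolding w_def
    using emeasure_lborel_cball_finite[of "0::'a" "2 * R + norm v"]
    by (subst nn_integral_cmult_indicator) (auto simp: ennreal_mult_less_top)
  have bound: "u n x \<le> w x" for n x
  proof (cases "line_set v (L n) x = {} \<or> x \<notin> slab v")
    case True
    then show ?thesis
    proof
      assume "line_set v (L n) x = {}"
      then show ?thesis by (simp add: u_empty)
    qed (simp add: u_def)
  next
    case False
    define b where "b = Sup (line_set v (L n) x)"
    have ne: "line_set v (L n) x \<noteq> {}" using False by simp
    have "b \<in> line_set v (L n) x"
      unfolding b_def using compact_line_set[OF v L(1)] ne
      by (intro closed_contains_Sup compact_imp_closed bounded_imp_bdd_above compact_imp_bounded) auto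
    then have bL: "norm (x + b *\<^sub>R v) \<le> R" using R by (simp add: line_set_def)
    have vv: "v \<bullet> v > 0" using v by simp
    have nv: "norm v > 0" using v by simp
    have "\<bar>b\<bar> * (norm v * norm v) = \<bar>(x + b *\<^sub>R v) \<bullet> v - x \<bullet> v\<bar>"
      by (simp add: inner_add_left abs_mult power2_norm_eq_inner[symmetric] power2_eq_square)
    also have "\<dots> \<le> \<bar>(x + b *\<^sub>R v) \<bullet> v\<bar> + \<bar>x \<bullet> v\<bar>" by (rule abs_triangle_ineq4)
    also have "\<bar>(x + b *\<^sub>R v) \<bullet> v\<bar> \<le> norm (x + b *\<^sub>R v) * norm v" by (rule Cauchy_Schwarz_ineq2)
    also have "\<dots> \<le> R * norm v" using bL by (rule mult_right_mono) simp
    also have "\<bar>x \<bullet> v\<bar> \<le> norm v * norm v" using False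
      by (auto simp: slab_def power2_norm_eq_inner[symmetric] power2_eq_square)
    finally have "(\<bar>b\<bar> * norm v) * norm v \<le> (R + norm v) * norm v" by (simp add: algebra_simps)
    then have bv: "\<bar>b\<bar> * norm v \<le> R + norm v" using nv by simp
    have "norm x \<le> norm (x + b *\<^sub>R v) + norm (b *\<^sub>R v)"
      using norm_triangle_ineq4[of "x + b *\<^sub>R v" "b *\<^sub>R v"] by simp
    also have "\<dots> \<le> 2 * R + norm v" using bL bv by simp
    finally have xR: "x \<in> cball 0 (2 * R + norm v)" by simp
    have gM: "g (x + s *\<^sub>R v) \<le> M" if s: "s \<in> {b <.. b + e n}" for s
    proof (rule M(2))
      have "norm (x + s *\<^sub>R v) = norm ((x + b *\<^sub>R v) + (s - b) *\<^sub>R v)" by (simp add: algebra_simps)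
      also have "\<dots> \<le> norm (x + b *\<^sub>R v) + norm ((s - b) *\<^sub>R v)" by (rule norm_triangle_ineq)
      also have "norm ((s - b) *\<^sub>R v) \<le> B * norm v"
        using s B(2)[of n] by (auto intro!: mult_right_mono)
      finally show "x + s *\<^sub>R v \<in> cball 0 (R + B * norm v)" using bL by simp
    qed
    have "u n x = ennreal (1 / e n) * (\<integral>\<^sup>+s. ennreal (g (x + s *\<^sub>R v)) * indicator {b <.. b + e n} s \<partial>lborel)"
      using u_eq[OF ne] False by (simp add: b_def)
    also have "\<dots> \<le> ennreal (1 / e n) * (\<integral>\<^sup>+s. ennreal M * indicator {b <.. b + e n} s \<partial>lborel)"
    proof (intro mult_left_mono nn_integral_mono)
      fix s show "ennreal (g (x + s *\<^sub>R v)) * indicator {b <.. b + e n} s \<le> ennreal M * indicator {b <.. b + e n} s"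
        using gM[of s] by (cases "s \<in> {b <.. b + e n}") (auto intro!: ennreal_leI)
    qed simp
    also have "\<dots> = ennreal M"
      using e(2)[of n] M(1) by (subst nn_integral_cmult_indicator) (simp_all add: ennreal_mult[symmetric])
    finally show ?thesis using xR by (simp add: w_def)
  qed
  \<comment> \<open>Measurability of \<open>top_value\<close> in x is inherited from the quotients
    of which it is the pointwise limit.\<close>
  have meas_lim: "(\<lambda>x. indicator (slab v) x * ennreal (top_value v K x)) \<in> borel_measurable lborel"
    by (rule borel_measurable_LIMSEQ_order[OF lim]) simp
  have conv: "(\<lambda>n. \<integral>\<^sup>+x. u n x \<partial>lborel) \<longlonglongrightarrow> (\<integral>\<^sup>+x. indicator (slab v) x * ennreal (top_value v K x) \<partial>lborel)"
    by (rule nn_integral_dominated_convergence[where w = w])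
       (use meas_lim bound int_w lim in auto)
  \<comment> \<open>\<open>enn2real\<close> sends infinity to 0, so the limit must be known to be
    finite before passing to the reals.\<close>
  have "(\<integral>\<^sup>+x. indicator (slab v) x * ennreal (top_value v K x) \<partial>lborel) \<le> (\<integral>\<^sup>+x. w x \<partial>lborel)"
    by (intro nn_integral_mono LIMSEQ_le_const2[OF lim]) (use bound in auto)
  then have fin: "(\<integral>\<^sup>+x. indicator (slab v) x * ennreal (top_value v K x) \<partial>lborel) < \<infinity>"
    using int_w by (rule le_less_trans)
  then have "(\<lambda>n. enn2real (\<integral>\<^sup>+x. u n x \<partial>lborel)) \<longlonglongrightarrow> face_mass v K"
    using conv unfolding face_mass_def by (intro tendsto_enn2real) auto
  moreover have "measure \<mu> (L n) \<le> measure \<mu> (L n + (*\<^sub>R) (e n) ` seg v)" for n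
    using sub[of n] cplus[of n] L(1)[of n] emeasure_\<mu>_compact[OF cplus[of n]]
    by (intro measure_mono_fmeasurable) (auto simp: borel_compact fmeasurable_def)
  ultimately show ?thesis unfolding int_u using e(2) by (simp add: less_imp_le)
qed

end

section \<open>Mixed measures and Minkowski's first inequality for zonotopes\<close>

text \<open>A list of generators rather than a set: induction adds one segment at a time, and
  generators may repeat.\<close>

primrec zon :: "'a::real_vector list \<Rightarrow> 'a set" where
  "zon [] = {0}"
| "zon (v # vs) = seg v + zon vs"

lemma zero_in_seg: "0 \<in> seg v"
  by (force simp: seg_def)

lemma zero_in_zon: "0 \<in> zon vs"
proof (induction vs)
  case (Cons v vs)
  have "0 + 0 \<in> seg v + zon vs" by (intro set_plus_intro zero_in_seg Cons)
  then show ?case by simp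
qed simp

lemma compact_zon: "compact (zon (vs :: 'a::real_normed_vector list))"
  by (induction vs) (auto intro: compact_plus_set compact_seg)

lemma convex_zon: "convex (zon (vs :: 'a::real_vector list))"
  by (induction vs) (auto intro: convex_set_plus convex_seg)

lemma scaleR_image_plus:
  fixes A B :: "'a::real_vector set"
  shows "(*\<^sub>R) c ` (A + B) = (*\<^sub>R) c ` A + (*\<^sub>R) c ` B"
proof (intro set_eqI iffI)
  fix x assume "x \<in> (*\<^sub>R) c ` (A + B)"
  then obtain a b where "a \<in> A" "b \<in> B" "x = c *\<^sub>R a + c *\<^sub>R b" by (auto simp: set_plus_def scaleR_add_right)
  then show "x \<in> (*\<^sub>R) c ` A + (*\<^sub>R) c ` B" by (auto intro!: set_plus_intro)
next
  fix x assume "x \<in> (*\<^sub>R) c ` A + (*\<^sub>R) c ` B"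
  then obtain a b where ab: "a \<in> A" "b \<in> B" "x = c *\<^sub>R (a + b)" by (auto simp: set_plus_def scaleR_add_right)
  then show "x \<in> (*\<^sub>R) c ` (A + B)" by (auto intro!: set_plus_intro)
qed

lemma sym_segment_eq_zon: "sym_segment \<theta> = zon [\<theta>, - \<theta>]"
proof (intro set_eqI iffI)
  fix x assume "x \<in> sym_segment \<theta>"
  then obtain t where t: "x = t *\<^sub>R \<theta>" "-1 \<le> t" "t \<le> 1" by (auto simp: sym_segment_def)
  have "max 0 t *\<^sub>R \<theta> + (max 0 (-t) *\<^sub>R (-\<theta>) + 0) \<in> zon [\<theta>, -\<theta>]"
    using t unfolding zon.simps by (intro set_plus_intro) (auto simp: seg_def)
  then show "x \<in> zon [\<theta>, -\<theta>]" by (simp add: t(1) max_def split: if_splits)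
next
  fix x assume "x \<in> zon [\<theta>, -\<theta>]"
  then obtain a b where "0 \<le> a" "a \<le> 1" "0 \<le> b" "b \<le> 1" "x = (a - b) *\<^sub>R \<theta>"
    by (auto simp: set_plus_def seg_def scaleR_diff_left)
  then show "x \<in> sym_segment \<theta>" by (auto simp: sym_segment_def intro!: exI[of _ "a - b"])
qed

context continuous_density
begin

lemma band_derivative:
  fixes K :: "'a set"
  assumes v: "v \<noteq> 0" and K: "compact K"
    and L: "\<And>\<epsilon>. 0 < \<epsilon> \<Longrightarrow> compact (L \<epsilon>)" "\<And>\<epsilon>. 0 < \<epsilon> \<Longrightarrow> convex (L \<epsilon>)" "\<And>\<epsilon>. 0 < \<epsilon> \<Longrightarrow> K \<subseteq> L \<epsilon>"
      "\<And>\<epsilon> y. 0 < \<epsilon> \<Longrightarrow> y \<in> L \<epsilon> \<Longrightarrow> \<exists>k\<in>K. dist y k \<le> C * \<epsilon>"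
  shows "((\<lambda>\<epsilon>. (measure \<mu> (L \<epsilon> + (*\<^sub>R) \<epsilon> ` seg v) - measure \<mu> (L \<epsilon>)) / \<epsilon>) \<longlongrightarrow> face_mass v K) (at_right 0)"
  unfolding tendsto_at_iff_sequentially
proof (intro allI impI)
  fix X :: "nat \<Rightarrow> real" assume "\<forall>i. X i \<in> {0<..} - {0}" "X \<longlonglongrightarrow> 0"
  then show "((\<lambda>\<epsilon>. (measure \<mu> (L \<epsilon> + (*\<^sub>R) \<epsilon> ` seg v) - measure \<mu> (L \<epsilon>)) / \<epsilon>) \<circ> X) \<longlonglongrightarrow> face_mass v K"
    unfolding o_def by (intro band_derivative_sequence[OF v K, where C = C] L) auto
qed

text \<open>The increment telescopes. Each segment is added to a body within C \<epsilon> of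
  \<open>K\<close>, and by the version of the derivative for varying bodies its contribution is the
  one it would make to \<open>K\<close> itself.\<close>

lemma zon_derivative:
  fixes K :: "'a set"
  assumes K: "compact K" "convex K" and vs: "0 \<notin> set vs"
  shows "((\<lambda>\<epsilon>. (measure \<mu> (K + (*\<^sub>R) \<epsilon> ` zon vs) - measure \<mu> K) / \<epsilon>) \<longlongrightarrow> (\<Sum>v\<leftarrow>vs. face_mass v K)) (at_right 0)"
  using vs
proof (induction vs)
  case Nil
  have "K + (*\<^sub>R) \<epsilon> ` zon [] = K" for \<epsilon> by (simp add: set_plus_def)
  then show ?case by (simp only:) simp
next
  case (Cons v vs)
  obtain C where C: "\<And>y. y \<in> zon vs \<Longrightarrow> norm y \<le> C"
    using compact_imp_bounded[OF compact_zon[of vs]] unfolding bounded_iff by blast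
  have "((\<lambda>\<epsilon>. (measure \<mu> ((K + (*\<^sub>R) \<epsilon> ` zon vs) + (*\<^sub>R) \<epsilon> ` seg v) - measure \<mu> (K + (*\<^sub>R) \<epsilon> ` zon vs)) / \<epsilon>)
      \<longlongrightarrow> face_mass v K) (at_right 0)"
  proof (rule band_derivative[where C = C])
    fix \<epsilon> :: real assume e: "\<epsilon> > 0"
    show "compact (K + (*\<^sub>R) \<epsilon> ` zon vs)" by (intro compact_plus_set K compact_scaling compact_zon)
    show "convex (K + (*\<^sub>R) \<epsilon> ` zon vs)" by (intro convex_set_plus K convex_scaling convex_zon)
    show "K \<subseteq> K + (*\<^sub>R) \<epsilon> ` zon vs"
    proof
      fix x assume x: "x \<in> K"
      have "0 \<in> (*\<^sub>R) \<epsilon> ` zon vs" using zero_in_zon[of vs] by force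
      then have "x + 0 \<in> K + (*\<^sub>R) \<epsilon> ` zon vs" by (intro set_plus_intro x)
      then show "x \<in> K + (*\<^sub>R) \<epsilon> ` zon vs" by simp
    qed
    fix y assume "y \<in> K + (*\<^sub>R) \<epsilon> ` zon vs"
    then obtain k z where kz: "k \<in> K" "z \<in> zon vs" "y = k + \<epsilon> *\<^sub>R z" by (auto simp: set_plus_def)
    then have "dist y k \<le> C * \<epsilon>" using C[of z] e by (simp add: dist_norm mult.commute)
    then show "\<exists>k\<in>K. dist y k \<le> C * \<epsilon>" using kz by blast
  qed (use Cons.prems K in auto)
  from tendsto_add[OF this Cons.IH] Cons.prems show ?case
    by (simp add: scaleR_image_plus add_ac flip: add_divide_distrib)
qed

lemma face_mass_nonneg: "0 \<le> face_mass v K"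
  by (simp add: face_mass_def)

text \<open>Both sides are limits of the same quotient with \<epsilon> replaced by a \<epsilon>;
  this avoids the slab, which itself changes with \<open>v\<close>.\<close>

lemma face_mass_scale:
  assumes K: "compact K" "convex K" and v: "v \<noteq> 0" and a: "a > 0"
  shows "face_mass (a *\<^sub>R v) K = a * face_mass v K"
proof -
  let ?D = "\<lambda>v \<epsilon>. (measure \<mu> (K + (*\<^sub>R) \<epsilon> ` zon [v]) - measure \<mu> K) / \<epsilon>"
  have lim: "filterlim (\<lambda>\<epsilon>. a * \<epsilon>) (at_right 0) (at_right (0::real))"
    by (rule filterlim_times_pos[OF filterlim_ident a]) simp
  have lhs: "(?D (a *\<^sub>R v) \<longlongrightarrow> face_mass (a *\<^sub>R v) K) (at_right 0)"
    using zon_derivative[OF K, of "[a *\<^sub>R v]"] v a by simp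
  have "((\<lambda>\<epsilon>. a * ?D v (a * \<epsilon>)) \<longlongrightarrow> a * face_mass v K) (at_right 0)"
    using zon_derivative[OF K, of "[v]"] v by (intro tendsto_mult tendsto_const filterlim_compose[OF _ lim]) simp
  moreover have "a * ?D v (a * \<epsilon>) = ?D (a *\<^sub>R v) \<epsilon>" for \<epsilon>
  proof -
    have "(*\<^sub>R) (a * \<epsilon>) ` zon [v] = (*\<^sub>R) \<epsilon> ` zon [a *\<^sub>R v]"
      by (simp add: seg_def image_image mult_ac flip: set_zero)
    then show ?thesis using a by simp
  qed
  ultimately have "(?D (a *\<^sub>R v) \<longlongrightarrow> a * face_mass v K) (at_right 0)" by (simp only:)
  with lhs show ?thesis by (rule tendsto_unique[rotated]) (rule trivial_limit_at_right_real)
qed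

definition width_mass :: "'a \<Rightarrow> 'a set \<Rightarrow> real" where
  "width_mass \<theta> K = face_mass \<theta> K + face_mass (- \<theta>) K"

lemma width_mass_nonneg: "0 \<le> width_mass \<theta> K"
  by (simp add: width_mass_def face_mass_nonneg)

lemma width_mass_derivative:
  assumes "compact K" "convex K" "\<theta> \<noteq> 0"
  shows "((\<lambda>\<epsilon>. (measure \<mu> (K + (*\<^sub>R) \<epsilon> ` sym_segment \<theta>) - measure \<mu> K) / \<epsilon>) \<longlongrightarrow> width_mass \<theta> K) (at_right 0)"
  using zon_derivative[OF assms(1,2), of "[\<theta>, - \<theta>]"] assms(3) unfolding sym_segment_eq_zon width_mass_def by simp

text \<open>The difference quotients converge in the reals, so the lower limit is an ordinary,
  finite limit.\<close>

lemma mixed_measure_sym_segment: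
  assumes K: "compact K" "convex K" and th: "\<theta> \<noteq> 0"
  shows "mixed_measure \<mu> K (sym_segment \<theta>) = ereal (width_mass \<theta> K)"
proof -
  have "((\<lambda>\<epsilon>. ereal ((measure \<mu> (K + (*\<^sub>R) \<epsilon> ` sym_segment \<theta>) - measure \<mu> K) / \<epsilon>)) \<longlongrightarrow> ereal (width_mass \<theta> K)) (at_right 0)"
    using width_mass_derivative[OF K th] by (rule tendsto_ereal)
  moreover have "\<forall>\<^sub>F \<epsilon> in at_right 0. ereal ((measure \<mu> (K + (*\<^sub>R) \<epsilon> ` sym_segment \<theta>) - measure \<mu> K) / \<epsilon>)
     = (enn2ereal (emeasure \<mu> (K + (*\<^sub>R) \<epsilon> ` sym_segment \<theta>)) - enn2ereal (emeasure \<mu> K)) / ereal \<epsilon>"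
    using eventually_at_right_less[of "0::real"]
  proof eventually_elim
    case (elim \<epsilon>)
    have "compact (K + (*\<^sub>R) \<epsilon> ` sym_segment \<theta>)"
      unfolding sym_segment_eq_zon by (intro compact_plus_set K compact_scaling compact_zon)
    then show ?case using K elim by (simp add: emeasure_\<mu>_eq_measure enn2ereal_ennreal)
  qed
  ultimately have "((\<lambda>\<epsilon>. (enn2ereal (emeasure \<mu> (K + (*\<^sub>R) \<epsilon> ` sym_segment \<theta>)) - enn2ereal (emeasure \<mu> K)) / ereal \<epsilon>)
     \<longlongrightarrow> ereal (width_mass \<theta> K)) (at_right 0)"
    by (rule Lim_transform_eventually)
  then show ?thesis unfolding mixed_measure_def
    by (intro lim_imp_Liminf) (auto simp: trivial_limit_at_right_real)
qed

end

section \<open>Homogeneity of the first variation and Minkowski's inequality\<close>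

context concave_homogeneous_density
begin

text \<open>tK + \<epsilon>A is the dilate by t of K + (\<epsilon>/t)A: the measure contributes t^q,
  and the change of \<epsilon> costs one factor t.\<close>

lemma width_mass_scaled_body:
  assumes K: "compact K" "convex K" and th: "\<theta> \<noteq> 0" and t: "t > 0"
  shows "width_mass \<theta> ((*\<^sub>R) t ` K) = t powr (q - 1) * width_mass \<theta> K"
proof -
  let ?A = "sym_segment \<theta>"
  let ?D = "\<lambda>K \<epsilon>. (measure \<mu> (K + (*\<^sub>R) \<epsilon> ` ?A) - measure \<mu> K) / \<epsilon>"
  have lim: "filterlim (\<lambda>\<epsilon>. \<epsilon> / t) (at_right 0) (at_right (0::real))"
    using filterlim_times_pos[OF filterlim_ident, of "1 / t" 0 0] t by simp
  have lhs: "(?D ((*\<^sub>R) t ` K) \<longlongrightarrow> width_mass \<theta> ((*\<^sub>R) t ` K)) (at_right 0)"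
    by (intro width_mass_derivative compact_scaling convex_scaling K th)
  have "((\<lambda>\<epsilon>. t powr (q - 1) * ?D K (\<epsilon> / t)) \<longlongrightarrow> t powr (q - 1) * width_mass \<theta> K) (at_right 0)"
    by (intro tendsto_mult tendsto_const filterlim_compose[OF width_mass_derivative[OF K th] lim])
  moreover have "t powr (q - 1) * ?D K (\<epsilon> / t) = ?D ((*\<^sub>R) t ` K) \<epsilon>" for \<epsilon>
  proof -
    have "(*\<^sub>R) t ` K + (*\<^sub>R) \<epsilon> ` ?A = (*\<^sub>R) t ` (K + (*\<^sub>R) (\<epsilon> / t) ` ?A)"
      using t by (simp add: scaleR_image_plus image_image)
    moreover have "compact (K + (*\<^sub>R) (\<epsilon> / t) ` ?A)"
      unfolding sym_segment_eq_zon by (intro compact_plus_set K compact_scaling compact_zon)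
    ultimately have eq: "?D ((*\<^sub>R) t ` K) \<epsilon> = t powr q * (measure \<mu> (K + (*\<^sub>R) (\<epsilon> / t) ` ?A) - measure \<mu> K) / \<epsilon>"
      using K t by (simp add: measure_\<mu>_scale right_diff_distrib)
    show ?thesis unfolding eq using t by (simp add: powr_diff)
  qed
  ultimately have "(?D ((*\<^sub>R) t ` K) \<longlongrightarrow> t powr (q - 1) * width_mass \<theta> K) (at_right 0)" by (simp only:)
  with lhs show ?thesis by (rule tendsto_unique[rotated]) (rule trivial_limit_at_right_real)
qed

lemma integral_mixed_measure:
  assumes K: "compact K" "convex K" and th: "\<theta> \<noteq> 0"
  shows "(LBINT t:{0..1}. real_of_ereal (mixed_measure \<mu> ((*\<^sub>R) t ` K) (sym_segment \<theta>))) = width_mass \<theta> K / q"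
proof -
  have q: "q > 1" by (rule q_gt_1)
  have eq: "real_of_ereal (mixed_measure \<mu> ((*\<^sub>R) t ` K) (sym_segment \<theta>)) = t powr (q - 1) * width_mass \<theta> K"
    if "t > 0" for t
    using that K th by (simp add: mixed_measure_sym_segment compact_scaling convex_scaling width_mass_scaled_body)
  \<comment> \<open>The scaling formula is available for \<open>t > 0\<close>; the point 0 is a null
    set.\<close>
  have "(LBINT t:{0..1}. real_of_ereal (mixed_measure \<mu> ((*\<^sub>R) t ` K) (sym_segment \<theta>)))
     = (LBINT t:{0..1}. t powr (q - 1) * width_mass \<theta> K)"
    unfolding set_lebesgue_integral_def
  proof (rule integral_discrete_difference[where X = "{0}"])
    fix t :: real assume "t \<notin> {0}"
    then show "indicator {0..1} t *\<^sub>R real_of_ereal (mixed_measure \<mu> ((*\<^sub>R) t ` K) (sym_segment \<theta>))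
       = indicator {0..1} t *\<^sub>R (t powr (q - 1) * width_mass \<theta> K)"
      using eq[of t] by (cases "t \<in> {0..1}") auto
  qed auto
  also have "\<dots> = (LBINT t:{0..1}. t powr (q - 1)) * width_mass \<theta> K" by simp
  also have "(LBINT t:{0..1}. t powr (q - 1)) = 1 / q"
  proof -
    have "set_integrable lborel {0..1} (\<lambda>t::real. t powr (q - 1))"
      using q by (intro borel_integrable_atLeastAtMost' continuous_on_powr' continuous_intros) auto
    then have "(LBINT t:{0..1}. t powr (q - 1)) = integral {0..1} (\<lambda>t::real. t powr (q - 1))"
      by (rule set_borel_integral_eq_integral)
    also have "\<dots> = 1 / q" using has_integral_powr_from_0[of "q - 1" 1] q by (simp add: integral_unique)
    finally show ?thesis .
  qed
  finally show ?thesis by simp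
qed

lemma minkowski_first:
  assumes K: "compact K" "convex K" "0 < measure \<mu> K" and Z: "0 < measure \<mu> (zon vs)" "0 \<notin> set vs"
  shows "q * measure \<mu> K powr (1 - 1 / q) * measure \<mu> (zon vs) powr (1 / q) \<le> (\<Sum>v\<leftarrow>vs. face_mass v K)"
proof (rule tendsto_lowerbound[OF zon_derivative[OF K(1,2) Z(2)]])
  show "\<forall>\<^sub>F \<epsilon> in at_right 0. q * measure \<mu> K powr (1 - 1 / q) * measure \<mu> (zon vs) powr (1 / q)
     \<le> (measure \<mu> (K + (*\<^sub>R) \<epsilon> ` zon vs) - measure \<mu> K) / \<epsilon>"
    using eventually_at_right_less[of "0::real"]
    by eventually_elim (intro measure_plus_scaled_ge K Z compact_zon)
qed (simp add: trivial_limit_at_right_real)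

text \<open>Retains only what is used of the zonotope, without lists. The inequality is conditional
  because positivity of \<mu>(Z) will be derived from the combinations that \<open>Z\<close>
  contains.\<close>

lemma minkowski_zonotope:
  fixes u :: "'i \<Rightarrow> 'a"
  assumes K: "compact K" "convex K" "0 < measure \<mu> K" and I: "finite I"
    and u: "\<And>i. i \<in> I \<Longrightarrow> u i \<noteq> 0" and a: "\<And>i. i \<in> I \<Longrightarrow> 0 < a i"
  shows "\<exists>Z. compact Z \<and> (\<forall>b. (\<forall>i\<in>I. \<bar>b i\<bar> \<le> a i) \<longrightarrow> (\<Sum>i\<in>I. b i *\<^sub>R u i) \<in> Z) \<and>
    (0 < measure \<mu> Z \<longrightarrow> q * measure \<mu> K powr (1 - 1 / q) * measure \<mu> Z powr (1 / q) \<le> (\<Sum>i\<in>I. a i * width_mass (u i) K))"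
proof -
  obtain xs where xs: "set xs = I" "distinct xs" using finite_distinct_list[OF I] by blast
  define vs where "vs = concat (map (\<lambda>i. [a i *\<^sub>R u i, - (a i *\<^sub>R u i)]) xs)"
  have "(\<Sum>v\<leftarrow>vs. face_mass v K) = (\<Sum>i\<leftarrow>xs. a i * width_mass (u i) K)"
  proof -
    have "face_mass (a i *\<^sub>R u i) K + face_mass (- (a i *\<^sub>R u i)) K = a i * width_mass (u i) K" if "i \<in> I" for i
      using face_mass_scale[OF K(1,2), of "u i" "a i"] face_mass_scale[OF K(1,2), of "- u i" "a i"] u[OF that] a[OF that]
      by (simp add: width_mass_def distrib_left)
    then show ?thesis unfolding vs_def xs(1)[symmetric] by (induction xs) (auto simp: add.assoc[symmetric])
  qed
  then have sum: "(\<Sum>v\<leftarrow>vs. face_mass v K) = (\<Sum>i\<in>I. a i * width_mass (u i) K)"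
    using xs by (simp add: sum_list_distinct_conv_sum_set)
  have mem: "(\<Sum>i\<in>I. b i *\<^sub>R u i) \<in> zon vs" if b: "\<And>i. i \<in> I \<Longrightarrow> \<bar>b i\<bar> \<le> a i" for b
  proof -
    have "(\<Sum>i\<leftarrow>xs. b i *\<^sub>R u i) \<in> zon vs"
      using a b unfolding vs_def xs(1)[symmetric]
    proof (induction xs)
      case (Cons i xs)
      have ai: "0 < a i" "\<bar>b i\<bar> \<le> a i" using Cons.prems by auto
      \<comment> \<open>The positive part of \<open>b i\<close> comes from the segment along
        \<open>u i\<close>, the negative part from the opposite one.\<close>
      have "(max 0 (b i) / a i) *\<^sub>R (a i *\<^sub>R u i) \<in> seg (a i *\<^sub>R u i)" 
        unfolding seg_def using ai by (intro imageI) auto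
      moreover have "(max 0 (- b i) / a i) *\<^sub>R (- (a i *\<^sub>R u i)) \<in> seg (- (a i *\<^sub>R u i))"
        unfolding seg_def using ai by (intro imageI) auto
      moreover have "(\<Sum>i\<leftarrow>xs. b i *\<^sub>R u i) \<in> zon (concat (map (\<lambda>i. [a i *\<^sub>R u i, - (a i *\<^sub>R u i)]) xs))"
        using Cons by auto
      ultimately have "(max 0 (b i) / a i) *\<^sub>R (a i *\<^sub>R u i) + ((max 0 (- b i) / a i) *\<^sub>R (- (a i *\<^sub>R u i)) + (\<Sum>i\<leftarrow>xs. b i *\<^sub>R u i))
         \<in> zon (concat (map (\<lambda>i. [a i *\<^sub>R u i, - (a i *\<^sub>R u i)]) (i # xs)))"
        unfolding list.map concat.simps append_Cons append_Nil zon.simps by (intro set_plus_intro)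
      also have "(max 0 (b i) / a i) *\<^sub>R (a i *\<^sub>R u i) + ((max 0 (- b i) / a i) *\<^sub>R (- (a i *\<^sub>R u i)) + (\<Sum>i\<leftarrow>xs. b i *\<^sub>R u i))
         = (\<Sum>i\<leftarrow>i # xs. b i *\<^sub>R u i)"
        using ai by (simp add: max_def)
      finally show ?case .
    qed simp
    then show ?thesis using xs by (simp add: sum_list_distinct_conv_sum_set)
  qed
  have nz: "0 \<notin> set vs"
  proof
    assume "0 \<in> set vs"
    then obtain i where "i \<in> I" "a i *\<^sub>R u i = 0" by (auto simp: vs_def xs(1))
    then show False using u[of i] a[of i] by simp
  qed
  show ?thesis
  proof (intro exI[of _ "zon vs"] conjI allI impI)
    show "compact (zon vs)" by (rule compact_zon)
    show "(\<Sum>i\<in>I. b i *\<^sub>R u i) \<in> zon vs" if "\<forall>i\<in>I. \<bar>b i\<bar> \<le> a i" for b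
      by (rule mem) (use that in blast)
    show "q * measure \<mu> K powr (1 - 1 / q) * measure \<mu> (zon vs) powr (1 / q) \<le> (\<Sum>i\<in>I. a i * width_mass (u i) K)"
      if "0 < measure \<mu> (zon vs)"
      using minkowski_first[OF K that nz] unfolding sum .
  qed
qed

end

section \<open>A determinant inequality\<close>

text \<open>A maximiser x of the quadratic form on the unit sphere of \<open>S\<close> is an
  eigenvector: along the defect w = f x - c x the Rayleigh quotient would otherwise
  increase.\<close>

lemma self_adjoint_eigenvector:
  fixes f :: "'a::euclidean_space \<Rightarrow> 'a"
  assumes f: "linear f" and adj: "\<And>x y. f x \<bullet> y = x \<bullet> f y"
    and S: "subspace S" "f ` S \<subseteq> S" "S \<noteq> {0}"
  obtains x c where "x \<in> S" "norm x = 1" "f x = c *\<^sub>R x"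
proof -
  let ?U = "S \<inter> sphere 0 1"
  have "compact ?U" using S(1) by (intro closed_Int_compact closed_subspace) auto
  moreover have "?U \<noteq> {}"
  proof -
    obtain y where "y \<in> S" "y \<noteq> 0" using S(1,3) subspace_0 by blast
    then have "y /\<^sub>R norm y \<in> ?U" using S(1) by (auto simp: subspace_scale)
    then show ?thesis by blast
  qed
  moreover have "continuous_on ?U (\<lambda>x. x \<bullet> f x)"
    by (intro continuous_intros linear_continuous_on linear_conv_bounded_linear[THEN iffD1] f)
  ultimately obtain x where x: "x \<in> ?U" "\<And>y. y \<in> ?U \<Longrightarrow> y \<bullet> f y \<le> x \<bullet> f x"
    using continuous_attains_sup[of ?U "\<lambda>x. x \<bullet> f x"] by blast
  define c where "c = x \<bullet> f x"
  have xx: "x \<bullet> x = 1" "x \<in> S" "norm x = 1" using x(1) by (auto simp: norm_eq_1)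
  have le: "y \<bullet> f y \<le> c * (y \<bullet> y)" if "y \<in> S" for y
  proof (cases "y = 0")
    case False
    have "(y /\<^sub>R norm y) \<bullet> f (y /\<^sub>R norm y) \<le> c"
      unfolding c_def using that False S(1) by (intro x(2)) (auto simp: subspace_scale)
    then show ?thesis using False
      by (simp add: linear_scale[OF f] field_simps power2_norm_eq_inner[symmetric] power2_eq_square)
  qed (simp add: linear_0[OF f])
  define w where "w = f x - c *\<^sub>R x"
  have w: "w \<in> S" unfolding w_def using xx S by (intro subspace_diff subspace_scale) auto
  \<comment> \<open>Maximality tested at x + t w; what survives to first order is 2 t |w|^2.\<close>
  have key: "2 * t * (w \<bullet> w) \<le> t\<^sup>2 * (c * (w \<bullet> w) - w \<bullet> f w)" for t
  proof -
    have le': "(x + t *\<^sub>R w) \<bullet> f (x + t *\<^sub>R w) \<le> c * ((x + t *\<^sub>R w) \<bullet> (x + t *\<^sub>R w))"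
      using w xx S(1) by (intro le subspace_add subspace_scale) auto
    have A: "(x + t *\<^sub>R w) \<bullet> f (x + t *\<^sub>R w) = c + 2 * t * (w \<bullet> f x) + t\<^sup>2 * (w \<bullet> f w)"
      using adj[of x w] by (simp add: linear_add[OF f] linear_scale[OF f] inner_add_left inner_add_right
        c_def power2_eq_square inner_commute algebra_simps)
    have B: "(x + t *\<^sub>R w) \<bullet> (x + t *\<^sub>R w) = 1 + 2 * t * (w \<bullet> x) + t\<^sup>2 * (w \<bullet> w)"
      using xx by (simp add: inner_add_left inner_add_right power2_eq_square inner_commute algebra_simps)
    have D: "w \<bullet> f x = w \<bullet> w + c * (w \<bullet> x)" by (simp add: w_def inner_diff_right inner_diff_left algebra_simps)
    show ?thesis using le' unfolding A B D by (simp add: algebra_simps)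
  qed
  have "w \<bullet> w = 0"
  proof (rule ccontr)
    assume "w \<bullet> w \<noteq> 0"
    then have pos: "w \<bullet> w > 0" by simp
    \<comment> \<open>The summand 1 makes \<open>C\<close> positive; with this t the quadratic term
      is at most t |w|^2, half of the linear one.\<close>
    define C where "C = \<bar>c * (w \<bullet> w) - w \<bullet> f w\<bar> + 1"
    define t where "t = (w \<bullet> w) / C"
    have C: "C > 0" by (simp add: C_def)
    have t: "t > 0" using pos C by (simp add: t_def)
    have "2 * t * (w \<bullet> w) \<le> t\<^sup>2 * (c * (w \<bullet> w) - w \<bullet> f w)" by (rule key)
    also have "\<dots> \<le> t\<^sup>2 * C" by (intro mult_left_mono) (auto simp: C_def)
    also have "\<dots> = t * (w \<bullet> w)" using C by (simp add: t_def power2_eq_square)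
    finally show False using t pos by simp
  qed
  then have "f x = c *\<^sub>R x" by (simp add: w_def)
  then show ?thesis using that xx by blast
qed

text \<open>Split off one eigenvector; self-adjointness keeps its orthogonal complement in
  \<open>S\<close> invariant.\<close>

lemma self_adjoint_eigenbasis_subspace:
  fixes f :: "'a::euclidean_space \<Rightarrow> 'a"
  assumes f: "linear f" and adj: "\<And>x y. f x \<bullet> y = x \<bullet> f y"
    and "subspace S" "f ` S \<subseteq> S"
  shows "\<exists>B. B \<subseteq> S \<and> pairwise orthogonal B \<and> (\<forall>b\<in>B. norm b = 1 \<and> (\<exists>c. f b = c *\<^sub>R b)) \<and> span B = S"
  using assms(3,4)
proof (induction "dim S" arbitrary: S rule: less_induct)
  case less
  show ?case
  proof (cases "S = {0}")
    case True
    then show ?thesis by (intro exI[of _ "{}"]) auto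
  next
    case False
    obtain x c where x: "x \<in> S" "norm x = 1" "f x = c *\<^sub>R x"
      using self_adjoint_eigenvector[OF f adj less.prems False] by blast
    have xx: "x \<bullet> x = 1" using x(2) by (simp add: norm_eq_1)
    define T where "T = {y \<in> S. y \<bullet> x = 0}"
    have T: "subspace T" using less.prems(1) by (auto simp: T_def subspace_def inner_add_left)
    have fT: "f ` T \<subseteq> T" using less.prems(2) adj x(3) by (auto simp: T_def)
    have "x \<notin> T" "T \<subseteq> S" using xx by (simp_all add: T_def)
    then have "T \<subset> S" using x(1) by blast
    then have "dim T < dim S"
      using T less.prems(1) by (intro dim_psubset) (simp add: span_eq_iff[THEN iffD2])
    then obtain B where B: "B \<subseteq> T" "pairwise orthogonal B" "\<forall>b\<in>B. norm b = 1 \<and> (\<exists>c. f b = c *\<^sub>R b)" "span B = T"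
      using less.hyps T fT by blast
    have "span (insert x B) = S"
    proof
      have "insert x B \<subseteq> S" using x(1) B(1) by (auto simp: T_def)
      then show "span (insert x B) \<subseteq> S" using less.prems(1) by (rule span_minimal)
      show "S \<subseteq> span (insert x B)"
      proof
        fix y assume y: "y \<in> S"
        have "y - (y \<bullet> x) *\<^sub>R x \<in> T"
          using y x(1) xx less.prems(1) by (auto simp: T_def inner_diff_left subspace_diff subspace_scale)
        then have "y - (y \<bullet> x) *\<^sub>R x \<in> span (insert x B)" using B(4) span_mono[of B "insert x B"] by blast
        moreover have "(y \<bullet> x) *\<^sub>R x \<in> span (insert x B)" by (intro span_scale span_base) simp
        ultimately have "(y - (y \<bullet> x) *\<^sub>R x) + (y \<bullet> x) *\<^sub>R x \<in> span (insert x B)" by (rule span_add)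
        then show "y \<in> span (insert x B)" by simp
      qed
    qed
    moreover have "pairwise orthogonal (insert x B)"
      using B(1,2) by (auto simp: pairwise_insert T_def orthogonal_def inner_commute)
    ultimately show ?thesis using B x by (intro exI[of _ "insert x B"]) (auto simp: T_def)
  qed
qed

lemma self_adjoint_orthonormal_eigenbasis:
  fixes f :: "real^'n \<Rightarrow> real^'n"
  assumes f: "linear f" and adj: "\<And>x y. f x \<bullet> y = x \<bullet> f y"
  obtains e :: "'n \<Rightarrow> real^'n" and c where "orthogonal_matrix (\<chi> i. e i)" "\<And>i. f (e i) = c i *\<^sub>R e i"
proof -
  obtain B where B: "pairwise orthogonal B" "\<forall>b\<in>B. norm b = 1 \<and> (\<exists>c. f b = c *\<^sub>R b)" "span B = (UNIV :: (real^'n) set)"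
    using self_adjoint_eigenbasis_subspace[OF f adj subspace_UNIV] by auto
  have "independent B" using B by (intro pairwise_orthogonal_independent) auto
  then have card: "card B = CARD('n)" "finite B"
    using basis_card_eq_dim[of B UNIV] B(3) by (auto simp: independent_imp_finite)
  then obtain e where e: "bij_betw e (UNIV::'n set) B"
    using finite_same_card_bij[of "UNIV::'n set" B] by auto
  have eB: "e i \<in> B" for i using e by (auto simp: bij_betw_def)
  have "orthogonal (e i) (e j)" if "i \<noteq> j" for i j
  proof -
    have "e i \<noteq> e j" using that e by (auto simp: bij_betw_def inj_on_def)
    then show ?thesis using B(1) eB by (simp add: pairwise_def)
  qed
  then have "orthogonal_matrix (\<chi> i. e i)"
    using eB B(2) by (auto simp: orthogonal_matrix_orthonormal_rows row_def)
  moreover have "\<forall>i. \<exists>c. f (e i) = c *\<^sub>R e i" using eB B(2) by blast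
  then obtain c where "\<forall>i. f (e i) = c i *\<^sub>R e i" by (rule choice[THEN exE])
  ultimately show ?thesis using that[of e c] by simp
qed

lemma weighted_arith_geo_mean:
  fixes w x :: "'i \<Rightarrow> real"
  assumes "finite I" "(\<Sum>i\<in>I. w i) = 1" "\<And>i. i \<in> I \<Longrightarrow> 0 \<le> w i" "\<And>i. i \<in> I \<Longrightarrow> 0 < x i"
  shows "(\<Prod>i\<in>I. x i powr w i) \<le> (\<Sum>i\<in>I. w i * x i)"
proof -
  have ne: "I \<noteq> {}" using assms(2) by auto
  have "(\<Sum>i\<in>I. w i * ln (x i)) \<le> ln (\<Sum>i\<in>I. w i *\<^sub>R x i)"
    using assms ne ln_concave by (intro concave_on_sum) auto
  moreover have "0 < (\<Sum>i\<in>I. w i *\<^sub>R x i)"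
  proof -
    obtain i where i: "i \<in> I" "w i > 0"
      using assms(2,3) by (metis less_eq_real_def sum.neutral zero_neq_one)
    show ?thesis
    proof (rule sum_pos2[OF assms(1) i(1)])
      show "0 < w i *\<^sub>R x i" using i assms(4) by simp
    qed (use assms(3,4) in \<open>auto intro!: mult_nonneg_nonneg intro: less_imp_le\<close>)
  qed
  ultimately have "exp (\<Sum>i\<in>I. w i * ln (x i)) \<le> (\<Sum>i\<in>I. w i *\<^sub>R x i)"
    by (simp add: ln_ge_iff)
  moreover have "exp (\<Sum>i\<in>I. w i * ln (x i)) = (\<Prod>i\<in>I. x i powr w i)"
    using assms by (auto simp: exp_sum powr_def less_imp_neq[symmetric] intro!: prod.cong)
  ultimately show ?thesis by simp
qed

lemma matrix_entry_inner:
  fixes M :: "real^'n^'n" and e :: "'n \<Rightarrow> real^'n"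
  shows "((\<chi> i. e i) ** M ** transpose (\<chi> i. e i)) $ i $ j = e i \<bullet> (M *v e j)"
proof -
  let ?Q = "\<chi> i. e i"
  have "(?Q ** M ** transpose ?Q) $ i $ j = (?Q ** M ** transpose ?Q *v axis j 1) $ i"
    by (simp add: matrix_vector_mult_basis column_def)
  also have "\<dots> = (?Q *v (M *v (transpose ?Q *v axis j 1))) $ i"
    by (simp only: matrix_vector_mul_assoc matrix_mul_assoc)
  also have "transpose ?Q *v axis j 1 = e j"
    by (simp add: matrix_vector_mult_basis column_def transpose_def vec_eq_iff)
  finally show ?thesis by (simp add: matrix_vector_mul_component)
qed

lemma sum_inner_orthogonal_rows:
  fixes e :: "'n \<Rightarrow> real^'n"
  assumes "orthogonal_matrix (\<chi> i. e i)"
  shows "(\<Sum>k\<in>UNIV. (e k \<bullet> x)\<^sup>2) = x \<bullet> x"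
proof -
  let ?Q = "\<chi> i. e i"
  have "(?Q *v x) \<bullet> (?Q *v x) = x \<bullet> x"
  proof -
    have "orthogonal_transformation ((*v) ?Q)"
      using assms by (simp add: orthogonal_transformation_matrix matrix_vector_mul_linear matrix_of_matrix_vector_mul)
    then show ?thesis by (simp add: orthogonal_transformation_def)
  qed
  moreover have "(?Q *v x) \<bullet> (?Q *v x) = (\<Sum>k\<in>UNIV. (e k \<bullet> x)\<^sup>2)"
    by (simp add: inner_vec_def matrix_vector_mult_def power2_eq_square)
  ultimately show ?thesis by simp
qed

text \<open>In an orthonormal eigenbasis the determinant is the product of the diagonal entries, each of
  which is a weighted mean of the \<open>l i\<close>.\<close>

lemma det_ge_prod_powr:
  fixes u :: "'i \<Rightarrow> real^'n"
  assumes I: "finite I" and u: "\<And>i. i \<in> I \<Longrightarrow> norm (u i) = 1" and c: "\<And>i. i \<in> I \<Longrightarrow> 0 < c i"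
    and id: "\<And>x. (\<Sum>i\<in>I. c i *\<^sub>R rank_one (u i) x) = x" and l: "\<And>i. i \<in> I \<Longrightarrow> 0 < l i"
  shows "(\<Prod>i\<in>I. l i powr c i) \<le> det (matrix (\<lambda>x. \<Sum>i\<in>I. (c i * l i) *\<^sub>R rank_one (u i) x))"
proof -
  define f where "f = (\<lambda>x. \<Sum>i\<in>I. (c i * l i) *\<^sub>R rank_one (u i) x)"
  have f: "linear f" unfolding f_def rank_one_def
    by (intro linear_compose_sum ballI) (auto simp: linear_iff inner_add_left algebra_simps)
  have adj: "f x \<bullet> y = x \<bullet> f y" for x y
    by (simp add: f_def rank_one_def inner_sum_left inner_sum_right inner_commute mult_ac)
  obtain e :: "'n \<Rightarrow> real^'n" and a where e: "orthogonal_matrix (\<chi> i. e i)" "\<And>i. f (e i) = a i *\<^sub>R e i"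
    using self_adjoint_orthonormal_eigenbasis[OF f adj] by blast
  let ?Q = "\<chi> i. e i"
  have ee: "e i \<bullet> e i = 1" "i \<noteq> j \<Longrightarrow> e i \<bullet> e j = 0" for i j
    using e(1) by (auto simp: orthogonal_matrix_orthonormal_rows row_def norm_eq_1 orthogonal_def)
  have M: "matrix f *v x = f x" for x using f by (metis linear_matrix_vector_mul_eq matrix_works)
  have "det (matrix f) = det (?Q ** matrix f ** transpose ?Q)"
  proof -
    have "det ?Q * det (transpose ?Q) = 1"
      using e(1) det_mul[of ?Q "transpose ?Q"] by (simp add: orthogonal_matrix_def)
    then show ?thesis by (simp add: det_mul)
  qed
  also have "\<dots> = (\<Prod>k\<in>UNIV. e k \<bullet> f (e k))"
    by (subst det_diagonal) (auto simp: matrix_entry_inner M e(2) ee)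
  finally have det: "det (matrix f) = (\<Prod>k\<in>UNIV. e k \<bullet> f (e k))" .
  \<comment> \<open>The decomposition of the identity, tested at the unit vector \<open>e k\<close>,
    makes the weights of the k-th mean add up to 1.\<close>
  have w1: "(\<Sum>i\<in>I. c i * (e k \<bullet> u i)\<^sup>2) = 1" for k
  proof -
    have "1 = e k \<bullet> (\<Sum>i\<in>I. c i *\<^sub>R rank_one (u i) (e k))" by (simp add: id ee)
    also have "\<dots> = (\<Sum>i\<in>I. c i * (e k \<bullet> u i)\<^sup>2)"
      by (simp add: inner_sum_right rank_one_def power2_eq_square mult.assoc)
    finally show ?thesis by simp
  qed
  have diag: "(\<Prod>i\<in>I. l i powr (c i * (e k \<bullet> u i)\<^sup>2)) \<le> e k \<bullet> f (e k)" for k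
  proof -
    have "(\<Prod>i\<in>I. l i powr (c i * (e k \<bullet> u i)\<^sup>2)) \<le> (\<Sum>i\<in>I. (c i * (e k \<bullet> u i)\<^sup>2) * l i)"
      using I w1 c l by (intro weighted_arith_geo_mean) (auto intro!: mult_nonneg_nonneg intro: less_imp_le)
    also have "\<dots> = e k \<bullet> f (e k)"
      by (simp add: f_def inner_sum_right rank_one_def power2_eq_square mult_ac)
    finally show ?thesis .
  qed
  \<comment> \<open>The squared coordinates of the unit vector \<open>u i\<close> in the eigenbasis
    add up to 1, which splits the exponent over k.\<close>
  have "(\<Prod>i\<in>I. l i powr c i) = (\<Prod>i\<in>I. l i powr (\<Sum>k\<in>UNIV. c i * (e k \<bullet> u i)\<^sup>2))"
    using u by (intro prod.cong refl) (simp add: sum_distrib_left[symmetric] sum_inner_orthogonal_rows[OF e(1)] norm_eq_1)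
  also have "\<dots> = (\<Prod>i\<in>I. \<Prod>k\<in>UNIV. l i powr (c i * (e k \<bullet> u i)\<^sup>2))"
    using l by (intro prod.cong refl powr_sum) (auto simp: less_imp_neq[symmetric])
  also have "\<dots> = (\<Prod>k\<in>UNIV. \<Prod>i\<in>I. l i powr (c i * (e k \<bullet> u i)\<^sup>2))" by (rule prod.swap)
  also have "\<dots> \<le> (\<Prod>k\<in>UNIV. e k \<bullet> f (e k))"
    using diag by (intro prod_mono) (auto intro: prod_nonneg)
  finally have "(\<Prod>i\<in>I. l i powr c i) \<le> det (matrix f)" unfolding det .
  then show ?thesis by (simp only: f_def)
qed

text \<open>Compare traces: each u_i \<otimes> u_i has trace |u_i|^2 = 1.\<close>

lemma sum_weights_eq_dim:
  fixes u :: "'i \<Rightarrow> real^'n"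
  assumes u: "\<And>i. i \<in> I \<Longrightarrow> norm (u i) = 1"
    and id: "\<And>x. (\<Sum>i\<in>I. c i *\<^sub>R rank_one (u i) x) = x"
  shows "(\<Sum>i\<in>I. c i) = real CARD('n)"
proof -
  have "real CARD('n) = (\<Sum>b\<in>(Basis::(real^'n) set). b \<bullet> b)" by simp
  also have "\<dots> = (\<Sum>b\<in>(Basis::(real^'n) set). \<Sum>i\<in>I. c i * (u i \<bullet> b)\<^sup>2)"
  proof (intro sum.cong refl)
    fix b :: "real^'n"
    have "b \<bullet> b = b \<bullet> (\<Sum>i\<in>I. c i *\<^sub>R rank_one (u i) b)" by (simp add: id)
    then show "b \<bullet> b = (\<Sum>i\<in>I. c i * (u i \<bullet> b)\<^sup>2)"
      by (simp add: inner_sum_right rank_one_def power2_eq_square inner_commute mult.assoc)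
  qed
  also have "\<dots> = (\<Sum>i\<in>I. c i * (\<Sum>b\<in>(Basis::(real^'n) set). (u i \<bullet> b)\<^sup>2))"
    by (subst sum.swap) (simp add: sum_distrib_left)
  also have "\<dots> = (\<Sum>i\<in>I. c i)"
  proof (intro sum.cong refl)
    fix i assume i: "i \<in> I"
    have "(\<Sum>b\<in>(Basis::(real^'n) set). (u i \<bullet> b)\<^sup>2) = u i \<bullet> u i"
      using euclidean_inner[of "u i" "u i"] by (simp add: power2_eq_square)
    then show "c i * (\<Sum>b\<in>(Basis::(real^'n) set). (u i \<bullet> b)\<^sup>2) = c i" using u[OF i] by (simp add: norm_eq_1)
  qed
  finally show ?thesis by simp
qed

lemma sum_weights_inner_sq:
  fixes u :: "'i \<Rightarrow> 'a::real_inner"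
  assumes id: "\<And>x. (\<Sum>i\<in>I. c i *\<^sub>R rank_one (u i) x) = x"
  shows "(\<Sum>i\<in>I. c i * (x \<bullet> u i)\<^sup>2) = x \<bullet> x"
proof -
  have "x \<bullet> x = x \<bullet> (\<Sum>i\<in>I. c i *\<^sub>R rank_one (u i) x)" by (simp add: id)
  then show ?thesis by (simp add: inner_sum_right rank_one_def power2_eq_square mult.assoc)
qed

section \<open>Lower bound for integrals over zonotopes\<close>

definition normal_cdf :: "real \<Rightarrow> real" where
  "normal_cdf t = measure (density lborel std_normal_density) {..t}"

text \<open>Prepares the fundamental theorem of calculus: the left tail is constant and only the
  upper end point varies.\<close>

lemma normal_cdf_eq_integral:
  assumes "a \<le> t"
  shows "normal_cdf t = measure (density lborel std_normal_density) {..<a} + integral {a..t} std_normal_density"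
proof -
  interpret prob_space "density lborel std_normal_density"
    by (rule prob_space_normal_density) simp
  have "{..t} = {..<a} \<union> {a..t}" using assms by auto
  then have "normal_cdf t = prob {..<a} + prob {a..t}"
    unfolding normal_cdf_def by (simp only:) (rule finite_measure_Union, auto)
  moreover have "emeasure (density lborel std_normal_density) {a..t} = ennreal (integral {a..t} std_normal_density)"
  proof -
    have "emeasure (density lborel std_normal_density) {a..t} = (\<integral>\<^sup>+x\<in>{a..t}. ennreal (std_normal_density x) \<partial>lborel)"
      by (simp add: emeasure_density)
    moreover have "emeasure (density lborel std_normal_density) {a..t} < \<infinity>"
      using emeasure_le_1 by (rule le_less_trans) simp
    ultimately show ?thesis by (simp only:) (rule set_nn_integral_lborel_eq_integral, auto simp: set_borel_measurable_def)
  qed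
  moreover have "0 \<le> integral {a..t} std_normal_density"
    by (rule Henstock_Kurzweil_Integration.integral_nonneg)
      (auto intro!: integrable_continuous_real continuous_intros simp: std_normal_density_def)
  ultimately show ?thesis by (simp add: measure_def)
qed

lemma continuous_std_normal_density: "continuous_on S std_normal_density"
  unfolding std_normal_density_def by (intro continuous_intros) auto

lemma DERIV_normal_cdf: "(normal_cdf has_real_derivative std_normal_density t) (at t)"
proof -
  have "((\<lambda>x. integral {t - 1..x} std_normal_density) has_real_derivative std_normal_density t) (at t within {t - 1..t + 1})"
    by (rule integral_has_real_derivative) (auto intro: continuous_std_normal_density)
  then have "((\<lambda>x. integral {t - 1..x} std_normal_density) has_real_derivative std_normal_density t) (at t)"
    by (subst (asm) at_within_interior) (auto simp: interior_atLeastAtMost_real)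
  then have "((\<lambda>x. measure (density lborel std_normal_density) {..<t - 1} + integral {t - 1..x} std_normal_density)
      has_real_derivative 0 + std_normal_density t) (at t)"
    by (intro DERIV_add DERIV_const)
  moreover have "\<forall>\<^sub>F x in nhds t. x \<in> {t - 1<..}" by (rule eventually_nhds_in_open) auto
  then have "\<forall>\<^sub>F x in nhds t. normal_cdf x
      = measure (density lborel std_normal_density) {..<t - 1} + integral {t - 1..x} std_normal_density"
    by (rule eventually_mono) (auto intro!: normal_cdf_eq_integral)
  ultimately show ?thesis by (subst DERIV_cong_ev[OF refl _ refl]) auto
qed

lemma normal_cdf_strict_mono: "s < t \<Longrightarrow> normal_cdf s < normal_cdf t"
  by (rule DERIV_pos_imp_increasing) (auto intro!: exI[of _ "std_normal_density _"] DERIV_normal_cdf normal_density_pos)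

lemma normal_cdf_pos: "0 < normal_cdf t"
proof -
  have "0 \<le> normal_cdf (t - 1)" by (simp add: normal_cdf_def)
  also have "\<dots> < normal_cdf t" by (rule normal_cdf_strict_mono) simp
  finally show ?thesis .
qed

lemma normal_cdf_less_1: "normal_cdf t < 1"
proof -
  interpret prob_space "density lborel std_normal_density"
    by (rule prob_space_normal_density) simp
  have "normal_cdf t < normal_cdf (t + 1)" by (rule normal_cdf_strict_mono) simp
  also have "\<dots> \<le> 1" by (simp add: normal_cdf_def)
  finally show ?thesis .
qed

text \<open>The normalising constants combine because the c_i add up to n, and the exponents because
  the decomposition of the identity gives \<Sum> c_i <y, u_i>^2 = |y|^2.\<close>

lemma prod_std_normal_powr:
  fixes u :: "'i \<Rightarrow> real^'n"
  assumes I: "finite I" and u: "\<And>i. i \<in> I \<Longrightarrow> norm (u i) = 1"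
    and id: "\<And>x. (\<Sum>i\<in>I. c i *\<^sub>R rank_one (u i) x) = x"
  shows "(\<Prod>i\<in>I. std_normal_density (y \<bullet> u i) powr c i) = (\<Prod>b\<in>Basis. std_normal_density (y \<bullet> b))"
proof -
  let ?A = "1 / sqrt (2 * pi)"
  have A: "?A > 0" by simp
  have "(\<Prod>i\<in>I. std_normal_density (y \<bullet> u i) powr c i) = (\<Prod>i\<in>I. ?A powr c i * exp (- (c i * (y \<bullet> u i)\<^sup>2) / 2))"
  proof (rule prod.cong[OF refl])
    fix i
    have "(?A * exp (- (y \<bullet> u i)\<^sup>2 / 2)) powr c i = ?A powr c i * exp (- (y \<bullet> u i)\<^sup>2 / 2) powr c i"
      by (rule powr_mult)
    also have "exp (- (y \<bullet> u i)\<^sup>2 / 2) powr c i = exp (- (c i * (y \<bullet> u i)\<^sup>2) / 2)"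
      by (simp add: powr_def)
    finally show "std_normal_density (y \<bullet> u i) powr c i = ?A powr c i * exp (- (c i * (y \<bullet> u i)\<^sup>2) / 2)"
      by (simp only: std_normal_density_def)
  qed
  also have "\<dots> = ?A powr (\<Sum>i\<in>I. c i) * exp (- (\<Sum>i\<in>I. c i * (y \<bullet> u i)\<^sup>2) / 2)"
    using I A by (simp add: prod.distrib powr_sum exp_sum sum_negf[symmetric] sum_divide_distrib del: powr_divide)
  also have "\<dots> = ?A ^ CARD('n) * exp (- (y \<bullet> y) / 2)"
  proof -
    have "(\<Sum>i\<in>I. c i) = real CARD('n)" by (rule sum_weights_eq_dim[OF u id])
    moreover have "?A powr real CARD('n) = ?A ^ CARD('n)" using A by (rule powr_realpow)
    ultimately show ?thesis using sum_weights_inner_sq[OF id, of y] by simp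
  qed
  also have "y \<bullet> y = (\<Sum>b\<in>Basis. (y \<bullet> b)\<^sup>2)"
    using euclidean_inner[of y y] by (simp add: power2_eq_square)
  also have "?A ^ CARD('n) * exp (- (\<Sum>b\<in>Basis. (y \<bullet> b)\<^sup>2) / 2) = (\<Prod>b\<in>Basis. std_normal_density (y \<bullet> b))"
  proof -
    have "(\<Prod>b\<in>Basis. std_normal_density (y \<bullet> b)) = (\<Prod>b\<in>(Basis::(real^'n) set). ?A * exp (- (y \<bullet> b)\<^sup>2 / 2))"
      by (simp only: std_normal_density_def)
    also have "\<dots> = ?A ^ CARD('n) * (\<Prod>b\<in>(Basis::(real^'n) set). exp (- (y \<bullet> b)\<^sup>2 / 2))"
      unfolding prod.distrib prod_constant by simp
    also have "(\<Prod>b\<in>(Basis::(real^'n) set). exp (- (y \<bullet> b)\<^sup>2 / 2)) = exp (- (\<Sum>b\<in>Basis. (y \<bullet> b)\<^sup>2) / 2)"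
      by (simp add: exp_sum[symmetric] sum_negf sum_divide_distrib)
    finally show ?thesis by simp
  qed
  finally show ?thesis .
qed

lemma has_integral_prod_std_normal:
  "((\<lambda>y::'a::euclidean_space. \<Prod>b\<in>Basis. std_normal_density (y \<bullet> b)) has_integral 1) UNIV"
proof (rule nn_integral_has_integral)
  have "(\<integral>\<^sup>+y. ennreal (\<Prod>b\<in>Basis. std_normal_density (y \<bullet> b)) \<partial>(lborel::'a measure))
    = (\<integral>\<^sup>+y. (\<Prod>b\<in>Basis. ennreal (std_normal_density (y \<bullet> b))) \<partial>(lborel::'a measure))"
    by (simp add: prod_ennreal)
  also have "\<dots> = (\<Prod>b\<in>(Basis::'a set). \<integral>\<^sup>+t. ennreal (std_normal_density t) \<partial>lborel)"
    by (rule nn_integral_lborel_prod) auto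
  also have "(\<integral>\<^sup>+t. ennreal (std_normal_density t) \<partial>lborel) = 1"
    by (subst nn_integral_eq_integral) (auto intro: integrable_normal_density)
  finally show "(\<integral>\<^sup>+y. ennreal (\<Prod>b\<in>Basis. std_normal_density (y \<bullet> b)) \<partial>(lborel::'a measure)) = ennreal 1" by simp
qed (auto intro: prod_nonneg)

text \<open>Barthe's transport argument: \<open>T\<close> below is a monotone map into the zonotope, and the exponent
  \<open>\<kappa>\<close> is chosen such that the power of the integrand cancels the power of \<open>normal_cdf\<close> in the
  Jacobian, leaving the standard Gaussian density. The order on the index type is required by
  the change of variables theorem of the library.\<close>

lemma zonotope_integral_wellorder:
  fixes u :: "'i \<Rightarrow> real^'n::{finite,wellorder}" and F :: "real^'n::_ \<Rightarrow> real"
  assumes I: "finite I" and u: "\<And>i. i \<in> I \<Longrightarrow> norm (u i) = 1" and c: "\<And>i. i \<in> I \<Longrightarrow> 0 < c i"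
    and id: "\<And>x. (\<Sum>i\<in>I. c i *\<^sub>R rank_one (u i) x) = x"
    and a: "\<And>i. i \<in> I \<Longrightarrow> 0 < a i" and r: "0 < r" and \<gamma>: "0 \<le> \<gamma>"
    and F: "\<And>x. 0 \<le> F x" "continuous_on UNIV F" and W: "W \<in> sets borel"
    and FW: "\<And>b. (\<And>i. i \<in> I \<Longrightarrow> 0 < b i \<and> b i < a i) \<Longrightarrow>
        (\<Sum>i\<in>I. b i *\<^sub>R u i) \<in> W \<and> \<gamma> * (\<Sum>i\<in>I. b i) powr r \<le> F (\<Sum>i\<in>I. b i *\<^sub>R u i)"
  shows "ennreal (\<gamma> * (1 / (1 + r / CARD('n))) ^ CARD('n) * (\<Prod>i\<in>I. (a i / c i) powr (c i * (1 + r / CARD('n)))))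
    \<le> (\<integral>\<^sup>+x. ennreal (F x) * indicator W x \<partial>lborel)"
proof -
  define n where "n = real CARD('n)"
  have n: "n \<ge> 1" by (simp add: n_def Suc_leI)
  define \<kappa> where "\<kappa> = 1 / (1 + r / n)"
  have \<kappa>: "\<kappa> > 0" using r n by (simp add: \<kappa>_def add_pos_pos)
  have \<kappa>1: "\<kappa> * (1 + r / n) = 1" using r n by (simp add: \<kappa>_def add_pos_pos less_imp_neq[symmetric])
  define \<Psi> where "\<Psi> t = normal_cdf t powr \<kappa>" for t
  define \<Psi>' where "\<Psi>' t = \<kappa> * normal_cdf t powr (\<kappa> - 1) * std_normal_density t" for t
  have \<Psi>0: "0 < \<Psi> t" for t using normal_cdf_pos[of t] by (simp add: \<Psi>_def)
  have \<Psi>1: "\<Psi> t < 1" for t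
    using powr_less_mono2[OF \<kappa> less_imp_le[OF normal_cdf_pos] normal_cdf_less_1, of t] by (simp add: \<Psi>_def)
  have \<Psi>_mono: "\<Psi> s < \<Psi> t" if "s < t" for s t
    using powr_less_mono2[OF \<kappa> less_imp_le[OF normal_cdf_pos] normal_cdf_strict_mono[OF that]] by (simp add: \<Psi>_def)
  have \<Psi>'0: "0 < \<Psi>' t" for t using \<kappa> normal_cdf_pos[of t] by (simp add: \<Psi>'_def normal_density_pos)
  have deriv: "(\<Psi> has_real_derivative \<Psi>' t) (at t)" for t
    using DERIV_fun_powr[OF DERIV_normal_cdf normal_cdf_pos, of \<kappa> t] by (simp add: \<Psi>_def[abs_def] \<Psi>'_def)
  define T where "T y = (\<Sum>i\<in>I. (a i * \<Psi> (y \<bullet> u i)) *\<^sub>R u i)" for y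
  \<comment> \<open>Chosen such that the derivative of \<open>T\<close> is \<Sum> c_i l_i u_i
    \<otimes> u_i, the form required by the determinant inequality.\<close>
  define l where "l y i = a i * \<Psi>' (y \<bullet> u i) / c i" for y i
  have l: "0 < l y i" if "i \<in> I" for y i using that a c \<Psi>'0 by (simp add: l_def)
  define T' where "T' y = (\<lambda>h. \<Sum>i\<in>I. (c i * l y i) *\<^sub>R rank_one (u i) h)" for y
  have derT: "(T has_derivative T' y) (at y)" for y
    unfolding T_def T'_def
  proof (rule has_derivative_sum)
    fix i assume i: "i \<in> I"
    have "((\<lambda>y. \<Psi> (y \<bullet> u i)) has_derivative (\<lambda>h. (h \<bullet> u i) * \<Psi>' (y \<bullet> u i))) (at y)"
      by (rule DERIV_compose_FDERIV[OF deriv]) (auto intro!: derivative_eq_intros)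
    then have "((\<lambda>y. (a i * \<Psi> (y \<bullet> u i)) *\<^sub>R u i) has_derivative (\<lambda>h. (a i * ((h \<bullet> u i) * \<Psi>' (y \<bullet> u i))) *\<^sub>R u i)) (at y)"
      by (auto intro!: derivative_eq_intros)
    moreover have "(\<lambda>h. (a i * ((h \<bullet> u i) * \<Psi>' (y \<bullet> u i))) *\<^sub>R u i) = (\<lambda>h. (c i * l y i) *\<^sub>R rank_one (u i) h)"
      using c[OF i] by (simp add: l_def rank_one_def fun_eq_iff mult_ac)
    ultimately show "((\<lambda>y. (a i * \<Psi> (y \<bullet> u i)) *\<^sub>R u i) has_derivative (\<lambda>h. (c i * l y i) *\<^sub>R rank_one (u i) h)) (at y)"
      by simp
  qed
  \<comment> \<open>Pairing T y - T z with y - z gives a sum of nonnegative terms, the i-th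
    vanishing only if y - z is orthogonal to \<open>u i\<close>; the u_i determine a vector.\<close>
  have inj: "inj T"
  proof (rule injI)
    fix y z assume eq: "T y = T z"
    have nonneg: "0 \<le> a i * ((\<Psi> (y \<bullet> u i) - \<Psi> (z \<bullet> u i)) * (y \<bullet> u i - z \<bullet> u i))" if "i \<in> I" for i
      using a[OF that] \<Psi>_mono[of "y \<bullet> u i" "z \<bullet> u i"] \<Psi>_mono[of "z \<bullet> u i" "y \<bullet> u i"]
      by (cases "y \<bullet> u i" "z \<bullet> u i" rule: linorder_cases) (auto simp: zero_le_mult_iff)
    have "0 = (T y - T z) \<bullet> (y - z)" using eq by simp
    also have "\<dots> = (\<Sum>i\<in>I. a i * ((\<Psi> (y \<bullet> u i) - \<Psi> (z \<bullet> u i)) * (y \<bullet> u i - z \<bullet> u i)))"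
      unfolding T_def sum_subtractf[symmetric] inner_sum_left
      by (intro sum.cong refl) (simp add: inner_diff_left inner_diff_right inner_commute algebra_simps)
    finally have "\<forall>i\<in>I. a i * ((\<Psi> (y \<bullet> u i) - \<Psi> (z \<bullet> u i)) * (y \<bullet> u i - z \<bullet> u i)) = 0"
      using sum_nonneg_eq_0_iff[OF I nonneg] by simp
    then have "(y - z) \<bullet> u i = 0" if "i \<in> I" for i
      using that a[OF that] \<Psi>_mono[of "y \<bullet> u i" "z \<bullet> u i"] \<Psi>_mono[of "z \<bullet> u i" "y \<bullet> u i"]
      by (cases "y \<bullet> u i" "z \<bullet> u i" rule: linorder_cases) (auto simp: inner_diff_left)
    then have "(\<Sum>i\<in>I. c i *\<^sub>R rank_one (u i) (y - z)) = 0" by (simp add: rank_one_def)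
    then show "y = z" using id[of "y - z"] by simp
  qed
  define C where "C = \<gamma> * \<kappa> ^ CARD('n) * (\<Prod>i\<in>I. (a i / c i) powr (c i * (1 + r / n)))"
  define E where "E y = C * (\<Prod>b\<in>Basis. std_normal_density (y \<bullet> b))" for y :: "real^'n::_"
  define J where "J y = \<bar>det (matrix (T' y))\<bar> *\<^sub>R F (T y)" for y
  have sumc: "(\<Sum>i\<in>I. c i) = n" unfolding n_def by (rule sum_weights_eq_dim[OF u id])
  have EJ: "E y \<le> J y" for y
  proof -
    let ?x = "\<lambda>i. a i * \<Psi> (y \<bullet> u i) / c i"
    have x: "0 < ?x i" if "i \<in> I" for i using a[OF that] c[OF that] \<Psi>0 by simp
    \<comment> \<open>The weights c_i / n add up to 1, and dividing by c_i in \<open>?x\<close>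
      makes the arithmetic mean the coefficient sum over n; the division by n \<ge> 1 is then
      dropped.\<close>
    have "(\<Prod>i\<in>I. ?x i powr (c i / n)) \<le> (\<Sum>i\<in>I. (c i / n) * ?x i)"
      using I c n x sumc by (intro weighted_arith_geo_mean) (auto simp: sum_divide_distrib[symmetric] intro: less_imp_le)
    also have "(\<Sum>i\<in>I. (c i / n) * ?x i) = (\<Sum>i\<in>I. a i * \<Psi> (y \<bullet> u i)) / n"
      unfolding sum_divide_distrib using c by (intro sum.cong refl) (auto simp: less_imp_neq[symmetric])
    also have "\<dots> \<le> (\<Sum>i\<in>I. a i * \<Psi> (y \<bullet> u i)) / 1"
      using n a \<Psi>0 by (intro divide_left_mono sum_nonneg) (auto intro: less_imp_le)
    finally have "(\<Prod>i\<in>I. ?x i powr (c i / n)) powr r \<le> (\<Sum>i\<in>I. a i * \<Psi> (y \<bullet> u i)) powr r"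
      using r x by (intro powr_mono2) (auto intro: prod_nonneg)
    also have "(\<Prod>i\<in>I. ?x i powr (c i / n)) powr r = (\<Prod>i\<in>I. (?x i powr (r / n)) powr c i)"
      using x by (subst prod_powr_distrib) (auto simp: powr_powr mult.commute)
    finally have 1: "\<gamma> * (\<Prod>i\<in>I. (?x i powr (r / n)) powr c i) \<le> \<gamma> * (\<Sum>i\<in>I. a i * \<Psi> (y \<bullet> u i)) powr r"
      using \<gamma> by (rule mult_left_mono)
    also have "\<dots> \<le> F (T y)" unfolding T_def using FW[of "\<lambda>i. a i * \<Psi> (y \<bullet> u i)"] a \<Psi>0 \<Psi>1 by simp
    finally have FT: "\<gamma> * (\<Prod>i\<in>I. (?x i powr (r / n)) powr c i) \<le> F (T y)" .
    have det: "(\<Prod>i\<in>I. l y i powr c i) \<le> \<bar>det (matrix (T' y))\<bar>"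
      unfolding T'_def using det_ge_prod_powr[OF I u c id, of "l y"] l by force
    have each: "(?x i powr (r / n)) powr c i * l y i powr c i
        = \<kappa> powr c i * (a i / c i) powr (c i * (1 + r / n)) * std_normal_density (y \<bullet> u i) powr c i" if i: "i \<in> I" for i
    proof -
      have pos: "0 < a i / c i" "0 < normal_cdf (y \<bullet> u i)" "0 < std_normal_density (y \<bullet> u i)"
        using a[OF i] c[OF i] by (auto simp: normal_cdf_pos normal_density_pos)
      have "?x i powr (r / n) * l y i = ((a i / c i) * normal_cdf (y \<bullet> u i) powr \<kappa>) powr (r / n)
          * ((a i / c i) * (\<kappa> * normal_cdf (y \<bullet> u i) powr (\<kappa> - 1) * std_normal_density (y \<bullet> u i)))"
        by (simp add: l_def \<Psi>_def \<Psi>'_def)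
      also have "\<dots> = \<kappa> * ((a i / c i) powr (r / n) * (a i / c i) powr 1)
          * (normal_cdf (y \<bullet> u i) powr (\<kappa> * (r / n)) * normal_cdf (y \<bullet> u i) powr (\<kappa> - 1)) * std_normal_density (y \<bullet> u i)"
      proof -
        have "(A * N powr \<kappa>) powr (r / n) * (A * (\<kappa> * N powr (\<kappa> - 1) * S))
          = \<kappa> * (A powr (r / n) * A powr 1) * (N powr (\<kappa> * (r / n)) * N powr (\<kappa> - 1)) * S"
          if "0 < A" "0 < N" for A N S :: real
          using that by (simp add: powr_mult powr_powr mult_ac)
        from this[OF pos(1,2)] show ?thesis .
      qed
      also have "\<dots> = \<kappa> * (a i / c i) powr (r / n + 1) * normal_cdf (y \<bullet> u i) powr (\<kappa> * (r / n) + (\<kappa> - 1)) * std_normal_density (y \<bullet> u i)"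
        by (simp only: powr_add)
      also have "\<kappa> * (r / n) + (\<kappa> - 1) = 0" using \<kappa>1 by (simp add: distrib_left)
      finally have eq: "?x i powr (r / n) * l y i = \<kappa> * (a i / c i) powr (r / n + 1) * std_normal_density (y \<bullet> u i)"
        using pos by simp
      have "(?x i powr (r / n)) powr c i * l y i powr c i = (?x i powr (r / n) * l y i) powr c i"
        using l[OF i] by (subst powr_mult) (auto intro: less_imp_le)
      also have "\<dots> = \<kappa> powr c i * ((a i / c i) powr (r / n + 1)) powr c i * std_normal_density (y \<bullet> u i) powr c i"
        unfolding eq using pos \<kappa> by (simp add: powr_mult)
      also have "((a i / c i) powr (r / n + 1)) powr c i = (a i / c i) powr (c i * (1 + r / n))"
        by (simp add: powr_powr mult.commute add.commute)
      finally show ?thesis .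
    qed
    have "\<kappa> ^ CARD('n) = (\<Prod>i\<in>I. \<kappa> powr c i)"
      using I \<kappa> sumc by (simp add: powr_sum[symmetric] n_def powr_realpow)
    then have "E y = \<gamma> * (\<Prod>i\<in>I. \<kappa> powr c i * (a i / c i) powr (c i * (1 + r / n)) * std_normal_density (y \<bullet> u i) powr c i)"
      unfolding E_def C_def using prod_std_normal_powr[OF I u id, of y] by (simp add: prod.distrib)
    also have "\<dots> = (\<Prod>i\<in>I. l y i powr c i) * (\<gamma> * (\<Prod>i\<in>I. (?x i powr (r / n)) powr c i))"
      using each by (simp add: prod.distrib[symmetric] mult_ac)
    also have "\<dots> \<le> \<bar>det (matrix (T' y))\<bar> * F (T y)"
      using det FT \<gamma> by (intro mult_mono) (auto intro!: mult_nonneg_nonneg prod_nonneg)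
    finally show ?thesis by (simp add: J_def)
  qed
  have contT: "continuous_on S T" for S
    using derT by (meson differentiable_at_withinI differentiable_imp_continuous_on differentiable_on_def differentiableI)
  have rangeT: "range T \<subseteq> W"
    using FW[of "\<lambda>i. a i * \<Psi> (_ \<bullet> u i)"] a \<Psi>0 \<Psi>1 by (auto simp: T_def)
  have "range T = (\<Union>k::nat. T ` cball 0 (real k))"
  proof (intro set_eqI iffI)
    fix z assume "z \<in> range T"
    then obtain y where y: "z = T y" by blast
    obtain k :: nat where "norm y \<le> real k" using real_arch_simple by blast
    then show "z \<in> (\<Union>k::nat. T ` cball 0 (real k))" using y by (intro UN_I[of k] image_eqI[of _ _ y]) auto
  qed auto
  moreover have "T ` cball 0 (real k) \<in> sets borel" for k :: nat
    by (intro borel_compact compact_continuous_image contT compact_cball)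
  ultimately have borelT: "range T \<in> sets borel" by auto
  have "bounded (range T)"
    unfolding bounded_iff
  proof (intro exI ballI)
    fix z assume "z \<in> range T"
    then obtain y where z: "z = T y" by blast
    have "norm z \<le> (\<Sum>i\<in>I. norm ((a i * \<Psi> (y \<bullet> u i)) *\<^sub>R u i))" unfolding z T_def by (rule norm_sum)
    also have "\<dots> \<le> (\<Sum>i\<in>I. a i)"
    proof (rule sum_mono)
      fix i assume i: "i \<in> I"
      have "a i * \<Psi> (y \<bullet> u i) \<le> a i * 1" using a[OF i] \<Psi>1[of "y \<bullet> u i"] by (intro mult_left_mono) auto
      then show "norm ((a i * \<Psi> (y \<bullet> u i)) *\<^sub>R u i) \<le> a i" using a[OF i] \<Psi>0[of "y \<bullet> u i"] u[OF i] by (simp add: abs_mult)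
    qed
    finally show "norm z \<le> (\<Sum>i\<in>I. a i)" .
  qed
  then obtain k where "range T \<subseteq> cbox (-k) k" using bounded_subset_cbox_symmetric by blast
  moreover have "F absolutely_integrable_on cbox (-k) k"
    by (intro absolutely_integrable_continuous continuous_on_subset[OF F(2)]) auto
  ultimately have absF: "F absolutely_integrable_on range T"
    by (rule set_integrable_subset[rotated 2]) (use borelT in \<open>simp add: sets_completionI_sets\<close>)
  \<comment> \<open>The change of variables is applied to vector-valued functions, hence the passage
    through \<open>real^1\<close>.\<close>
  then have "(\<lambda>x. vec (F x) :: real^1) absolutely_integrable_on range T"
    by (simp add: absolutely_integrable_on_1_iff)
  moreover have "(T has_derivative T' x) (at x within UNIV)" for x using derT by simp
  ultimately have "(\<lambda>x. \<bar>det (matrix (T' x))\<bar> *\<^sub>R (vec (F (T x)) :: real^1)) absolutely_integrable_on UNIV \<and>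
      integral UNIV (\<lambda>x. \<bar>det (matrix (T' x))\<bar> *\<^sub>R (vec (F (T x)) :: real^1)) = integral (range T) (\<lambda>x. vec (F x) :: real^1)"
    by (subst has_absolute_integral_change_of_variables) (auto simp: inj)
  then have J: "J absolutely_integrable_on UNIV" "integral UNIV J = integral (range T) F"
    by (simp_all add: absolutely_integrable_on_1_iff integral_on_1_eq J_def[abs_def] vec_eq_iff)
  have E: "(E has_integral C) UNIV"
    unfolding E_def using has_integral_mult_right[OF has_integral_prod_std_normal, of C] by simp
  have "C = integral UNIV E" using E by (rule integral_unique[symmetric])
  also have "\<dots> \<le> integral UNIV J"
    using E J(1) EJ by (intro integral_le has_integral_integrable[OF E] set_lebesgue_integral_eq_integral(1)) auto
  also have "\<dots> = integral (range T) F" by (rule J(2))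
  finally have CF: "C \<le> integral (range T) F" .
  have [measurable]: "F \<in> borel_measurable borel" using F(2) by (rule borel_measurable_continuous_onI)
  have "(F has_integral integral (range T) F) (range T)"
    using absF by (intro integrable_integral set_lebesgue_integral_eq_integral(1))
  then have "((\<lambda>x. indicator (range T) x * F x) has_integral integral (range T) F) UNIV"
  proof -
    assume F: "(F has_integral integral (range T) F) (range T)"
    have "(\<lambda>x. indicator (range T) x * F x) = (\<lambda>x. if x \<in> range T then F x else 0)"
      by (auto simp: indicator_def)
    with F show ?thesis by (simp only: has_integral_restrict_UNIV)
  qed
  then have "(\<integral>\<^sup>+x. ennreal (indicator (range T) x * F x) \<partial>lborel) = ennreal (integral (range T) F)"
    using borelT F(1) by (intro nn_integral_has_integral_lborel) auto
  moreover have "(\<integral>\<^sup>+x. ennreal (indicator (range T) x * F x) \<partial>lborel) \<le> (\<integral>\<^sup>+x. ennreal (F x) * indicator W x \<partial>lborel)"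
    using rangeT by (intro nn_integral_mono) (auto simp: indicator_def)
  ultimately have "ennreal C \<le> (\<integral>\<^sup>+x. ennreal (F x) * indicator W x \<partial>lborel)"
    using CF ennreal_leI order_trans by metis
  then show ?thesis by (simp add: C_def \<kappa>_def n_def)
qed

text \<open>A well-ordered copy of a finite index type, to which the change of variables theorem applies.\<close>

typedef ('n::finite) idx = "{..<CARD('n)}"
  by (intro exI[of _ 0]) simp

instantiation idx :: (finite) linorder
begin

definition less_eq_idx :: "'a idx \<Rightarrow> 'a idx \<Rightarrow> bool" where
  "x \<le> y \<longleftrightarrow> Rep_idx x \<le> Rep_idx y"

definition less_idx :: "'a idx \<Rightarrow> 'a idx \<Rightarrow> bool" where
  "x < y \<longleftrightarrow> Rep_idx x < Rep_idx y"

instance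
  by standard (auto simp: less_eq_idx_def less_idx_def Rep_idx_inject)

end

instance idx :: (finite) wellorder
proof
  fix P :: "'a idx \<Rightarrow> bool" and a :: "'a idx"
  assume step: "\<And>x. (\<And>y. y < x \<Longrightarrow> P y) \<Longrightarrow> P x"
  show "P a"
  proof (induction a rule: measure_induct_rule[of Rep_idx])
    case (less x)
    show ?case
    proof (rule step)
      fix y assume "y < x"
      then show "P y" by (intro less) (simp only: less_idx_def)
    qed
  qed
qed

instance idx :: (finite) finite
proof
  have "finite (Abs_idx ` {..<CARD('a)} :: 'a idx set)" by simp
  then show "finite (UNIV :: 'a idx set)" by (simp add: type_definition.Abs_image[OF type_definition_idx])
qed

lemma card_idx: "CARD('n::finite idx) = CARD('n)"
  by (simp add: type_definition.card[OF type_definition_idx])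

lemma prod_Basis_cart: "(\<Prod>b\<in>Basis. x \<bullet> b) = (\<Prod>i\<in>UNIV. (x :: real^'n) $ i)"
proof -
  have Basis: "(Basis :: (real^'n) set) = (\<lambda>i. axis i 1) ` UNIV" by (auto simp: Basis_vec_def)
  have "inj (\<lambda>i::'n. axis i (1::real))" by (auto simp: inj_def axis_eq_axis)
  then show ?thesis unfolding Basis by (simp add: prod.reindex inner_axis)
qed

text \<open>Relabelling coordinates maps boxes to boxes of equal volume, and boxes determine
  Lebesgue measure.\<close>

lemma nn_integral_reindex:
  fixes e :: "'m::finite \<Rightarrow> 'n::finite" and F :: "real^'m \<Rightarrow> ennreal"
  assumes e: "bij e" and F: "F \<in> borel_measurable borel"
  shows "(\<integral>\<^sup>+z. F z \<partial>lborel) = (\<integral>\<^sup>+x. F (\<chi> k. x $ e k) \<partial>lborel)"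
proof -
  let ?R = "\<lambda>x::real^'n. (\<chi> k. x $ e k) :: real^'m"
  let ?L = "\<lambda>z::real^'m. (\<chi> i. z $ inv e i) :: real^'n"
  have ie: "inv e (e k) = k" "e (inv e i) = i" for k i
    using e by (auto simp: bij_def surj_f_inv_f)
  have R: "?R \<in> borel_measurable borel"
    by (intro borel_measurable_continuous_onI continuous_intros)
  have "lborel = distr lborel borel ?R"
  proof (rule lborel_eqI)
    fix l u :: "real^'m" assume le: "\<And>b. b \<in> Basis \<Longrightarrow> l \<bullet> b \<le> u \<bullet> b"
    have le': "l $ k \<le> u $ k" for k using le[of "axis k 1"] by (simp add: inner_axis)
    have all: "(\<forall>k. Q k (e k)) \<longleftrightarrow> (\<forall>i. Q (inv e i) i)" for Q
    proof (intro iffI allI)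
      fix i assume "\<forall>k. Q k (e k)"
      then have "Q (inv e i) (e (inv e i))" ..
      then show "Q (inv e i) i" by (simp only: ie)
    next
      fix k assume "\<forall>i. Q (inv e i) i"
      then have "Q (inv e (e k)) (e k)" ..
      then show "Q k (e k)" by (simp only: ie)
    qed
    have "x \<in> ?R -` box l u \<longleftrightarrow> x \<in> box (?L l) (?L u)" for x
      using all[of "\<lambda>k i. l $ k < x $ i \<and> x $ i < u $ k"] by (simp add: mem_box_cart)
    then have "?R -` box l u = box (?L l) (?L u)" by (rule set_eqI)
    then have "emeasure (distr lborel borel ?R) (box l u) = emeasure lborel (box (?L l) (?L u))"
      using R by (subst emeasure_distr) auto
    also have "\<dots> = ennreal (\<Prod>b\<in>Basis. (?L u - ?L l) \<bullet> b)"
      using le' by (intro emeasure_lborel_box) (auto simp: Basis_vec_def inner_axis)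
    also have "(\<Prod>b\<in>Basis. (?L u - ?L l) \<bullet> b) = (\<Prod>i\<in>UNIV. (u - l) $ inv e i)"
      unfolding prod_Basis_cart by simp
    also have "\<dots> = (\<Prod>k\<in>UNIV. (u - l) $ k)"
      by (rule prod.reindex_bij_betw) (use e in \<open>simp add: bij_imp_bij_inv\<close>)
    finally show "emeasure (distr lborel borel ?R) (box l u) = ennreal (\<Prod>b\<in>Basis. (u - l) \<bullet> b)"
      unfolding prod_Basis_cart .
  qed simp
  then have "(\<integral>\<^sup>+z. F z \<partial>lborel) = (\<integral>\<^sup>+z. F z \<partial>distr lborel borel ?R)" by simp
  then show ?thesis using F R by (simp add: nn_integral_distr)
qed

text \<open>Relabelling along a bijection with the ordered copy is a linear isometry, so the unit
  vectors, the decomposition and the integral carry over.\<close>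

lemma zonotope_integral:
  fixes u :: "'i \<Rightarrow> real^'n" and F :: "real^'n \<Rightarrow> real"
  assumes I: "finite I" and u: "\<And>i. i \<in> I \<Longrightarrow> norm (u i) = 1" and c: "\<And>i. i \<in> I \<Longrightarrow> 0 < c i"
    and id: "\<And>x. (\<Sum>i\<in>I. c i *\<^sub>R rank_one (u i) x) = x"
    and a: "\<And>i. i \<in> I \<Longrightarrow> 0 < a i" and r: "0 < r" and \<gamma>: "0 \<le> \<gamma>"
    and F: "\<And>x. 0 \<le> F x" "continuous_on UNIV F" and W: "W \<in> sets borel"
    and FW: "\<And>b. (\<And>i. i \<in> I \<Longrightarrow> 0 < b i \<and> b i < a i) \<Longrightarrow>
        (\<Sum>i\<in>I. b i *\<^sub>R u i) \<in> W \<and> \<gamma> * (\<Sum>i\<in>I. b i) powr r \<le> F (\<Sum>i\<in>I. b i *\<^sub>R u i)"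
  shows "ennreal (\<gamma> * (1 / (1 + r / CARD('n))) ^ CARD('n) * (\<Prod>i\<in>I. (a i / c i) powr (c i * (1 + r / CARD('n)))))
    \<le> (\<integral>\<^sup>+x. ennreal (F x) * indicator W x \<partial>lborel)"
proof -
  obtain e :: "'n idx \<Rightarrow> 'n" where e: "bij e"
    using finite_same_card_bij[of "UNIV::'n idx set" "UNIV::'n set"] card_idx[where 'n='n] by auto
  let ?R = "\<lambda>x::real^'n. (\<chi> k. x $ e k) :: real^'n idx"
  let ?L = "\<lambda>z::real^'n idx. (\<chi> i. z $ inv e i) :: real^'n"
  have LR: "?L (?R x) = x" "?R (?L z) = z" for x z
    using e by (auto simp: vec_eq_iff bij_def surj_f_inv_f)
  have inner: "?R x \<bullet> ?R y = x \<bullet> y" for x y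
    unfolding inner_vec_def using sum.reindex_bij_betw[OF e, of "\<lambda>i. x $ i \<bullet> y $ i"] by simp
  have sumR: "(\<Sum>i\<in>I. b i *\<^sub>R ?R (u i)) = ?R (\<Sum>i\<in>I. b i *\<^sub>R u i)" for b
    by (simp add: vec_eq_iff)
  have contL: "continuous_on UNIV ?L" by (intro continuous_intros)
  have measL: "?L \<in> borel_measurable borel" using contL by (rule borel_measurable_continuous_onI)
  have [measurable]: "F \<in> borel_measurable borel" using F(2) by (rule borel_measurable_continuous_onI)
  have W': "?L -` W \<in> sets borel" using measurable_sets[OF measL W] by simp
  have "ennreal (\<gamma> * (1 / (1 + r / CARD('n idx))) ^ CARD('n idx) * (\<Prod>i\<in>I. (a i / c i) powr (c i * (1 + r / CARD('n idx)))))
    \<le> (\<integral>\<^sup>+z. ennreal (F (?L z)) * indicator (?L -` W) z \<partial>lborel)"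
  proof (rule zonotope_integral_wellorder[where u = "\<lambda>i. ?R (u i)", OF I _ c _ a r \<gamma>])
    show "norm (?R (u i)) = 1" if "i \<in> I" for i using u[OF that] by (simp add: norm_eq_1 inner)
    show "(\<Sum>i\<in>I. c i *\<^sub>R rank_one (?R (u i)) z) = z" for z
    proof -
      have "(\<Sum>i\<in>I. c i *\<^sub>R rank_one (?R (u i)) (?R x)) = ?R x" for x
      proof -
        have "(\<Sum>i\<in>I. c i *\<^sub>R rank_one (?R (u i)) (?R x)) = (\<Sum>i\<in>I. (c i * (x \<bullet> u i)) *\<^sub>R ?R (u i))"
          by (simp only: rank_one_def inner scaleR_scaleR)
        also have "\<dots> = ?R (\<Sum>i\<in>I. (c i * (x \<bullet> u i)) *\<^sub>R u i)" by (rule sumR)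
        also have "(\<Sum>i\<in>I. (c i * (x \<bullet> u i)) *\<^sub>R u i) = x" using id[of x] by (simp add: rank_one_def)
        finally show ?thesis .
      qed
      from this[of "?L z"] show ?thesis by (simp only: LR)
    qed
    show "continuous_on UNIV (\<lambda>z. F (?L z))"
      by (rule continuous_on_compose2[OF F(2) contL]) auto
    fix b assume "\<And>i. i \<in> I \<Longrightarrow> 0 < b i \<and> b i < a i"
    from FW[of b, OF this] show "(\<Sum>i\<in>I. b i *\<^sub>R ?R (u i)) \<in> ?L -` W \<and>
        \<gamma> * (\<Sum>i\<in>I. b i) powr r \<le> F (?L (\<Sum>i\<in>I. b i *\<^sub>R ?R (u i)))"
      unfolding sumR vimage_eq LR .
  qed (use F(1) W' in auto)
  also have "(\<integral>\<^sup>+z. ennreal (F (?L z)) * indicator (?L -` W) z \<partial>lborel)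
    = (\<integral>\<^sup>+x. ennreal (F (?L (?R x))) * indicator (?L -` W) (?R x) \<partial>lborel)"
    using measL W' by (intro nn_integral_reindex[OF e]) simp
  also have "\<dots> = (\<integral>\<^sup>+x. ennreal (F x) * indicator W x \<partial>lborel)"
  proof (rule nn_integral_cong)
    fix x
    have "indicator (?L -` W) (?R x) = (indicator W x :: ennreal)" by (simp only: indicator_def vimage_eq LR)
    then show "ennreal (F (?L (?R x))) * indicator (?L -` W) (?R x) = ennreal (F x) * indicator W x"
      by (simp only: LR)
  qed
  finally show ?thesis by (simp only: card_idx)
qed

section \<open>The Loomis-Whitney type inequality\<close>

lemma finite_proj_set: "finite S \<Longrightarrow> finite (proj_set S)"
  by (rule finite_subset[of _ "(\<lambda>(v, w). (1 / norm (v - (v \<bullet> w) *\<^sub>R w)) *\<^sub>R (v - (v \<bullet> w) *\<^sub>R w)) ` (S \<times> S)"])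
    (auto simp: proj_set_def)

lemma finite_proj_closure: "finite S \<Longrightarrow> finite (proj_closure S)"
proof -
  assume S: "finite S"
  have "finite ((proj_set ^^ k) S)" for k by (induction k) (auto simp: S finite_proj_set)
  then show ?thesis by (simp add: proj_closure_def)
qed

lemma subset_proj_closure: "S \<subseteq> proj_closure S"
  unfolding proj_closure_def by (rule subsetI, rule UN_I[of 0]) auto

text \<open>Passes from the constant of the transport argument to the one in the theorem.\<close>

lemma power_le_prod_harmonic:
  assumes "r \<ge> (0::real)"
  shows "(1 + r / n) ^ n \<le> (\<Prod>k=1..n. 1 + r / real k)"
proof -
  have "(1 + r / n) ^ n = (\<Prod>k=1..n. 1 + r / real n)" by simp
  also have "\<dots> \<le> (\<Prod>k=1..n. 1 + r / real k)"
    using assms by (intro prod_mono) (auto intro!: divide_left_mono)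
  finally show ?thesis .
qed

context concave_homogeneous_density
begin

text \<open>A point t v of the support is dilated to v or -v according to the sign of t; t = 0 is
  impossible because \<open>g\<close> vanishes at the origin.\<close>

lemma sym_sum_pos:
  assumes "sym_segment v \<inter> supp g \<noteq> {}"
  shows "0 < g v \<or> 0 < g (- v)"
proof -
  obtain t where t: "0 < g (t *\<^sub>R v)" using assms by (auto simp: sym_segment_def supp_def)
  consider "t > 0" | "t < 0" | "t = 0" by linarith
  then show ?thesis
  proof cases
    case 1
    then show ?thesis using t by (simp add: g_scale zero_less_mult_iff)
  next
    case 2
    then show ?thesis using t g_scale[of "- t" "- v"] by (simp add: zero_less_mult_iff)
  next
    case 3
    then show ?thesis using t by (simp add: g_zero)
  qed
qed

text \<open>Dilation by \<open>b i\<close> multiplies the p-th power of \<open>g\<close> by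
  \<open>b i\<close>, so superadditivity gives a bound linear in b.\<close>

lemma zonotope_density_ge:
  assumes I: "finite I" "I \<noteq> {}" and b: "\<And>i. i \<in> I \<Longrightarrow> 0 < b i"
    and \<gamma>: "0 < \<gamma>" "\<And>i. i \<in> I \<Longrightarrow> \<gamma> \<le> g (w i)"
  shows "\<gamma> * (\<Sum>i\<in>I. b i) powr (1 / p) \<le> g (\<Sum>i\<in>I. b i *\<^sub>R w i)"
proof -
  have "(\<Sum>i\<in>I. b i) * \<gamma> powr p \<le> (\<Sum>i\<in>I. b i * g (w i) powr p)"
    unfolding sum_distrib_right using b \<gamma> p_pos
    by (intro sum_mono mult_left_mono powr_mono2) (auto intro: less_imp_le)
  also have "\<dots> \<le> g (\<Sum>i\<in>I. b i *\<^sub>R w i) powr p"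
    using b \<gamma> by (intro g_sum_ge I) (auto intro: less_le_trans)
  finally have "((\<Sum>i\<in>I. b i) * \<gamma> powr p) powr (1 / p) \<le> (g (\<Sum>i\<in>I. b i *\<^sub>R w i) powr p) powr (1 / p)"
    using p_pos b by (intro powr_mono2 mult_nonneg_nonneg sum_nonneg) (auto intro: less_imp_le)
  then show ?thesis using p_pos \<gamma>(1) b g_nonneg
    by (simp add: powr_mult powr_powr sum_nonneg less_imp_le mult.commute)
qed

end

theorem theorem1p7:
  fixes p :: real and g :: "real^'n \<Rightarrow> real" and \<mu> :: "(real^'n) measure"
    and m :: nat and u :: "nat \<Rightarrow> real^'n" and c :: "nat \<Rightarrow> real"
    and P :: "(real^'n) set" and K :: "(real^'n) set"
  assumes "p > 0"
    and "\<And>x. g x \<ge> 0"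
    and "continuous_on UNIV g"
    and "p_concave p g"
    and "homogeneous (1 / p) g"
    and "\<mu> = density_measure g"
    and "\<And>i. i \<in> {1..m} \<Longrightarrow> norm (u i) = 1"
    and "\<And>i. i \<in> {1..m} \<Longrightarrow> c i > 0"
    and "(\<lambda>x. \<Sum>i=1..m. c i *\<^sub>R rank_one (u i) x) = id"
    and "P = proj_closure (u ` {1..m})"
    and "\<And>v. v \<in> P \<Longrightarrow> sym_segment v \<inter> supp g \<noteq> {}"
    and "convex_body K"
  shows "measure \<mu> K powr (real CARD('n) + 1 / p - 1)
    \<le> 2 powr (real CARD('n) + 1 / p)
      * inverse (INF v\<in>P. sym_sum g v)
      * (\<Prod>k=1..CARD('n). 1 + 1 / (real k * p))
      * (\<Prod>i=1..m. P_functional \<mu> K (u i) powr (c i * (1 + 1 / (p * real CARD('n)))))"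
proof -
  note p = assms(1) and u = assms(7) and c = assms(8)
  interpret concave_homogeneous_density g p
    by unfold_locales (use assms in auto)
  note \<mu> = assms(6)
  let ?I = "{1..m}"
  define n where "n = real CARD('n)"
  define r where "r = 1 / p"
  define \<beta> where "\<beta> = 1 + r / n"
  define \<gamma> where "\<gamma> = (INF v\<in>P. sym_sum g v)"
  define Q where "Q i = P_functional \<mu> K (u i)" for i
  have n: "n \<ge> 1" by (simp add: n_def Suc_leI)
  have r: "r > 0" using p by (simp add: r_def)
  have q: "q = n + r" by (simp add: q_def n_def r_def)
  have \<beta>: "\<beta> > 0" using r n by (simp add: \<beta>_def add_pos_pos)
  have id: "(\<Sum>i\<in>?I. c i *\<^sub>R rank_one (u i) x) = x" for x using fun_cong[OF assms(9), of x] by simp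
  have sumc: "(\<Sum>i\<in>?I. c i) = n" unfolding n_def by (rule sum_weights_eq_dim[OF u id])
  have I: "?I \<noteq> {}"
  proof
    assume "?I = {}"
    then have "(\<Sum>i\<in>?I. c i) = 0" by (simp only: sum.empty)
    then show False using sumc n by linarith
  qed
  have K: "compact K" "convex K" using assms(12) by (auto simp: convex_body_def)
  have uP: "u i \<in> P" if "i \<in> ?I" for i using that subset_proj_closure[of "u ` ?I"] assms(10) by auto
  have finP: "finite P" unfolding assms(10) by (intro finite_proj_closure) simp
  have Pne: "P \<noteq> {}" using uP I by blast
  have sym_pos: "0 < sym_sum g v" if "v \<in> P" for v
    using sym_sum_pos[OF assms(11)[OF that]] g_nonneg[of v] g_nonneg[of "- v"] by (auto simp: sym_sum_def)
  \<comment> \<open>Over a finite nonempty set the infimum is attained, so positivity at each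
    direction suffices.\<close>
  have \<gamma>0: "\<gamma> > 0"
    unfolding \<gamma>_def using finP Pne sym_pos by (subst cInf_eq_Min) auto
  have \<gamma>_le: "\<gamma> \<le> sym_sum g v" if "v \<in> P" for v
    unfolding \<gamma>_def using finP that by (intro cINF_lower) auto
  define w where "w i = (if 0 < g (u i) then u i else - u i)" for i
  \<comment> \<open>Exactly one of \<open>g (u i)\<close> and \<open>g (- u i)\<close> is positive,
    so \<open>g (w i)\<close> is all of \<open>sym_sum g (u i)\<close>.\<close>
  have gw: "\<gamma> \<le> g (w i)" if i: "i \<in> ?I" for i
    using \<gamma>_le[OF uP[OF i]] sym_sum_pos[OF assms(11)[OF uP[OF i]]] g_uminus_eq_0[of "u i"] g_uminus_eq_0[of "- u i"]
    by (auto simp: w_def sym_sum_def)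
  have Q0: "0 \<le> Q i" and width: "width_mass (u i) K = 2 * q / n * Q i" if "i \<in> ?I" for i
  proof -
    have "u i \<noteq> 0" using u[OF that] by auto
    then have Q: "Q i = n / 2 * (width_mass (u i) K / q)"
      unfolding Q_def P_functional_def \<mu> n_def by (simp add: integral_mixed_measure K)
    show "0 \<le> Q i"
      unfolding Q using width_mass_nonneg[of "u i" K] q_gt_1 n by (intro mult_nonneg_nonneg divide_nonneg_nonneg) auto
    show "width_mass (u i) K = 2 * q / n * Q i"
      unfolding Q using q_gt_1 n by simp
  qed
  define B where "B = (\<Prod>k=1..CARD('n). 1 + 1 / (real k * p))"
  have B: "\<beta> ^ CARD('n) \<le> B"
    using power_le_prod_harmonic[of r "CARD('n)"] r by (simp add: B_def \<beta>_def n_def r_def mult.commute)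
  \<comment> \<open>The shift by \<eta> keeps the denominators in \<open>a\<close> positive, as only
    nonnegativity of \<open>Q i\<close> is known.\<close>
  have main: "measure \<mu> K powr (q - 1) \<le> 2 powr q * inverse \<gamma> * B * (\<Prod>i\<in>?I. (Q i + \<eta>) powr (c i * \<beta>))"
    if Kpos: "0 < measure \<mu> K" and \<eta>: "\<eta> > 0" for \<eta>
  proof -
    define a where "a i = c i / (Q i + \<eta>)" for i
    have a: "0 < a i" if "i \<in> ?I" for i using c[OF that] Q0[OF that] \<eta> by (simp add: a_def)
    have u0: "u i \<noteq> 0" if "i \<in> ?I" for i using u[OF that] by auto
    have Kpos': "0 < measure (density_measure g) K" using Kpos \<mu> by simp
    have "\<exists>Z. compact Z \<and> (\<forall>b. (\<forall>i\<in>?I. \<bar>b i\<bar> \<le> a i) \<longrightarrow> (\<Sum>i\<in>?I. b i *\<^sub>R u i) \<in> Z) \<and>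
        (0 < measure (density_measure g) Z \<longrightarrow>
          q * measure (density_measure g) K powr (1 - 1 / q) * measure (density_measure g) Z powr (1 / q)
            \<le> (\<Sum>i\<in>?I. a i * width_mass (u i) K))"
      by (rule minkowski_zonotope[OF K Kpos' _ u0 a]) simp_all
    then obtain Z where Z: "compact Z" "\<forall>b. (\<forall>i\<in>?I. \<bar>b i\<bar> \<le> a i) \<longrightarrow> (\<Sum>i\<in>?I. b i *\<^sub>R u i) \<in> Z"
        "0 < measure (density_measure g) Z \<longrightarrow>
          q * measure (density_measure g) K powr (1 - 1 / q) * measure (density_measure g) Z powr (1 / q)
            \<le> (\<Sum>i\<in>?I. a i * width_mass (u i) K)"
      by (elim exE conjE)
    define D where "D = \<gamma> * (1 / \<beta>) ^ CARD('n) * (\<Prod>i\<in>?I. (a i / c i) powr (c i * \<beta>))"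
    have ac: "a i / c i = inverse (Q i + \<eta>)" if "i \<in> ?I" for i using c[OF that] by (simp add: a_def inverse_eq_divide)
    have "0 < (a i / c i) powr (c i * \<beta>)" if "i \<in> ?I" for i using a[OF that] c[OF that] by simp
    then have D0: "D > 0" unfolding D_def using \<gamma>0 \<beta> by (intro mult_pos_pos prod_pos zero_less_power) auto
    have "ennreal D \<le> (\<integral>\<^sup>+x. ennreal (g x) * indicator Z x \<partial>lborel)"
      unfolding D_def \<beta>_def n_def
    proof (rule zonotope_integral[where u = w, OF _ _ c _ a r less_imp_le[OF \<gamma>0] g_nonneg g_cont])
      show "norm (w i) = 1" if "i \<in> ?I" for i using u[OF that] by (simp add: w_def)
      show "(\<Sum>i\<in>?I. c i *\<^sub>R rank_one (w i) x) = x" for x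
      proof -
        have "rank_one (w i) = rank_one (u i)" for i by (auto simp: w_def rank_one_def)
        then show ?thesis using id by simp
      qed
      show "Z \<in> sets borel" using Z(1) by (rule borel_compact)
      fix b assume b: "\<And>i. i \<in> ?I \<Longrightarrow> 0 < b i \<and> b i < a i"
      \<comment> \<open>The sign moves from the vector to the coefficient, whose absolute value is
        unchanged.\<close>
      have "(\<Sum>i\<in>?I. b i *\<^sub>R w i) = (\<Sum>i\<in>?I. (if 0 < g (u i) then b i else - b i) *\<^sub>R u i)"
        by (intro sum.cong) (auto simp: w_def)
      also have "\<dots> \<in> Z"
      proof (rule Z(2)[rule_format])
        fix i assume "i \<in> ?I"
        from b[OF this] show "\<bar>if 0 < g (u i) then b i else - b i\<bar> \<le> a i" by simp
      qed
      finally have "(\<Sum>i\<in>?I. b i *\<^sub>R w i) \<in> Z" .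
      moreover have "\<gamma> * (\<Sum>i\<in>?I. b i) powr r \<le> g (\<Sum>i\<in>?I. b i *\<^sub>R w i)"
        unfolding r_def using b gw \<gamma>0 I by (intro zonotope_density_ge) auto
      ultimately show "(\<Sum>i\<in>?I. b i *\<^sub>R w i) \<in> Z \<and> \<gamma> * (\<Sum>i\<in>?I. b i) powr r \<le> g (\<Sum>i\<in>?I. b i *\<^sub>R w i)" by simp
    qed simp
    also have "\<dots> = ennreal (measure \<mu> Z)"
      using Z(1) by (simp add: \<mu> emeasure_\<mu>_eq_measure[symmetric] emeasure_\<mu> borel_compact)
    finally have DZ: "D \<le> measure \<mu> Z" by (simp add: ennreal_le_iff)
    have "q * measure \<mu> K powr (1 - 1 / q) * D powr (1 / q) \<le> q * measure \<mu> K powr (1 - 1 / q) * measure \<mu> Z powr (1 / q)"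
      using q_gt_1 DZ D0 by (intro mult_left_mono powr_mono2) auto
    also have "\<dots> \<le> (\<Sum>i\<in>?I. a i * width_mass (u i) K)" using Z(3) D0 DZ \<mu> by simp
    \<comment> \<open>Each quotient of \<open>Q i\<close> by \<open>Q i + \<eta>\<close> is at most
      1, so the bound does not depend on \<eta>.\<close>
    also have "\<dots> \<le> (\<Sum>i\<in>?I. 2 * q / n * c i)"
    proof (rule sum_mono)
      fix i assume i: "i \<in> ?I"
      have "a i * width_mass (u i) K = 2 * q / n * (c i * (Q i / (Q i + \<eta>)))"
        using width[OF i] by (simp add: a_def mult_ac)
      also have "\<dots> \<le> 2 * q / n * (c i * 1)"
        using c[OF i] Q0[OF i] \<eta> q_gt_1 n by (intro mult_left_mono) auto
      finally show "a i * width_mass (u i) K \<le> 2 * q / n * c i" by simp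
    qed
    also have "\<dots> = 2 * q / n * n" by (simp only: sum_distrib_left[symmetric] sumc)
    also have "\<dots> = 2 * q" using n by simp
    finally have "measure \<mu> K powr (1 - 1 / q) * D powr (1 / q) \<le> 2" using q_gt_1 by simp
    then have "(measure \<mu> K powr (1 - 1 / q) * D powr (1 / q)) powr q \<le> 2 powr q"
      using q_gt_1 by (intro powr_mono2) auto
    moreover have "(measure \<mu> K powr (1 - 1 / q) * D powr (1 / q)) powr q = measure \<mu> K powr (q - 1) * D"
    proof -
      have "(1 - 1 / q) * q = q - 1" using q_gt_1 by (simp add: field_simps)
      then show ?thesis using D0 q_gt_1 by (simp add: powr_mult powr_powr)
    qed
    ultimately have "measure \<mu> K powr (q - 1) * D \<le> 2 powr q" by simp
    then have "measure \<mu> K powr (q - 1) \<le> 2 powr q * inverse D" using D0 by (simp add: field_simps)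
    also have "inverse D = inverse \<gamma> * \<beta> ^ CARD('n) * (\<Prod>i\<in>?I. (Q i + \<eta>) powr (c i * \<beta>))"
    proof -
      have "(\<Prod>i\<in>?I. (a i / c i) powr (c i * \<beta>)) = inverse (\<Prod>i\<in>?I. (Q i + \<eta>) powr (c i * \<beta>))"
        unfolding prod_inversef[symmetric] o_def
      proof (intro prod.cong refl)
        fix i assume i: "i \<in> ?I"
        show "(a i / c i) powr (c i * \<beta>) = inverse ((Q i + \<eta>) powr (c i * \<beta>))"
          unfolding ac[OF i] using Q0[OF i] \<eta> by (simp add: powr_def ln_inverse exp_minus)
      qed
      moreover have "inverse ((1 / \<beta>) ^ CARD('n)) = \<beta> ^ CARD('n)" by (simp add: power_one_over)
      ultimately show ?thesis by (simp only: D_def inverse_mult_distrib inverse_inverse_eq)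
    qed
    also have "2 powr q * (inverse \<gamma> * \<beta> ^ CARD('n) * (\<Prod>i\<in>?I. (Q i + \<eta>) powr (c i * \<beta>)))
      \<le> 2 powr q * (inverse \<gamma> * B * (\<Prod>i\<in>?I. (Q i + \<eta>) powr (c i * \<beta>)))"
      using B \<gamma>0 by (intro mult_left_mono mult_right_mono prod_nonneg) auto
    finally show ?thesis by (simp only: mult.assoc)
  qed
  have "measure \<mu> K powr (q - 1) \<le> 2 powr q * inverse \<gamma> * B * (\<Prod>i\<in>?I. Q i powr (c i * \<beta>))"
  proof (cases "measure \<mu> K = 0")
    case True
    \<comment> \<open>The left-hand side is 0 because \<open>0 powr x = 0\<close>, and the
      right-hand side is nonnegative.\<close>
    have "0 \<le> B" unfolding B_def using p by (intro prod_nonneg) auto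
    then show ?thesis using True \<gamma>0 by (auto intro!: mult_nonneg_nonneg prod_nonneg)
  next
    case False
    then have Kpos: "0 < measure \<mu> K" by (simp add: zero_less_measure_iff)
    have "((\<lambda>\<eta>. 2 powr q * inverse \<gamma> * B * (\<Prod>i\<in>?I. (Q i + \<eta>) powr (c i * \<beta>)))
        \<longlongrightarrow> 2 powr q * inverse \<gamma> * B * (\<Prod>i\<in>?I. (Q i + 0) powr (c i * \<beta>))) (at_right 0)"
    proof (intro tendsto_mult tendsto_const tendsto_prod)
      fix i assume i: "i \<in> ?I"
      show "((\<lambda>\<eta>. (Q i + \<eta>) powr (c i * \<beta>)) \<longlongrightarrow> (Q i + 0) powr (c i * \<beta>)) (at_right 0)"
      proof (rule tendsto_powr')
        show "((\<lambda>\<eta>. Q i + \<eta>) \<longlongrightarrow> Q i + 0) (at_right 0)" by (intro tendsto_intros)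
        have "\<forall>\<^sub>F \<eta> in at_right 0. 0 \<le> Q i + \<eta>"
          using eventually_at_right_less[of "0::real"] by eventually_elim (use Q0[OF i] in simp)
        \<comment> \<open>If \<open>Q i = 0\<close>, continuity of \<open>powr\<close> there relies
          on the positive exponent and on approach from the right.\<close>
        then show "Q i + 0 \<noteq> 0 \<or> 0 < c i * \<beta> \<and> (\<forall>\<^sub>F \<eta> in at_right 0. 0 \<le> Q i + \<eta>)"
          using c[OF i] \<beta> by simp
      qed (rule tendsto_const)
    qed
    moreover have "\<forall>\<^sub>F \<eta> in at_right 0. measure \<mu> K powr (q - 1)
        \<le> 2 powr q * inverse \<gamma> * B * (\<Prod>i\<in>?I. (Q i + \<eta>) powr (c i * \<beta>))"
      using eventually_at_right_less[of "0::real"] by eventually_elim (rule main[OF Kpos])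
    ultimately have "measure \<mu> K powr (q - 1) \<le> 2 powr q * inverse \<gamma> * B * (\<Prod>i\<in>?I. (Q i + 0) powr (c i * \<beta>))"
      by (rule tendsto_lowerbound) (rule trivial_limit_at_right_real)
    then show ?thesis by (simp only: add_0_right)
  qed
  then show ?thesis
    by (simp add: q n_def r_def \<beta>_def \<gamma>_def B_def Q_def mult.commute[of p])
qed

end
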